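(* Let $K$ be a field and $X$ a finite set with $|X|=r\ge1$. If a ring $B$ is elementarily equivalent to $\mathbb{A}^0_K(X)$, then $B$ is an associative algebra over a field $K_1$ such that $K_1\equiv K$ and, for every positive integer $n$, $B/B^n\equiv C_n$, where $C_n=\mathbb{A}^0_{K_1}(X)/(\mathbb{A}^0_{K_1}(X))^n$ is the free $n$-nilpotent associative algebra with basis $X$ over $K_1$. In particular, if $B$ is residually nilpotent, then $B$ is para-free.
   Context: $\mathbb{A}^0_F(X)$ denotes the free associative algebra without unity over a field $F$ with basis $X$; rings are considered in the language $\{+,\cdot,0\}$. For an associative ring $A$ and $n\ge1$, $A^n$ is the additive subgroup (a two-sided ideal) generated by all products $a_1\cdots a_n$ with $a_i\in A$. $A$ is residually nilpotent if $\bigcap_{n\ge1}A^n=0$. A $K_1$-algebra $R$ is para-free (relative to $X$) if it is residually nilpotent and $R/R^n\cong \mathbb{A}^0_{K_1}(X)/(\mathbb{A}^0_{K_1}(X))^n$ as $K_1$-algebras for every $n$. *)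

theory Defs
  imports "HOL-Algebra.QuotRing" "HOL-Algebra.Module" "HOL-Algebra.Generated_Groups"
begin

section \<open>Rings and algebras without unity\<close>

text \<open>
  Rings without unity live on the record type of \<^theory>\<open>HOL-Algebra.Ring\<close>; the field
  \<open>one\<close> is never consulted, neither by the axioms nor by the first-order semantics below.
  Multiplication is not assumed associative in \<open>nonunital_ring\<close>.
\<close>

locale nonunital_ring = abelian_group R for R (structure) +
  assumes mult_closed: "\<lbrakk>x \<in> carrier R; y \<in> carrier R\<rbrakk> \<Longrightarrow> x \<otimes> y \<in> carrier R"
    and distrib_right: "\<lbrakk>x \<in> carrier R; y \<in> carrier R; z \<in> carrier R\<rbrakk>
      \<Longrightarrow> (x \<oplus> y) \<otimes> z = x \<otimes> z \<oplus> y \<otimes> z"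
    and distrib_left: "\<lbrakk>x \<in> carrier R; y \<in> carrier R; z \<in> carrier R\<rbrakk>
      \<Longrightarrow> z \<otimes> (x \<oplus> y) = z \<otimes> x \<oplus> z \<otimes> y"

locale assoc_nonunital_ring = nonunital_ring +
  assumes mult_assoc: "\<lbrakk>x \<in> carrier R; y \<in> carrier R; z \<in> carrier R\<rbrakk>
      \<Longrightarrow> (x \<otimes> y) \<otimes> z = x \<otimes> (y \<otimes> z)"

text \<open>
  The library's locale \<open>algebra\<close> is restricted to commutative algebras with unity.
  For a nonzero algebra \<open>A\<close> and \<open>x \<noteq> \<zero>\<close>, the map \<open>a \<mapsto> a \<odot> x\<close> is injective, so up to
  isomorphism every field of scalars has its elements in the type of elements of \<open>A\<close>;
  hence an existential statement over fields of scalars may be confined to that type.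
\<close>

locale assoc_algebra = field K + module K A + assoc_nonunital_ring A
  for K (structure) and A (structure) +
  assumes smult_mult_left: "\<lbrakk>a \<in> carrier K; x \<in> carrier A; y \<in> carrier A\<rbrakk>
      \<Longrightarrow> (a \<odot>\<^bsub>A\<^esub> x) \<otimes>\<^bsub>A\<^esub> y = a \<odot>\<^bsub>A\<^esub> (x \<otimes>\<^bsub>A\<^esub> y)"
    and smult_mult_right: "\<lbrakk>a \<in> carrier K; x \<in> carrier A; y \<in> carrier A\<rbrakk>
      \<Longrightarrow> x \<otimes>\<^bsub>A\<^esub> (a \<odot>\<^bsub>A\<^esub> y) = a \<odot>\<^bsub>A\<^esub> (x \<otimes>\<^bsub>A\<^esub> y)"

definition with_smult :: "'a ring \<Rightarrow> ('k \<Rightarrow> 'a \<Rightarrow> 'a) \<Rightarrow> ('k, 'a) module" where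
  "with_smult R s = ring.extend R \<lparr>smult = s\<rparr>"

definition algebra_isomorphic ::
    "('k, 'm) ring_scheme \<Rightarrow> ('k, 'a, 'n) module_scheme \<Rightarrow> ('k, 'b, 'l) module_scheme \<Rightarrow> bool" where
  "algebra_isomorphic K A B \<longleftrightarrow> (\<exists>h. bij_betw h (carrier A) (carrier B) \<and>
     (\<forall>x \<in> carrier A. \<forall>y \<in> carrier A.
        h (x \<oplus>\<^bsub>A\<^esub> y) = h x \<oplus>\<^bsub>B\<^esub> h y \<and> h (x \<otimes>\<^bsub>A\<^esub> y) = h x \<otimes>\<^bsub>B\<^esub> h y) \<and>
     (\<forall>a \<in> carrier K. \<forall>x \<in> carrier A. h (a \<odot>\<^bsub>A\<^esub> x) = a \<odot>\<^bsub>B\<^esub> h x))"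

definition quotient_algebra ::
    "('k, 'a, 'm) module_scheme \<Rightarrow> 'a set \<Rightarrow> ('k, 'a set) module" where
  "quotient_algebra A I =
     with_smult (A Quot I) (\<lambda>a S. \<Union>x\<in>S. I +>\<^bsub>A\<^esub> (a \<odot>\<^bsub>A\<^esub> x))"


section \<open>Powers of a ring\<close>

text \<open>The empty product does not exist in a ring without unity.\<close>

fun nonempty_prod :: "('a, 'm) ring_scheme \<Rightarrow> 'a list \<Rightarrow> 'a" where
  "nonempty_prod R [] = undefined"
| "nonempty_prod R [a] = a"
| "nonempty_prod R (a # b # bs) = a \<otimes>\<^bsub>R\<^esub> nonempty_prod R (b # bs)"

definition ring_power :: "('a, 'm) ring_scheme \<Rightarrow> nat \<Rightarrow> 'a set" where
  "ring_power R n = generate (add_monoid R)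
     {nonempty_prod R as | as. length as = n \<and> set as \<subseteq> carrier R}"

definition residually_nilpotent :: "('a, 'm) ring_scheme \<Rightarrow> bool" where
  "residually_nilpotent R \<longleftrightarrow> (\<Inter>n\<in>{1..}. ring_power R n) = {\<zero>\<^bsub>R\<^esub>}"


section \<open>Free associative algebras without unity\<close>

text \<open>
  An element is the coefficient function of a finite linear combination of nonempty words
  over \<open>Xs\<close>; the product extends concatenation of words bilinearly.
\<close>

definition free_algebra :: "('k, 'm) ring_scheme \<Rightarrow> 'x set \<Rightarrow> ('k, 'x list \<Rightarrow> 'k) module" where
  "free_algebra K Xs =
     \<lparr>carrier = {f. (\<forall>w. f w \<in> carrier K) \<and> finite {w. f w \<noteq> \<zero>\<^bsub>K\<^esub>} \<and>
                    {w. f w \<noteq> \<zero>\<^bsub>K\<^esub>} \<subseteq> lists Xs - {[]}},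
      mult = (\<lambda>f g w. \<Oplus>\<^bsub>K\<^esub>i\<in>{..length w}. (f (take i w) \<otimes>\<^bsub>K\<^esub> g (drop i w))),
      one = undefined,
      zero = (\<lambda>w. \<zero>\<^bsub>K\<^esub>),
      add = (\<lambda>f g w. f w \<oplus>\<^bsub>K\<^esub> g w),
      smult = (\<lambda>a f w. a \<otimes>\<^bsub>K\<^esub> f w)\<rparr>"

definition free_nilpotent_algebra ::
    "('k, 'm) ring_scheme \<Rightarrow> 'x set \<Rightarrow> nat \<Rightarrow> ('k, ('x list \<Rightarrow> 'k) set) module" where
  "free_nilpotent_algebra K Xs n =
     quotient_algebra (free_algebra K Xs) (ring_power (free_algebra K Xs) n)"

definition para_free ::
    "('k, 'm) ring_scheme \<Rightarrow> 'x set \<Rightarrow> ('k, 'a, 'n) module_scheme \<Rightarrow> bool" where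
  "para_free K Xs R \<longleftrightarrow> assoc_algebra K R \<and> residually_nilpotent R \<and>
     (\<forall>n\<ge>1. algebra_isomorphic K
        (quotient_algebra R (ring_power R n)) (free_nilpotent_algebra K Xs n))"


section \<open>Elementary equivalence in the language of addition, multiplication and zero\<close>

datatype ring_term = Var nat | Zero | Plus ring_term ring_term | Times ring_term ring_term

datatype ring_formula =
    Eq ring_term ring_term
  | Neg ring_formula
  | Conj ring_formula ring_formula
  | All nat ring_formula

primrec term_vars :: "ring_term \<Rightarrow> nat set" where
  "term_vars (Var i) = {i}"
| "term_vars Zero = {}"
| "term_vars (Plus s t) = term_vars s \<union> term_vars t"
| "term_vars (Times s t) = term_vars s \<union> term_vars t"

primrec free_vars :: "ring_formula \<Rightarrow> nat set" where
  "free_vars (Eq s t) = term_vars s \<union> term_vars t"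
| "free_vars (Neg p) = free_vars p"
| "free_vars (Conj p q) = free_vars p \<union> free_vars q"
| "free_vars (All i p) = free_vars p - {i}"

primrec term_val :: "('a, 'm) ring_scheme \<Rightarrow> (nat \<Rightarrow> 'a) \<Rightarrow> ring_term \<Rightarrow> 'a" where
  "term_val R v (Var i) = v i"
| "term_val R v Zero = \<zero>\<^bsub>R\<^esub>"
| "term_val R v (Plus s t) = term_val R v s \<oplus>\<^bsub>R\<^esub> term_val R v t"
| "term_val R v (Times s t) = term_val R v s \<otimes>\<^bsub>R\<^esub> term_val R v t"

primrec satisfies :: "('a, 'm) ring_scheme \<Rightarrow> (nat \<Rightarrow> 'a) \<Rightarrow> ring_formula \<Rightarrow> bool" where
  "satisfies R v (Eq s t) \<longleftrightarrow> term_val R v s = term_val R v t"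
| "satisfies R v (Neg p) \<longleftrightarrow> \<not> satisfies R v p"
| "satisfies R v (Conj p q) \<longleftrightarrow> satisfies R v p \<and> satisfies R v q"
| "satisfies R v (All i p) \<longleftrightarrow> (\<forall>a \<in> carrier R. satisfies R (v(i := a)) p)"

text \<open>The truth value of a sentence does not depend on the assignment.\<close>

definition holds_in :: "('a, 'm) ring_scheme \<Rightarrow> ring_formula \<Rightarrow> bool" where
  "holds_in R p \<longleftrightarrow> (\<forall>v. range v \<subseteq> carrier R \<longrightarrow> satisfies R v p)"

text \<open>
  Fields are compared in this language too; this is no restriction, because the unity of a
  field is definable from multiplication.
\<close>

definition elementarily_equivalent ::
    "('a, 'm) ring_scheme \<Rightarrow> ('b, 'n) ring_scheme \<Rightarrow> bool"  (infix "\<equiv>\<^sub>e" 50) where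
  "R \<equiv>\<^sub>e S \<longleftrightarrow> (\<forall>p. free_vars p = {} \<longrightarrow> holds_in R p = holds_in S p)"

end

(*
  In the free algebra F, an element y is a scalar multiple of x \<noteq> 0 iff y = 0 or F y = F x:
  comparing top degrees in e y = a x for a letter e forces a to be linear.  Hence K b is definable
  from b, the action of f = \<phi> b on x is determined by (\<phi> x) b = x f, and the axioms of the algebra
  over this field of scalars are first-order, so they pass to B.  Homogenizing terms (a term of
  degree d takes values in K b^d) translates sentences about K into sentences about F, whence the
  scalar fields of B and F are elementarily equivalent.

  Also first-order is the existence of letters e_1, ..., e_r such that every f is uniquely
  \<Sum> \<alpha>_i e_i + e_i f_i with scalars \<alpha>_i.  Iterating this decomposition gives a coefficient for every
  word; the n-th power of the algebra consists of the elements whose coefficients vanish on all words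
  of length < n, and the quotient is the algebra of truncated noncommutative polynomials.  Thus
  B/B^n is even isomorphic to C_n.
*)
theory Submission
  imports Defs "HOL-Algebra.Multiplicative_Group"
begin

section \<open>First-order definability\<close>

text \<open>A sentence cannot name a particular element, so no property may depend on a
  distinguished b. Each property of F is therefore written as a formula with the single parameter b,
  shown to hold for every nonzero b of F, and transferred as a universal sentence; then any nonzero
  element of B will do. Without unity a scalar \<phi> is visible only through \<phi> b, and the
  product of two such elements lies in K b^2 instead of K b. This forces the homogenization, the
  indirect equation (\<phi> x) b = x f, and a letter decomposition multiplied by b. It also makes
  the scalars of B elements of B, so the new field lives in the type of B. The letter decomposition
  is weaker than freeness: formal power series without constant term have it too, and it says
  nothing about the intersection of all powers. But n steps of it control everything modulo the n-th
  power. So B is never compared with a free algebra directly: both are mapped onto the same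
  truncated algebra.\<close>

lemma term_val_cong: "(\<And>i. i \<in> term_vars t \<Longrightarrow> v i = u i) \<Longrightarrow> term_val R v t = term_val R u t"
  by (induction t) auto

lemma satisfies_cong:
  "(\<And>i. i \<in> free_vars p \<Longrightarrow> v i = u i) \<Longrightarrow> satisfies R v p \<longleftrightarrow> satisfies R u p"
proof (induction p arbitrary: v u)
  case (Eq s t)
  then have "term_val R v s = term_val R u s" "term_val R v t = term_val R u t"
    by (auto intro!: term_val_cong)
  then show ?case by simp
next
  case (All i p)
  have "satisfies R (v(i := a)) p \<longleftrightarrow> satisfies R (u(i := a)) p" for a
    using All.prems by (intro All.IH) auto
  then show ?case by simp
next
  case (Conj p q)
  have "satisfies R v p \<longleftrightarrow> satisfies R u p" "satisfies R v q \<longleftrightarrow> satisfies R u q"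
    using Conj.prems by (auto intro!: Conj.IH)
  then show ?case by simp
next
  case (Neg p)
  have "satisfies R v p \<longleftrightarrow> satisfies R u p"
    using Neg.prems by (auto intro!: Neg.IH)
  then show ?case by simp
qed

section \<open>Derived connectives and blocks of quantifiers of variable length\<close>

definition Disj :: "ring_formula \<Rightarrow> ring_formula \<Rightarrow> ring_formula" where
  "Disj p q = Neg (Conj (Neg p) (Neg q))"

definition Imp :: "ring_formula \<Rightarrow> ring_formula \<Rightarrow> ring_formula" where
  "Imp p q = Neg (Conj p (Neg q))"

definition Ex :: "nat \<Rightarrow> ring_formula \<Rightarrow> ring_formula" where
  "Ex i p = Neg (All i (Neg p))"

lemma satisfies_connectives [simp]:
  "satisfies R v (Disj p q) \<longleftrightarrow> satisfies R v p \<or> satisfies R v q"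
  "satisfies R v (Imp p q) \<longleftrightarrow> (satisfies R v p \<longrightarrow> satisfies R v q)"
  "satisfies R v (Ex i p) \<longleftrightarrow> (\<exists>a\<in>carrier R. satisfies R (v(i := a)) p)"
  by (auto simp: Disj_def Imp_def Ex_def)

lemma free_vars_connectives [simp]:
  "free_vars (Disj p q) = free_vars p \<union> free_vars q"
  "free_vars (Imp p q) = free_vars p \<union> free_vars q"
  "free_vars (Ex i p) = free_vars p - {i}"
  by (auto simp: Disj_def Imp_def Ex_def)

primrec All_block :: "nat \<Rightarrow> nat \<Rightarrow> ring_formula \<Rightarrow> ring_formula" where
  "All_block k 0 p = p"
| "All_block k (Suc n) p = All k (All_block (Suc k) n p)"

primrec Ex_block :: "nat \<Rightarrow> nat \<Rightarrow> ring_formula \<Rightarrow> ring_formula" where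
  "Ex_block k 0 p = p"
| "Ex_block k (Suc n) p = Ex k (Ex_block (Suc k) n p)"

primrec Conj_block :: "nat \<Rightarrow> (nat \<Rightarrow> ring_formula) \<Rightarrow> ring_formula" where
  "Conj_block 0 p = Eq Zero Zero"
| "Conj_block (Suc n) p = Conj (p n) (Conj_block n p)"

primrec Plus_block :: "nat \<Rightarrow> (nat \<Rightarrow> ring_term) \<Rightarrow> ring_term" where
  "Plus_block 0 t = Zero"
| "Plus_block (Suc n) t = Plus (t n) (Plus_block n t)"

text \<open>A block of n quantifiers is read as one quantifier over total functions \<open>g\<close>
  restricted only on the first n arguments. The number of letters is a parameter, so the formulas
  cannot be written out with a fixed number of quantifiers.\<close>

definition upd_block :: "(nat \<Rightarrow> 'a) \<Rightarrow> nat \<Rightarrow> nat \<Rightarrow> (nat \<Rightarrow> 'a) \<Rightarrow> nat \<Rightarrow> 'a" where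
  "upd_block v k n g i = (if k \<le> i \<and> i < k + n then g (i - k) else v i)"

lemma upd_block_0: "upd_block v k 0 g = v"
  unfolding upd_block_def by (rule ext) auto

lemma upd_block_Suc: "upd_block (v(k := g 0)) (Suc k) n (\<lambda>i. g (Suc i)) = upd_block v k (Suc n) g"
proof
  fix i
  show "upd_block (v(k := g 0)) (Suc k) n (\<lambda>i. g (Suc i)) i = upd_block v k (Suc n) g i"
    by (cases "k < i") (auto simp: upd_block_def Suc_diff_le[symmetric])
qed

lemma satisfies_All_block [simp]:
  "satisfies R v (All_block k n p) \<longleftrightarrow>
    (\<forall>g. (\<forall>i<n. g i \<in> carrier R) \<longrightarrow> satisfies R (upd_block v k n g) p)"
proof (induction n arbitrary: k v)
  case 0
  then show ?case by (simp add: upd_block_0)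
next
  case (Suc n)
  have "(\<forall>a\<in>carrier R. \<forall>g. (\<forall>i<n. g i \<in> carrier R) \<longrightarrow>
           satisfies R (upd_block (v(k := a)) (Suc k) n g) p) \<longleftrightarrow>
        (\<forall>g. (\<forall>i<Suc n. g i \<in> carrier R) \<longrightarrow> satisfies R (upd_block v k (Suc n) g) p)"
    (is "?L \<longleftrightarrow> ?R")
  proof
    assume ?L
    show ?R
    proof (intro allI impI)
      fix g :: "nat \<Rightarrow> _" assume g: "\<forall>i<Suc n. g i \<in> carrier R"
      have "satisfies R (upd_block (v(k := g 0)) (Suc k) n (\<lambda>i. g (Suc i))) p"
        using \<open>?L\<close> g by auto
      then show "satisfies R (upd_block v k (Suc n) g) p" by (simp only: upd_block_Suc)
    qed
  next
    assume R: ?R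
    show ?L
    proof (intro ballI allI impI)
      fix a and g :: "nat \<Rightarrow> _" assume a: "a \<in> carrier R" and g: "\<forall>i<n. g i \<in> carrier R"
      have "satisfies R (upd_block v k (Suc n) (case_nat a g)) p"
        using a g by (intro R[rule_format]) (auto split: nat.split)
      then show "satisfies R (upd_block (v(k := a)) (Suc k) n g) p"
        by (simp flip: upd_block_Suc)
    qed
  qed
  then show ?case by (simp only: All_block.simps satisfies.simps Suc.IH)
qed

lemma Ex_block_All_block: "satisfies R v (Ex_block k n p) \<longleftrightarrow> \<not> satisfies R v (All_block k n (Neg p))"
  by (induction n arbitrary: k v) (simp_all del: satisfies_All_block)

lemma satisfies_Ex_block [simp]:
  "satisfies R v (Ex_block k n p) \<longleftrightarrow>
    (\<exists>g. (\<forall>i<n. g i \<in> carrier R) \<and> satisfies R (upd_block v k n g) p)"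
  by (auto simp: Ex_block_All_block)

lemma satisfies_Conj_block [simp]:
  "satisfies R v (Conj_block n p) \<longleftrightarrow> (\<forall>i<n. satisfies R v (p i))"
  by (induction n) (auto simp: less_Suc_eq)

lemma free_vars_blocks [simp]:
  "free_vars (All_block k n p) = free_vars p - {k..<k+n}"
  "free_vars (Ex_block k n p) = free_vars p - {k..<k+n}"
  "free_vars (Conj_block n q) = (\<Union>i\<in>{..<n}. free_vars (q i))"
  "term_vars (Plus_block n t) = (\<Union>i\<in>{..<n}. term_vars (t i))"
  by (induction n arbitrary: k) (auto simp: lessThan_Suc)

text \<open>The transferred sentence says that \<open>p\<close> holds at every nonzero value of
  variable 0. This is why the premise on \<open>S\<close> covers all nonzero elements, while the
  conclusion can be used at a single chosen one. Only variable 0 is free, so one assignment with the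
  right value there decides the matter.\<close>

lemma elementarily_equivalent_transfer:
  assumes "R \<equiv>\<^sub>e S" and free: "free_vars p \<subseteq> {0}"
    and S: "\<And>x. x \<in> carrier S \<Longrightarrow> x \<noteq> \<zero>\<^bsub>S\<^esub> \<Longrightarrow> \<exists>v. v 0 = x \<and> satisfies S v p"
    and b: "v 0 \<in> carrier R" "v 0 \<noteq> \<zero>\<^bsub>R\<^esub>"
  shows "satisfies R v p"
proof -
  let ?q = "All 0 (Imp (Neg (Eq (Var 0) Zero)) p)"
  have "holds_in S ?q"
    unfolding holds_in_def
  proof (intro allI impI)
    fix v :: "nat \<Rightarrow> _"
    have "satisfies S (v(0 := x)) p" if x: "x \<in> carrier S" "x \<noteq> \<zero>\<^bsub>S\<^esub>" for x
    proof -
      obtain u where "u 0 = x" "satisfies S u p" using S x by blast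
      then show ?thesis using satisfies_cong[of p u "v(0 := x)" S] free
        by (metis (no_types, lifting) fun_upd_same singletonD subsetD)
    qed
    then show "satisfies S v ?q" by simp
  qed
  moreover have "free_vars ?q = {}" using free by auto
  ultimately have "holds_in R ?q" using assms(1) by (simp add: elementarily_equivalent_def)
  moreover have "range (\<lambda>_::nat. v 0) \<subseteq> carrier R" using b by auto
  ultimately have "satisfies R (\<lambda>_. v 0) ?q" unfolding holds_in_def by blast
  then have "satisfies R ((\<lambda>i. v 0)(0 := v 0)) p" using b by simp
  then show ?thesis using satisfies_cong[of p v "(\<lambda>i. v 0)(0 := v 0)" R] free by auto
qed

section \<open>Invariance of truth under isomorphism\<close>

lemma term_val_isomorphic:
  assumes hom: "\<And>x y. x \<in> carrier R \<Longrightarrow> y \<in> carrier R \<Longrightarrow> h (x \<oplus>\<^bsub>R\<^esub> y) = h x \<oplus>\<^bsub>S\<^esub> h y"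
    "\<And>x y. x \<in> carrier R \<Longrightarrow> y \<in> carrier R \<Longrightarrow> h (x \<otimes>\<^bsub>R\<^esub> y) = h x \<otimes>\<^bsub>S\<^esub> h y"
    and zero: "h \<zero>\<^bsub>R\<^esub> = \<zero>\<^bsub>S\<^esub>"
    and R: "\<zero>\<^bsub>R\<^esub> \<in> carrier R"
      "\<And>x y. x \<in> carrier R \<Longrightarrow> y \<in> carrier R \<Longrightarrow> x \<oplus>\<^bsub>R\<^esub> y \<in> carrier R \<and> x \<otimes>\<^bsub>R\<^esub> y \<in> carrier R"
    and v: "range v \<subseteq> carrier R"
  shows "term_val R v t \<in> carrier R \<and> h (term_val R v t) = term_val S (h \<circ> v) t"
  using v by (induction t) (auto simp: hom zero R)

lemma satisfies_isomorphic:
  assumes bij: "bij_betw h (carrier R) (carrier S)"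
    and hom: "\<And>x y. x \<in> carrier R \<Longrightarrow> y \<in> carrier R \<Longrightarrow> h (x \<oplus>\<^bsub>R\<^esub> y) = h x \<oplus>\<^bsub>S\<^esub> h y"
    "\<And>x y. x \<in> carrier R \<Longrightarrow> y \<in> carrier R \<Longrightarrow> h (x \<otimes>\<^bsub>R\<^esub> y) = h x \<otimes>\<^bsub>S\<^esub> h y"
    and zero: "h \<zero>\<^bsub>R\<^esub> = \<zero>\<^bsub>S\<^esub>"
    and R: "\<zero>\<^bsub>R\<^esub> \<in> carrier R"
      "\<And>x y. x \<in> carrier R \<Longrightarrow> y \<in> carrier R \<Longrightarrow> x \<oplus>\<^bsub>R\<^esub> y \<in> carrier R \<and> x \<otimes>\<^bsub>R\<^esub> y \<in> carrier R"
    and v: "range v \<subseteq> carrier R"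
  shows "satisfies R v p \<longleftrightarrow> satisfies S (h \<circ> v) p"
  using v
proof (induction p arbitrary: v)
  case (Eq s t)
  note tv = term_val_isomorphic[where h = h, OF hom zero R Eq.prems]
  have "inj_on h (carrier R)" using bij by (simp add: bij_betw_def)
  then show ?case using tv[of s] tv[of t] by (metis inj_on_eq_iff satisfies.simps(1))
next
  case (All i p)
  have upd: "h \<circ> v(i := a) = (h \<circ> v)(i := h a)" for a by auto
  have "carrier S = h ` carrier R" using bij by (simp add: bij_betw_def)
  moreover have "satisfies R (v(i := a)) p \<longleftrightarrow> satisfies S ((h \<circ> v)(i := h a)) p"
    if "a \<in> carrier R" for a
  proof -
    have "range (v(i := a)) \<subseteq> carrier R" using All.prems that by auto
    from All.IH[OF this] show ?thesis by (simp only: upd)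
  qed
  ultimately show ?case by (metis (no_types, lifting) imageE imageI satisfies.simps(4))
qed auto

lemma isomorphic_imp_elementarily_equivalent:
  assumes bij: "bij_betw h (carrier R) (carrier S)"
    and hom: "\<And>x y. x \<in> carrier R \<Longrightarrow> y \<in> carrier R \<Longrightarrow> h (x \<oplus>\<^bsub>R\<^esub> y) = h x \<oplus>\<^bsub>S\<^esub> h y"
    "\<And>x y. x \<in> carrier R \<Longrightarrow> y \<in> carrier R \<Longrightarrow> h (x \<otimes>\<^bsub>R\<^esub> y) = h x \<otimes>\<^bsub>S\<^esub> h y"
    and zero: "h \<zero>\<^bsub>R\<^esub> = \<zero>\<^bsub>S\<^esub>"
    and R: "\<zero>\<^bsub>R\<^esub> \<in> carrier R"
      "\<And>x y. x \<in> carrier R \<Longrightarrow> y \<in> carrier R \<Longrightarrow> x \<oplus>\<^bsub>R\<^esub> y \<in> carrier R \<and> x \<otimes>\<^bsub>R\<^esub> y \<in> carrier R"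
  shows "R \<equiv>\<^sub>e S"
proof -
  have "holds_in R p \<longleftrightarrow> holds_in S p" for p
    unfolding holds_in_def
  proof safe
    fix u :: "nat \<Rightarrow> _" assume *: "\<forall>v. range v \<subseteq> carrier R \<longrightarrow> satisfies R v p" and u: "range u \<subseteq> carrier S"
    define v where "v = inv_into (carrier R) h \<circ> u"
    have "range v \<subseteq> carrier R"
      using u bij_betwE[OF bij_betw_inv_into[OF bij]] by (auto simp: v_def)
    moreover have "h \<circ> v = u"
      using u bij_betw_inv_into_right[OF bij] by (auto simp: v_def fun_eq_iff image_subset_iff)
    ultimately show "satisfies S u p"
      using * satisfies_isomorphic[where h = h, OF bij hom zero R] by metis
  next
    fix v :: "nat \<Rightarrow> _" assume *: "\<forall>u. range u \<subseteq> carrier S \<longrightarrow> satisfies S u p" and v: "range v \<subseteq> carrier R"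
    have "range (h \<circ> v) \<subseteq> carrier S" using v bij_betwE[OF bij] by auto
    then show "satisfies R v p"
      using * satisfies_isomorphic[where h = h, OF bij hom zero R v] by blast
  qed
  then show ?thesis by (simp add: elementarily_equivalent_def)
qed

section \<open>Definable scalars\<close>

text \<open>This is equality of the left ideals R f and R b. Inclusion in one direction alone would
  admit every left multiple of b. Multiples are compared instead of elements because without unity f
  need not lie in R f. The zero scalar generates a different ideal and is listed separately.\<close>

definition proportional :: "('a, 'm) ring_scheme \<Rightarrow> 'a \<Rightarrow> 'a \<Rightarrow> bool" where
  "proportional R b f \<longleftrightarrow> f = \<zero>\<^bsub>R\<^esub> \<or>
    (\<forall>a\<in>carrier R. \<exists>c\<in>carrier R. a \<otimes>\<^bsub>R\<^esub> f = c \<otimes>\<^bsub>R\<^esub> b) \<and>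
    (\<forall>a\<in>carrier R. \<exists>c\<in>carrier R. a \<otimes>\<^bsub>R\<^esub> b = c \<otimes>\<^bsub>R\<^esub> f)"

text \<open>The bound variables exceed i + j, hence are distinct from both parameters whatever i and
  j are.\<close>

definition Proportional :: "nat \<Rightarrow> nat \<Rightarrow> ring_formula" where
  "Proportional i j = Disj (Eq (Var j) Zero)
     (Conj (All (Suc (i + j)) (Ex (Suc (Suc (i + j)))
              (Eq (Times (Var (Suc (i + j))) (Var j)) (Times (Var (Suc (Suc (i + j)))) (Var i)))))
           (All (Suc (i + j)) (Ex (Suc (Suc (i + j)))
              (Eq (Times (Var (Suc (i + j))) (Var i)) (Times (Var (Suc (Suc (i + j)))) (Var j))))))"

lemma satisfies_Proportional [simp]: "satisfies R v (Proportional i j) \<longleftrightarrow> proportional R (v i) (v j)"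
  by (simp add: Proportional_def proportional_def)

lemma free_vars_Proportional [simp]: "free_vars (Proportional i j) = {i, j}"
  by (auto simp: Proportional_def)

text \<open>The situation in which the scalars are definable from b. It is met on both sides: by the
  free algebra with every nonzero b, and by B once its scalars are reconstructed. Integrality keeps
  all powers of b nonzero and lets b be cancelled.\<close>

locale scalar_domain = assoc_algebra +
  fixes b
  assumes b_closed: "b \<in> carrier A" and b_nonzero: "b \<noteq> \<zero>\<^bsub>A\<^esub>"
    and integral: "\<lbrakk>x \<in> carrier A; y \<in> carrier A; x \<otimes>\<^bsub>A\<^esub> y = \<zero>\<^bsub>A\<^esub>\<rbrakk> \<Longrightarrow> x = \<zero>\<^bsub>A\<^esub> \<or> y = \<zero>\<^bsub>A\<^esub>"
    and proportional_iff: "f \<in> carrier A \<Longrightarrow>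
      proportional A b f \<longleftrightarrow> (\<exists>a\<in>carrier K. f = a \<odot>\<^bsub>A\<^esub> b)"

text \<open>
  Homogenization: \<open>homogenize t\<close> takes values in \<open>K b\<^sup>d\<^sup>+\<^sup>1\<close> with \<open>d = hom_deg t\<close>, so that products
  of scalars become products in the algebra. Variable \<open>0\<close> stands for \<open>b\<close>, and \<open>Power_b d\<close> for
  \<open>b\<^sup>d\<^sup>+\<^sup>1\<close>.
\<close>

fun Power_b :: "nat \<Rightarrow> ring_term" where
  "Power_b 0 = Var 0"
| "Power_b (Suc d) = Times (Var 0) (Power_b d)"

primrec hom_deg :: "ring_term \<Rightarrow> nat" where
  "hom_deg (Var i) = 0"
| "hom_deg Zero = 0"
| "hom_deg (Plus s t) = Suc (hom_deg s + hom_deg t)"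
| "hom_deg (Times s t) = Suc (hom_deg s + hom_deg t)"

primrec homogenize :: "ring_term \<Rightarrow> ring_term" where
  "homogenize (Var i) = Var (Suc i)"
| "homogenize Zero = Zero"
| "homogenize (Plus s t) = Plus (Times (homogenize s) (Power_b (hom_deg t)))
     (Times (homogenize t) (Power_b (hom_deg s)))"
| "homogenize (Times s t) = Times (homogenize s) (homogenize t)"

text \<open>The two sides of an equation may lie in multiples of different powers of b, so each is
  multiplied by the power belonging to the other. Quantifiers are relativized to the multiples of b,
  and variables move up by one because variable 0 is reserved for b.\<close>

primrec scalar_translation :: "ring_formula \<Rightarrow> ring_formula" where
  "scalar_translation (Eq s t) = Eq (Times (homogenize s) (Power_b (hom_deg t)))
     (Times (homogenize t) (Power_b (hom_deg s)))"
| "scalar_translation (Neg p) = Neg (scalar_translation p)"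
| "scalar_translation (Conj p q) = Conj (scalar_translation p) (scalar_translation q)"
| "scalar_translation (All i p) = All (Suc i) (Imp (Proportional 0 (Suc i)) (scalar_translation p))"

lemma term_vars_Power_b [simp]: "term_vars (Power_b d) = {0}"
  by (induction d) auto

lemma term_vars_homogenize: "term_vars (homogenize t) \<subseteq> insert 0 (Suc ` term_vars t)"
  by (induction t) auto

lemma free_vars_scalar_translation: "free_vars (scalar_translation p) \<subseteq> insert 0 (Suc ` free_vars p)"
proof (induction p)
  case (Eq s t)
  then show ?case using term_vars_homogenize[of s] term_vars_homogenize[of t] by auto
qed auto

context scalar_domain
begin

primrec bpow :: "nat \<Rightarrow> 'c" where
  "bpow 0 = b"
| "bpow (Suc d) = b \<otimes>\<^bsub>A\<^esub> bpow d"

lemma bpow_closed [simp]: "bpow d \<in> carrier A"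
  by (induction d) (auto simp: b_closed mult_closed)

lemma bpow_nonzero [simp]: "bpow d \<noteq> \<zero>\<^bsub>A\<^esub>"
proof (induction d)
  case 0
  then show ?case by (simp add: b_nonzero)
next
  case (Suc d)
  then show ?case using integral[OF b_closed bpow_closed] b_nonzero by auto
qed

lemma bpow_mult: "bpow d \<otimes>\<^bsub>A\<^esub> bpow k = bpow (Suc (d + k))"
proof (induction d)
  case (Suc d)
  have "bpow (Suc d) \<otimes>\<^bsub>A\<^esub> bpow k = b \<otimes>\<^bsub>A\<^esub> (bpow d \<otimes>\<^bsub>A\<^esub> bpow k)"
    by (simp add: mult_assoc b_closed)
  also have "\<dots> = bpow (Suc (Suc d + k))" unfolding Suc by simp
  finally show ?case .
qed simp

lemma smult_bpow_mult:
  "\<lbrakk>x \<in> carrier K; y \<in> carrier K\<rbrakk> \<Longrightarrow>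
    (x \<odot>\<^bsub>A\<^esub> bpow d) \<otimes>\<^bsub>A\<^esub> (y \<odot>\<^bsub>A\<^esub> bpow k) = (y \<otimes> x) \<odot>\<^bsub>A\<^esub> bpow (Suc (d + k))"
  by (simp only: smult_mult_left smult_mult_right[of y] bpow_mult smult_assoc1[of y x] smult_closed
      bpow_closed)

lemma smult_inj:
  assumes "x \<in> carrier K" "y \<in> carrier K" "f \<in> carrier A" "f \<noteq> \<zero>\<^bsub>A\<^esub>" "x \<odot>\<^bsub>A\<^esub> f = y \<odot>\<^bsub>A\<^esub> f"
  shows "x = y"
proof (rule ccontr)
  assume "x \<noteq> y"
  define z where "z = x \<ominus> y"
  have z: "z \<in> carrier K" "z \<noteq> \<zero>"
    using assms \<open>x \<noteq> y\<close> by (auto simp: z_def)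
  have "z \<odot>\<^bsub>A\<^esub> f = x \<odot>\<^bsub>A\<^esub> f \<ominus>\<^bsub>A\<^esub> y \<odot>\<^bsub>A\<^esub> f"
    using assms(1-3) by (simp add: z_def a_minus_def smult_l_distr smult_l_minus)
  then have 0: "z \<odot>\<^bsub>A\<^esub> f = \<zero>\<^bsub>A\<^esub>"
    using assms by (simp add: M.r_neg a_minus_def)
  have "inv z \<otimes> z = \<one>" using z by (intro Units_l_inv) (simp add: field_Units)
  then have "f = (inv z \<otimes> z) \<odot>\<^bsub>A\<^esub> f" using assms by simp
  also have "\<dots> = inv z \<odot>\<^bsub>A\<^esub> (z \<odot>\<^bsub>A\<^esub> f)" using z assms by (intro smult_assoc1) (simp_all add: field_Units)
  also have "\<dots> = \<zero>\<^bsub>A\<^esub>" using z by (simp add: 0 field_Units)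
  finally show False using assms by simp
qed

lemma term_val_Power_b: "v 0 = b \<Longrightarrow> term_val A v (Power_b d) = bpow d"
  by (induction d) auto

lemma term_val_scalar_closed: "range v \<subseteq> carrier K \<Longrightarrow> term_val K v t \<in> carrier K"
  by (induction t) auto

lemma term_val_homogenize:
  assumes "range v \<subseteq> carrier K" "u 0 = b" "\<And>i. u (Suc i) = v i \<odot>\<^bsub>A\<^esub> b"
  shows "term_val A u (homogenize t) = term_val K v t \<odot>\<^bsub>A\<^esub> bpow (hom_deg t)"
proof (induction t)
  case (Plus s t)
  let ?s = "term_val K v s" and ?t = "term_val K v t"
  have c: "?s \<in> carrier K" "?t \<in> carrier K" using assms term_val_scalar_closed by auto
  then show ?case
    by (simp add: Plus term_val_Power_b assms smult_mult_left bpow_mult smult_l_distr del: bpow.simps)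
      (simp add: add.commute)
next
  case (Times s t)
  then show ?case using assms by (simp add: smult_bpow_mult m_comm term_val_scalar_closed del: bpow.simps)
qed (auto simp: assms b_closed)

text \<open>Equations: both sides become scalar multiples of the same nonzero power of b, and
  \<open>smult_inj\<close> compares the scalars. Quantifiers: by \<open>proportional_iff\<close> the
  relativized variable runs exactly through the elements x b with x in K.\<close>

lemma satisfies_scalar_translation:
  assumes "range v \<subseteq> carrier K" "u 0 = b" "\<And>i. u (Suc i) = v i \<odot>\<^bsub>A\<^esub> b"
  shows "satisfies A u (scalar_translation p) \<longleftrightarrow> satisfies K v p"
  using assms
proof (induction p arbitrary: u v)
  case (Eq s t)
  let ?s = "term_val K v s" and ?t = "term_val K v t"
  have c: "?s \<in> carrier K" "?t \<in> carrier K" using Eq term_val_scalar_closed by auto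
  have "satisfies A u (scalar_translation (Eq s t)) \<longleftrightarrow>
      ?s \<odot>\<^bsub>A\<^esub> bpow (Suc (hom_deg s + hom_deg t)) = ?t \<odot>\<^bsub>A\<^esub> bpow (Suc (hom_deg s + hom_deg t))"
    by (simp add: term_val_homogenize[OF Eq] term_val_Power_b Eq c smult_mult_left bpow_mult
        add.commute[of "hom_deg t"] del: bpow.simps)
  also have "\<dots> \<longleftrightarrow> ?s = ?t" using smult_inj c bpow_closed bpow_nonzero by metis
  finally show ?case by simp
next
  case (All i p)
  have "satisfies A (u(Suc i := x \<odot>\<^bsub>A\<^esub> b)) (scalar_translation p) \<longleftrightarrow> satisfies K (v(i := x)) p"
    if "x \<in> carrier K" for x
    using All.prems that by (intro All.IH) auto
  moreover have "x \<odot>\<^bsub>A\<^esub> b \<in> carrier A" if "x \<in> carrier K" for x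
    using that b_closed by simp
  moreover have "satisfies A u (scalar_translation (All i p)) \<longleftrightarrow>
      (\<forall>f\<in>carrier A. (\<exists>x\<in>carrier K. f = x \<odot>\<^bsub>A\<^esub> b) \<longrightarrow>
        satisfies A (u(Suc i := f)) (scalar_translation p))"
    using proportional_iff All.prems by auto
  ultimately show ?case by auto
qed auto

lemma satisfies_scalar_translation_sentence:
  assumes "free_vars p = {}" "u 0 = b"
  shows "satisfies A u (scalar_translation p) \<longleftrightarrow> holds_in K p"
proof -
  \<comment> \<open>The values of \<open>u\<close> beyond variable 0 need not be multiples of b. The
    translated sentence has no free variable there, so they may be replaced by b, the multiple with
    scalar one.\<close>
  have "satisfies A u (scalar_translation p) \<longleftrightarrow>
      satisfies A (case_nat b (\<lambda>i. \<one> \<odot>\<^bsub>A\<^esub> b)) (scalar_translation p)"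
    using free_vars_scalar_translation[of p] assms by (intro satisfies_cong) auto
  also have "\<dots> \<longleftrightarrow> satisfies K (\<lambda>i. \<one>) p"
    by (rule satisfies_scalar_translation) auto
  also have "\<dots> \<longleftrightarrow> holds_in K p"
    unfolding holds_in_def using assms satisfies_cong[of p _ "\<lambda>i. \<one>" K] by auto
  finally show ?thesis .
qed

end

section \<open>Sentences about the field of scalars\<close>

lemma holds_in_iff:
  assumes "free_vars p = {}" "range u \<subseteq> carrier R"
  shows "holds_in R p \<longleftrightarrow> satisfies R u p"
proof -
  have "satisfies R v p \<longleftrightarrow> satisfies R u p" for v
    using assms(1) by (intro satisfies_cong) auto
  then show ?thesis using assms(2) unfolding holds_in_def by blast
qed

text \<open>An element of the carrier must be given: over an empty carrier there is no assignment,
  and both \<open>p\<close> and its negation hold vacuously.\<close>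

lemma holds_in_Neg:
  assumes p: "free_vars p = {}" and "a \<in> carrier R"
  shows "holds_in R (Neg p) \<longleftrightarrow> \<not> holds_in R p"
proof -
  have a: "range (\<lambda>_::nat. a) \<subseteq> carrier R" using assms by auto
  have "free_vars (Neg p) = {}" using p by simp
  from holds_in_iff[OF this a] holds_in_iff[OF p a] show ?thesis by simp
qed

text \<open>Transfer runs only from F to B, since it consumes a property of all nonzero elements of
  F and yields one at the chosen b. The converse implication comes from transferring the negated
  sentence.\<close>

lemma scalar_fields_elementarily_equivalent:
  assumes B: "scalar_domain K1 B b"
    and F: "\<And>x. x \<in> carrier F \<Longrightarrow> x \<noteq> \<zero>\<^bsub>F\<^esub> \<Longrightarrow> scalar_domain K F x"
    and "B \<equiv>\<^sub>e F" and "field K"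
  shows "K1 \<equiv>\<^sub>e K"
proof -
  interpret B: scalar_domain K1 B b by fact
  interpret K: field K by fact
  have transfer: "holds_in K1 p" if p: "free_vars p = {}" and "holds_in K p" for p
  proof -
    have "satisfies B (\<lambda>i. b) (scalar_translation p)"
    proof (rule elementarily_equivalent_transfer[OF assms(3)])
      show "free_vars (scalar_translation p) \<subseteq> {0}"
        using free_vars_scalar_translation[of p] p by auto
      fix x assume x: "x \<in> carrier F" "x \<noteq> \<zero>\<^bsub>F\<^esub>"
      interpret F: scalar_domain K F x using F x .
      show "\<exists>v. v 0 = x \<and> satisfies F v (scalar_translation p)"
        using F.satisfies_scalar_translation_sentence[OF p, of "\<lambda>i. x"] that by auto
    qed (auto simp: B.b_closed B.b_nonzero)
    then show ?thesis using B.satisfies_scalar_translation_sentence[OF p, of "\<lambda>i. b"] by simp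
  qed
  have "holds_in K1 p \<longleftrightarrow> holds_in K p" if p: "free_vars p = {}" for p
  proof
    assume "holds_in K1 p"
    show "holds_in K p"
    proof (rule ccontr)
      assume "\<not> holds_in K p"
      then have "holds_in K1 (Neg p)" using transfer[of "Neg p"] p
        by (simp add: holds_in_Neg[OF p K.zero_closed])
      then show False using \<open>holds_in K1 p\<close> using holds_in_Neg[OF p B.one_closed] by simp
    qed
  qed (use transfer p in blast)
  then show ?thesis by (simp add: elementarily_equivalent_def)
qed

section \<open>The free algebra\<close>

text \<open>The product of the free algebra, extended to all functions on words, including those
  with a nonzero value at the empty word. Such functions appear as soon as a first letter is
  stripped from an element, and they stand in for the missing unity.\<close>

definition conv :: "('k, 'm) ring_scheme \<Rightarrow> ('x list \<Rightarrow> 'k) \<Rightarrow> ('x list \<Rightarrow> 'k) \<Rightarrow> 'x list \<Rightarrow> 'k" where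
  "conv K f g w = (\<Oplus>\<^bsub>K\<^esub>i\<in>{..length w}. f (take i w) \<otimes>\<^bsub>K\<^esub> g (drop i w))"

context ring
begin

lemma conv_Nil:
  "range f \<subseteq> carrier R \<Longrightarrow> range g \<subseteq> carrier R \<Longrightarrow> conv R f g [] = f [] \<otimes> g []"
  by (auto simp: conv_def image_subset_iff)

text \<open>Either the word is cut before its first letter, leaving \<open>f []\<close> as left
  factor, or the left piece contains that letter. This recursion replaces all manipulation of sums
  over cut positions in the inductions below.\<close>

lemma conv_Cons:
  assumes "range f \<subseteq> carrier R" "range g \<subseteq> carrier R"
  shows "conv R f g (x # w) = f [] \<otimes> g (x # w) \<oplus> conv R (\<lambda>u. f (x # u)) g w"
proof -
  have c: "f u \<in> carrier R" "g u \<in> carrier R" for u using assms by auto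
  have "conv R f g (x # w) = (\<Oplus>i\<in>{..Suc (length w)}. f (take i (x # w)) \<otimes> g (drop i (x # w)))"
    by (simp add: conv_def)
  also have "\<dots> = conv R (\<lambda>u. f (x # u)) g w \<oplus> f [] \<otimes> g (x # w)"
    by (subst finsum_Suc2) (auto simp: c conv_def)
  finally show ?thesis by (simp add: a_comm c conv_def finsum_closed)
qed

lemma conv_closed [simp]:
  "range f \<subseteq> carrier R \<Longrightarrow> range g \<subseteq> carrier R \<Longrightarrow> conv R f g w \<in> carrier R"
  unfolding conv_def by (intro finsum_closed) (auto simp: image_subset_iff)

lemma conv_zero_left:
  "range g \<subseteq> carrier R \<Longrightarrow> conv R (\<lambda>u. \<zero>) g w = \<zero>"
  by (induction w) (auto simp: conv_Nil conv_Cons image_subset_iff)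

lemma conv_unit_left:
  assumes "range g \<subseteq> carrier R" "range f \<subseteq> carrier R" "\<And>u. u \<noteq> [] \<Longrightarrow> f u = \<zero>"
  shows "conv R f g w = f [] \<otimes> g w"
  using assms by (cases w) (auto simp: conv_Nil conv_Cons image_subset_iff conv_zero_left)

lemma conv_add_left:
  assumes "range f \<subseteq> carrier R" "range g \<subseteq> carrier R" "range h \<subseteq> carrier R"
  shows "conv R (\<lambda>u. f u \<oplus> g u) h w = conv R f h w \<oplus> conv R g h w"
  using assms
proof (induction w arbitrary: f g)
  case Nil
  then show ?case by (simp add: conv_Nil image_subset_iff l_distr)
next
  case (Cons x w)
  have c: "f u \<in> carrier R" "g u \<in> carrier R" "h u \<in> carrier R" for u using Cons.prems by auto
  have cr: "range (\<lambda>u. f (x # u)) \<subseteq> carrier R" "range (\<lambda>u. g (x # u)) \<subseteq> carrier R"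
    "range (\<lambda>u. f u \<oplus> g u) \<subseteq> carrier R"
    using c by auto
  show ?case
    by (simp add: Cons.prems conv_Cons cr Cons.IH l_distr c a_ac)
qed

lemma conv_add_right:
  assumes "range f \<subseteq> carrier R" "range g \<subseteq> carrier R" "range h \<subseteq> carrier R"
  shows "conv R f (\<lambda>u. g u \<oplus> h u) w = conv R f g w \<oplus> conv R f h w"
  using assms
proof (induction w arbitrary: f)
  case Nil
  then show ?case by (simp add: conv_Nil image_subset_iff r_distr)
next
  case (Cons x w)
  have c: "f u \<in> carrier R" "g u \<in> carrier R" "h u \<in> carrier R" for u using Cons.prems by auto
  have cr: "range (\<lambda>u. f (x # u)) \<subseteq> carrier R" "range (\<lambda>u. g u \<oplus> h u) \<subseteq> carrier R"
    using c by auto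
  show ?case
    by (simp add: Cons.prems conv_Cons cr Cons.IH r_distr c a_ac)
qed

lemma conv_smult_left:
  assumes "a \<in> carrier R" "range f \<subseteq> carrier R" "range g \<subseteq> carrier R"
  shows "conv R (\<lambda>u. a \<otimes> f u) g w = a \<otimes> conv R f g w"
  using assms
proof (induction w arbitrary: f)
  case Nil
  then show ?case by (simp add: conv_Nil image_subset_iff m_assoc)
next
  case (Cons x w)
  have c: "f u \<in> carrier R" "g u \<in> carrier R" for u using Cons.prems by auto
  have cr: "range (\<lambda>u. f (x # u)) \<subseteq> carrier R" "range (\<lambda>u. a \<otimes> f u) \<subseteq> carrier R"
    using c Cons.prems by auto
  show ?case
    by (simp add: Cons.prems conv_Cons cr Cons.IH r_distr c m_assoc)
qed

text \<open>Stripping the first letter from a convolution gives a sum of two terms, so linearity in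
  the left factor reduces the claim to the induction hypothesis for the stripped
  \<open>f\<close>.\<close>

lemma conv_assoc:
  assumes "range f \<subseteq> carrier R" "range g \<subseteq> carrier R" "range h \<subseteq> carrier R"
  shows "conv R (conv R f g) h w = conv R f (conv R g h) w"
  using assms
proof (induction w arbitrary: f)
  case Nil
  then show ?case by (simp add: conv_Nil image_subset_iff m_assoc)
next
  case (Cons x w)
  have c: "f u \<in> carrier R" "g u \<in> carrier R" "h u \<in> carrier R" for u using Cons.prems by auto
  have cr: "range (\<lambda>u. f (x # u)) \<subseteq> carrier R" "range (\<lambda>u. g (x # u)) \<subseteq> carrier R"
    "range (conv R f g) \<subseteq> carrier R" "range (conv R g h) \<subseteq> carrier R"
    "range (\<lambda>u. f [] \<otimes> g (x # u)) \<subseteq> carrier R"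
    "range (conv R (\<lambda>u. f (x # u)) g) \<subseteq> carrier R"
    using c Cons.prems by (auto simp: image_subset_iff)
  have fg: "(\<lambda>u. conv R f g (x # u)) = (\<lambda>u. f [] \<otimes> g (x # u) \<oplus> conv R (\<lambda>u. f (x # u)) g u)"
    using Cons.prems by (simp add: conv_Cons)
  have "conv R (conv R f g) h (x # w) =
      (f [] \<otimes> g []) \<otimes> h (x # w) \<oplus> (f [] \<otimes> conv R (\<lambda>u. g (x # u)) h w \<oplus>
        conv R (conv R (\<lambda>u. f (x # u)) g) h w)"
    by (simp add: conv_Cons[OF cr(3) Cons.prems(3)] fg conv_add_left cr Cons.prems conv_smult_left c conv_Nil)
  also have "\<dots> = conv R f (conv R g h) (x # w)"
    by (simp add: conv_Cons[of f "conv R g h"] Cons.prems cr Cons.IH conv_Cons[of g h] c r_distr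
        m_assoc a_assoc)
  finally show ?case .
qed

lemma conv_nonzero_split:
  assumes "range f \<subseteq> carrier R" "range g \<subseteq> carrier R" "conv R f g w \<noteq> \<zero>"
  shows "\<exists>u v. w = u @ v \<and> f u \<noteq> \<zero> \<and> g v \<noteq> \<zero>"
proof (rule ccontr)
  assume *: "\<not> ?thesis"
  have c: "f u \<in> carrier R" "g u \<in> carrier R" for u using assms by auto
  have "f (take i w) \<otimes> g (drop i w) = \<zero>" for i
    using * c by (metis append_take_drop_id l_null r_null)
  then show False using assms(3) by (simp add: conv_def)
qed

text \<open>Only the cut at \<open>length u\<close> contributes: an earlier cut leaves a right piece
  longer than \<open>v\<close>, a later one a left piece longer than \<open>u\<close>. There is no
  cancellation in top degree.\<close>

lemma conv_top:
  assumes "range f \<subseteq> carrier R" "range g \<subseteq> carrier R"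
    and "\<And>w. length w > length u \<Longrightarrow> f w = \<zero>" "\<And>w. length w > length v \<Longrightarrow> g w = \<zero>"
  shows "conv R f g (u @ v) = f u \<otimes> g v"
  using assms
proof (induction u arbitrary: f)
  case Nil
  then show ?case by (simp add: conv_unit_left)
next
  case (Cons x u)
  have c: "f u \<in> carrier R" "g u \<in> carrier R" for u using Cons.prems by auto
  have cr: "range (\<lambda>u. f (x # u)) \<subseteq> carrier R" using c by auto
  have "conv R (\<lambda>u. f (x # u)) g (u @ v) = f (x # u) \<otimes> g v"
    using Cons.prems cr by (intro Cons.IH) auto
  moreover have "g (x # u @ v) = \<zero>" using Cons.prems(4) by simp
  ultimately show ?case using Cons.prems by (simp add: conv_Cons c)
qed

end

lemma finite_support_top:
  assumes "finite {w. f w \<noteq> z}" "\<exists>w. f w \<noteq> z"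
  obtains u where "f u \<noteq> z" "\<And>w. length w > length u \<Longrightarrow> f w = z"
proof -
  let ?S = "{w. f w \<noteq> z}"
  have "Max (length ` ?S) \<in> length ` ?S" using assms by (intro Max_in) auto
  then obtain u where u: "u \<in> ?S" "length u = Max (length ` ?S)" by auto
  have "f w = z" if "length w > length u" for w
  proof (rule ccontr)
    assume "f w \<noteq> z"
    then have "length w \<le> Max (length ` ?S)" using assms by (intro Max_ge) auto
    then show False using that u by simp
  qed
  then show thesis using that u by blast
qed

lemma free_algebra_simps:
  "\<zero>\<^bsub>free_algebra K Xs\<^esub> = (\<lambda>w. \<zero>\<^bsub>K\<^esub>)"
  "f \<oplus>\<^bsub>free_algebra K Xs\<^esub> g = (\<lambda>w. f w \<oplus>\<^bsub>K\<^esub> g w)"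
  "f \<otimes>\<^bsub>free_algebra K Xs\<^esub> g = conv K f g"
  "a \<odot>\<^bsub>free_algebra K Xs\<^esub> f = (\<lambda>w. a \<otimes>\<^bsub>K\<^esub> f w)"
  "f \<in> carrier (free_algebra K Xs) \<longleftrightarrow> range f \<subseteq> carrier K \<and> finite {w. f w \<noteq> \<zero>\<^bsub>K\<^esub>} \<and>
     {w. f w \<noteq> \<zero>\<^bsub>K\<^esub>} \<subseteq> lists Xs - {[]}"
  by (auto simp: free_algebra_def conv_def fun_eq_iff)

text \<open>The sum of e_x (\<alpha>_x + g_x), with coefficients in the algebra K + A with unity
  adjoined. The two parts are kept separate because that unity is not an element of A.\<close>

definition letter_sum ::
    "('k, 'a, 'm) module_scheme \<Rightarrow> ('x \<Rightarrow> 'a) \<Rightarrow> 'x set \<Rightarrow> ('x \<Rightarrow> 'k) \<Rightarrow> ('x \<Rightarrow> 'a) \<Rightarrow> 'a" where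
  "letter_sum A e Xs \<alpha> g = (\<Oplus>\<^bsub>A\<^esub>x\<in>Xs. \<alpha> x \<odot>\<^bsub>A\<^esub> e x \<oplus>\<^bsub>A\<^esub> e x \<otimes>\<^bsub>A\<^esub> g x)"

text \<open>In other words, A is a free right module with basis \<open>e\<close> over K + A, the
  algebra with unity adjoined. Uniqueness is demanded only for the zero element, as differences of
  such sums are again such sums.\<close>

locale letter_algebra = assoc_algebra +
  fixes Xs :: "'x set" and e :: "'x \<Rightarrow> 'c"
  assumes finite_letters: "finite Xs" and letter_closed: "x \<in> Xs \<Longrightarrow> e x \<in> carrier A"
    and letter_sum_exists: "f \<in> carrier A \<Longrightarrow>
      \<exists>\<alpha> g. (\<forall>x\<in>Xs. \<alpha> x \<in> carrier K \<and> g x \<in> carrier A) \<and> f = letter_sum A e Xs \<alpha> g"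
    and letter_sum_zero: "\<lbrakk>\<And>x. x \<in> Xs \<Longrightarrow> \<alpha> x \<in> carrier K; \<And>x. x \<in> Xs \<Longrightarrow> g x \<in> carrier A;
      letter_sum A e Xs \<alpha> g = \<zero>\<^bsub>A\<^esub>; x \<in> Xs\<rbrakk> \<Longrightarrow> \<alpha> x = \<zero> \<and> g x = \<zero>\<^bsub>A\<^esub>"

context field
begin

lemma free_algebra_assoc_algebra:
  fixes Xs :: "'x set"
  shows "assoc_algebra R (free_algebra R Xs)"
proof -
  let ?F = "free_algebra R Xs"
  note simps = free_algebra_simps
  have c: "f w \<in> carrier R" if "f \<in> carrier ?F" for f w using that by (auto simp: simps)
  have add: "f \<oplus>\<^bsub>?F\<^esub> g \<in> carrier ?F" if f: "f \<in> carrier ?F" and g: "g \<in> carrier ?F" for f g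
  proof -
    have sub: "{w. f w \<oplus> g w \<noteq> \<zero>} \<subseteq> {w. f w \<noteq> \<zero>} \<union> {w. g w \<noteq> \<zero>}" by auto
    have "finite {w. f w \<oplus> g w \<noteq> \<zero>}" using finite_subset[OF sub] f g by (auto simp: simps)
    then show ?thesis using sub f g c[OF f] c[OF g] by (auto simp: simps image_subset_iff) blast+
  qed
  have smult: "a \<odot>\<^bsub>?F\<^esub> f \<in> carrier ?F" if a: "a \<in> carrier R" and f: "f \<in> carrier ?F" for a f
  proof -
    have sub: "{w. a \<otimes> f w \<noteq> \<zero>} \<subseteq> {w. f w \<noteq> \<zero>}" using a by auto
    have "finite {w. a \<otimes> f w \<noteq> \<zero>}" using finite_subset[OF sub] f by (auto simp: simps)
    then show ?thesis using sub f a c[OF f] by (auto simp: simps image_subset_iff)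
  qed
  have mult: "f \<otimes>\<^bsub>?F\<^esub> g \<in> carrier ?F" if f: "f \<in> carrier ?F" and g: "g \<in> carrier ?F" for f g
  proof -
    have r: "range f \<subseteq> carrier R" "range g \<subseteq> carrier R" using f g by (auto simp: simps)
    \<comment> \<open>The support of a product consists of concatenations of words from two finite
      supports; this yields finiteness and shows that only nonempty words over \<open>Xs\<close>
      occur.\<close>
    have sub: "{w. conv R f g w \<noteq> \<zero>} \<subseteq> (\<lambda>(u, v). u @ v) ` ({w. f w \<noteq> \<zero>} \<times> {w. g w \<noteq> \<zero>})"
      using conv_nonzero_split[OF r] by force
    have "finite {w. conv R f g w \<noteq> \<zero>}"
      using finite_subset[OF sub] f g by (auto simp: simps)
    moreover have "{w. conv R f g w \<noteq> \<zero>} \<subseteq> lists Xs - {[]}"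
      using sub f g by (fastforce simp: simps)
    ultimately show ?thesis using conv_closed[OF r] by (auto simp: simps)
  qed
  have grp: "abelian_group ?F"
  proof (rule abelian_groupI)
    fix f assume f: "f \<in> carrier ?F"
    have "(\<ominus> \<one>) \<odot>\<^bsub>?F\<^esub> f \<oplus>\<^bsub>?F\<^esub> f = \<zero>\<^bsub>?F\<^esub>"
      using c[OF f] by (simp add: simps fun_eq_iff l_minus l_neg)
    then show "\<exists>g\<in>carrier ?F. g \<oplus>\<^bsub>?F\<^esub> f = \<zero>\<^bsub>?F\<^esub>" using smult[of "\<ominus> \<one>" f] f by auto
  qed (use add in \<open>auto simp: simps image_subset_iff fun_eq_iff a_ac\<close>)
  have mod: "Module.module R ?F"
    by (rule moduleI[OF is_cring grp smult])
      (simp_all add: simps(1-4) fun_eq_iff l_distr r_distr m_assoc c)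
  have assoc: "assoc_nonunital_ring ?F"
    by (intro assoc_nonunital_ring.intro nonunital_ring.intro nonunital_ring_axioms.intro
        assoc_nonunital_ring_axioms.intro grp mult)
      (auto simp: simps fun_eq_iff conv_add_left conv_add_right conv_assoc)
  have comm: "conv R f (\<lambda>w. a \<otimes> g w) w = a \<otimes> conv R f g w"
    if "a \<in> carrier R" "f \<in> carrier ?F" "g \<in> carrier ?F" for a f g w
  proof -
    have r: "range f \<subseteq> carrier R" "range g \<subseteq> carrier R" "range (\<lambda>w. a \<otimes> g w) \<subseteq> carrier R"
      using that by (auto simp: simps)
    from r(1,2) show ?thesis
      using that(1) c[OF that(2)] c[OF that(3)]
      by (simp add: conv_def finsum_rdistr image_subset_iff Pi_def m_lcomm)
  qed
  show ?thesis
    by (intro assoc_algebra.intro field_axioms mod assoc assoc_algebra_axioms.intro)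
      (use comm in \<open>auto simp: simps(3,4) fun_eq_iff\<close>, auto simp: simps conv_smult_left)
qed

lemma free_algebra_scalar_domain:
  fixes Xs :: "'x set"
  assumes Xs: "Xs \<noteq> {}" and b: "b \<in> carrier (free_algebra R Xs)" "b \<noteq> \<zero>\<^bsub>free_algebra R Xs\<^esub>"
  shows "scalar_domain R (free_algebra R Xs) b"
proof -
  let ?F = "free_algebra R Xs"
  note simps = free_algebra_simps
  interpret F: assoc_algebra R ?F by (rule free_algebra_assoc_algebra)
  have top: "\<exists>u. f u \<noteq> \<zero> \<and> (\<forall>w. length w > length u \<longrightarrow> f w = \<zero>)"
    if "finite {w. f w \<noteq> \<zero>}" "\<exists>w. f w \<noteq> \<zero>" for f :: "'x list \<Rightarrow> 'a"
    using finite_support_top[OF that] by metis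
  \<comment> \<open>Degrees add. The witness is the concatenation of two words of maximal length in
    the supports; its coefficient is a product of two nonzero field elements.\<close>
  have mult_nonzero: "\<exists>w. length w = length u + length v \<and> conv R f g w \<noteq> \<zero>"
    if "range f \<subseteq> carrier R" "range g \<subseteq> carrier R" "f u \<noteq> \<zero>" "g v \<noteq> \<zero>"
      "\<forall>w. length w > length u \<longrightarrow> f w = \<zero>" "\<forall>w. length w > length v \<longrightarrow> g w = \<zero>"
    for f g :: "'x list \<Rightarrow> 'a" and u v
    using that conv_top[of f g u v] integral[of "f u" "g v"]
    by (intro exI[of _ "u @ v"]) (auto simp: image_subset_iff)
  show ?thesis
  proof (intro scalar_domain.intro scalar_domain_axioms.intro F.assoc_algebra_axioms b)
    fix f g assume f: "f \<in> carrier ?F" and g: "g \<in> carrier ?F" and 0: "f \<otimes>\<^bsub>?F\<^esub> g = \<zero>\<^bsub>?F\<^esub>"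
    show "f = \<zero>\<^bsub>?F\<^esub> \<or> g = \<zero>\<^bsub>?F\<^esub>"
    proof (rule ccontr)
      assume "\<not> ?thesis"
      then have "\<exists>w. f w \<noteq> \<zero>" "\<exists>w. g w \<noteq> \<zero>" by (auto simp: simps fun_eq_iff)
      moreover have "finite {w. f w \<noteq> \<zero>}" "finite {w. g w \<noteq> \<zero>}" using f g by (auto simp: simps)
      ultimately obtain u v where "f u \<noteq> \<zero>" "\<forall>w. length w > length u \<longrightarrow> f w = \<zero>"
          "g v \<noteq> \<zero>" "\<forall>w. length w > length v \<longrightarrow> g w = \<zero>"
        using top[of f] top[of g] by blast
      moreover have "range f \<subseteq> carrier R" "range g \<subseteq> carrier R" using f g by (auto simp: simps)
      moreover have "conv R f g w = \<zero>" for w using 0 by (simp add: simps fun_eq_iff)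
      ultimately show False using mult_nonzero[of f g u v] by blast
    qed
  next
    fix f assume f: "f \<in> carrier ?F"
    show "proportional ?F b f \<longleftrightarrow> (\<exists>a\<in>carrier R. f = a \<odot>\<^bsub>?F\<^esub> b)"
    proof
      assume pr: "proportional ?F b f"
      show "\<exists>a\<in>carrier R. f = a \<odot>\<^bsub>?F\<^esub> b"
      proof (cases "f = \<zero>\<^bsub>?F\<^esub>")
        case True
        then show ?thesis using b F.smult_l_null by (metis zero_closed)
      next
        case False
        obtain x where x: "x \<in> Xs" using Xs by auto
        define l where "l w = (if w = [x] then \<one> else \<zero>)" for w
        have l: "l \<in> carrier ?F" using x by (auto simp: simps l_def)
        \<comment> \<open>Comparing the coefficients of l g = c h at words beginning with the letter
          x gives g = d h, where d is c with its first letter x removed. The factor d may have a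
          constant term, so it is only a function on words and not an element of the
          algebra.\<close>
        have strip: "\<exists>d. range d \<subseteq> carrier R \<and> finite {w. d w \<noteq> \<zero>} \<and> g = conv R d h"
          if g: "g \<in> carrier ?F" and h: "h \<in> carrier ?F" and c: "c \<in> carrier ?F"
            and eq: "l \<otimes>\<^bsub>?F\<^esub> g = c \<otimes>\<^bsub>?F\<^esub> h" for g h c
        proof (intro exI[of _ "\<lambda>u. c (x # u)"] conjI ext)
          show "range (\<lambda>u. c (x # u)) \<subseteq> carrier R" using c by (auto simp: simps)
          have "finite ((#) x -` {w. c w \<noteq> \<zero>})"
            using c by (intro finite_vimageI) (auto simp: simps)
          then show "finite {u. c (x # u) \<noteq> \<zero>}" by (simp add: vimage_def)
          fix w
          have r: "range g \<subseteq> carrier R" "range h \<subseteq> carrier R" "range c \<subseteq> carrier R"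
            "range l \<subseteq> carrier R" "range (\<lambda>u. l (x # u)) \<subseteq> carrier R"
            "range (\<lambda>u. c (x # u)) \<subseteq> carrier R"
            using g h c l by (auto simp: simps)
          \<comment> \<open>Neither left factor has a constant term, so at the word
            \<open>x # w\<close> the cut in front of x contributes nothing on either side.\<close>
          have "c [] = \<zero>" using c by (auto simp: simps)
          have "conv R l g (x # w) = conv R c h (x # w)" using eq by (simp add: simps)
          moreover have "conv R (\<lambda>u. l (x # u)) g w = l [x] \<otimes> g w"
            by (rule conv_unit_left[OF r(1,5)]) (simp add: l_def)
          moreover have "g w \<in> carrier R" "h (x # w) \<in> carrier R" "g (x # w) \<in> carrier R"
            using r by auto
          ultimately show "g w = conv R (\<lambda>u. c (x # u)) h w"
            using r \<open>c [] = \<zero>\<close> by (simp add: conv_Cons) (simp add: l_def)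
        qed
        obtain p where p: "range p \<subseteq> carrier R" "finite {w. p w \<noteq> \<zero>}" "f = conv R p b"
          using pr False strip[OF f b(1)] l unfolding proportional_def by blast
        obtain q where q: "range q \<subseteq> carrier R" "finite {w. q w \<noteq> \<zero>}" "b = conv R q f"
          using pr False strip[OF b(1) f] l unfolding proportional_def by blast
        have r: "range f \<subseteq> carrier R" "range b \<subseteq> carrier R" using f b by (auto simp: simps)
        have "p \<noteq> (\<lambda>w. \<zero>)"
          using p(3) False conv_zero_left[OF r(2)] by (auto simp: simps)
        moreover have "q \<noteq> (\<lambda>w. \<zero>)"
          using q(3) b(2) conv_zero_left[OF r(1)] by (auto simp: simps)
        ultimately have "\<exists>w. p w \<noteq> \<zero>" "\<exists>w. q w \<noteq> \<zero>" by auto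
        moreover have "\<exists>w. f w \<noteq> \<zero>" "\<exists>w. b w \<noteq> \<zero>" using False b(2) by (auto simp: simps)
        moreover have "finite {w. f w \<noteq> \<zero>}" "finite {w. b w \<noteq> \<zero>}" using f b by (auto simp: simps)
        ultimately obtain t u v s where t: "p t \<noteq> \<zero>" "\<forall>w. length w > length t \<longrightarrow> p w = \<zero>"
          and u: "q u \<noteq> \<zero>" "\<forall>w. length w > length u \<longrightarrow> q w = \<zero>"
          and v: "f v \<noteq> \<zero>" "\<forall>w. length w > length v \<longrightarrow> f w = \<zero>"
          and s: "b s \<noteq> \<zero>" "\<forall>w. length w > length s \<longrightarrow> b w = \<zero>"
          using top[of p] top[of q] top[of f] top[of b] p(2) q(2) by blast
        have "length t + length s \<le> length v"
          using mult_nonzero[OF p(1) r(2) t(1) s(1) t(2) s(2)] v(2) p(3) by (metis not_le)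
        moreover have "length u + length v \<le> length s"
          using mult_nonzero[OF q(1) r(1) u(1) v(1) u(2) v(2)] s(2) q(3) by (metis not_le)
        \<comment> \<open>From f = p b and b = q f the degrees satisfy deg p + deg b \<le> deg f and
          deg q + deg f \<le> deg b. Hence p has degree 0, and the scalar sought is its value at the
          empty word.\<close>
        ultimately have "length t = 0" by linarith
        then have "f = (\<lambda>w. p [] \<otimes> b w)"
          unfolding p(3) using t(2) by (intro ext conv_unit_left r p) auto
        then show ?thesis using p(1) by (auto simp: simps intro!: bexI[of _ "p []"])
      qed
    next
      assume "\<exists>a\<in>carrier R. f = a \<odot>\<^bsub>?F\<^esub> b"
      then obtain a where a: "a \<in> carrier R" "f = a \<odot>\<^bsub>?F\<^esub> b" by auto
      show "proportional ?F b f"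
      proof (cases "a = \<zero>")
        case True
        then show ?thesis using a b by (simp add: proportional_def)
      next
        case False
        have i: "inv a \<in> carrier R" "a \<otimes> inv a = \<one>" using a False by (auto simp: field_Units)
        \<comment> \<open>Since multiplication is bilinear over the scalars, the factor
          \<open>a\<close> can be moved from f to the left operand; its inverse serves for the other
          inclusion.\<close>
        have "z \<otimes>\<^bsub>?F\<^esub> f = (a \<odot>\<^bsub>?F\<^esub> z) \<otimes>\<^bsub>?F\<^esub> b" if "z \<in> carrier ?F" for z
          using that a b by (simp add: F.smult_mult_left F.smult_mult_right)
        moreover have "z \<otimes>\<^bsub>?F\<^esub> b = (inv a \<odot>\<^bsub>?F\<^esub> z) \<otimes>\<^bsub>?F\<^esub> f" if "z \<in> carrier ?F" for z
          using that a b i F.smult_assoc1[of a "inv a" "z \<otimes>\<^bsub>?F\<^esub> b"]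
          by (simp add: F.smult_mult_left F.smult_mult_right F.mult_closed)
        ultimately show ?thesis unfolding proportional_def using a i F.smult_closed by blast
      qed
    qed
  qed
qed

section \<open>Letters of the free algebra and decomposition by the first letter\<close>

definition letter :: "'x \<Rightarrow> 'x list \<Rightarrow> 'a" where
  "letter x w = (if w = [x] then \<one> else \<zero>)"

lemma letter_in_free_algebra: "x \<in> Xs \<Longrightarrow> letter x \<in> carrier (free_algebra R Xs)"
  by (auto simp: free_algebra_simps letter_def)

lemma conv_letter_Cons:
  assumes "range g \<subseteq> carrier R"
  shows "conv R (letter x) g (y # w) = (if y = x then g w else \<zero>)"
proof -
  have r: "range (letter x) \<subseteq> carrier R" "range (\<lambda>u. letter x (y # u)) \<subseteq> carrier R"
    "g (y # w) \<in> carrier R" "g w \<in> carrier R"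
    using assms by (auto simp: letter_def)
  have "conv R (\<lambda>u. letter x (y # u)) g w = letter x [y] \<otimes> g w"
    by (rule conv_unit_left[OF assms r(2)]) (simp add: letter_def)
  moreover have "letter x [] = \<zero>" "letter x [y] = (if y = x then \<one> else \<zero>)"
    by (auto simp: letter_def)
  ultimately show ?thesis using r by (simp add: conv_Cons[OF r(1) assms])
qed

lemma free_algebra_finsum:
  assumes "finite I" "\<And>i. i \<in> I \<Longrightarrow> h i \<in> carrier (free_algebra R Xs)"
  shows "(\<Oplus>\<^bsub>free_algebra R Xs\<^esub>i\<in>I. h i) w = (\<Oplus>i\<in>I. h i w)"
proof -
  interpret F: assoc_algebra R "free_algebra R Xs" by (rule free_algebra_assoc_algebra)
  show ?thesis
    using assms
  proof (induction I)
    case empty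
    then show ?case by (simp add: F.M.finsum_empty free_algebra_simps)
  next
    case (insert i I)
    have "h j w \<in> carrier R" if "j \<in> insert i I" for j
      using insert.prems[OF that] by (auto simp: free_algebra_simps)
    with insert show ?case
      by (simp add: F.M.finsum_insert Pi_def) (simp add: free_algebra_simps)
  qed
qed

text \<open>A word beginning with y receives a contribution only from the summand of the letter y.
  Read backwards, the formula recovers all coefficients of \<open>\<alpha>\<close> and
  \<open>g\<close>, which is both existence and uniqueness of the decomposition.\<close>

lemma letter_sum_free_algebra:
  assumes "finite Xs" "\<And>x. x \<in> Xs \<Longrightarrow> \<alpha> x \<in> carrier R"
    "\<And>x. x \<in> Xs \<Longrightarrow> g x \<in> carrier (free_algebra R Xs)"
  shows "letter_sum (free_algebra R Xs) letter Xs \<alpha> g [] = \<zero>"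
    and "letter_sum (free_algebra R Xs) letter Xs \<alpha> g (y # w) =
      (if y \<in> Xs then if w = [] then \<alpha> y else g y w else \<zero>)"
proof -
  let ?F = "free_algebra R Xs"
  note simps = free_algebra_simps
  interpret F: assoc_algebra R ?F by (rule free_algebra_assoc_algebra)
  have g: "range (g x) \<subseteq> carrier R" "g x [] = \<zero>" if "x \<in> Xs" for x
    using assms(3)[OF that] by (auto simp: simps)
  have gc: "g x u \<in> carrier R" if "x \<in> Xs" for x u using g[OF that] by auto
  have cl: "\<alpha> x \<odot>\<^bsub>?F\<^esub> letter x \<oplus>\<^bsub>?F\<^esub> letter x \<otimes>\<^bsub>?F\<^esub> g x \<in> carrier ?F" if "x \<in> Xs" for x
    using that assms(2,3)
    by (intro F.M.a_closed F.smult_closed F.mult_closed letter_in_free_algebra)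
  have r: "range (letter x) \<subseteq> carrier R" for x :: 'c by (auto simp: letter_def)
  have sum: "letter_sum ?F letter Xs \<alpha> g u =
      (\<Oplus>x\<in>Xs. \<alpha> x \<otimes> letter x u \<oplus> conv R (letter x) (g x) u)" for u
    unfolding letter_sum_def by (simp add: free_algebra_finsum assms cl) (simp add: simps)
  have "letter_sum ?F letter Xs \<alpha> g [] = (\<Oplus>x\<in>Xs. \<zero>)"
    unfolding sum using g gc r assms(2)
    by (intro finsum_cong') (auto simp: conv_Nil letter_def image_subset_iff)
  then show "letter_sum ?F letter Xs \<alpha> g [] = \<zero>" by simp
  have "letter_sum ?F letter Xs \<alpha> g (y # w) =
      (\<Oplus>x\<in>Xs. if y = x then (if w = [] then \<alpha> x else g x w) else \<zero>)"
    unfolding sum using g gc r assms(2)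
    by (intro finsum_cong') (auto simp: conv_letter_Cons letter_def image_subset_iff)
  also have "\<dots> = (if y \<in> Xs then if w = [] then \<alpha> y else g y w else \<zero>)"
  proof (cases "y \<in> Xs")
    case True
    then show ?thesis
      using assms gc finsum_singleton[of y Xs "\<lambda>x. if w = [] then \<alpha> x else g x w"] by auto
  next
    case False
    then have "(\<Oplus>x\<in>Xs. if y = x then (if w = [] then \<alpha> x else g x w) else \<zero>) = (\<Oplus>x\<in>Xs. \<zero>)"
      by (intro finsum_cong') auto
    then show ?thesis using False by simp
  qed
  finally show "letter_sum ?F letter Xs \<alpha> g (y # w) =
      (if y \<in> Xs then if w = [] then \<alpha> y else g y w else \<zero>)" .
qed

lemma free_algebra_letter_algebra:
  assumes "finite Xs"
  shows "letter_algebra R (free_algebra R Xs) Xs letter"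
proof -
  let ?F = "free_algebra R Xs"
  note simps = free_algebra_simps
  interpret F: assoc_algebra R ?F by (rule free_algebra_assoc_algebra)
  show ?thesis
  proof (intro letter_algebra.intro F.assoc_algebra_axioms letter_algebra_axioms.intro)
    show "finite Xs" by fact
    show "letter x \<in> carrier ?F" if "x \<in> Xs" for x using that by (rule letter_in_free_algebra)
  next
    fix f assume f: "f \<in> carrier ?F"
    \<comment> \<open>The coefficient of the one-letter word \<open>[x]\<close> is carried by the
      scalar part; \<open>g x\<close> must vanish at the empty word to be an element of the
      algebra.\<close>
    define g where "g x w = (if w = [] then \<zero> else f (x # w))" for x w
    have \<alpha>: "f [x] \<in> carrier R" for x using f by (auto simp: simps)
    have g: "g x \<in> carrier ?F" if "x \<in> Xs" for x
    proof -
      have "finite ((#) x -` {w. f w \<noteq> \<zero>})"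
        using f by (intro finite_vimageI) (auto simp: simps)
      then have "finite {w. g x w \<noteq> \<zero>}" by (rule finite_subset[rotated]) (auto simp: g_def)
      moreover have "range (g x) \<subseteq> carrier R" using f by (auto simp: simps g_def)
      moreover have "{w. g x w \<noteq> \<zero>} \<subseteq> lists Xs - {[]}" 
      proof
        fix w assume "w \<in> {w. g x w \<noteq> \<zero>}"
        then have "w \<noteq> []" "f (x # w) \<noteq> \<zero>" by (auto simp: g_def split: if_splits)
        then have "x # w \<in> lists Xs" using f by (auto simp: simps)
        then show "w \<in> lists Xs - {[]}" using \<open>w \<noteq> []\<close> by simp
      qed
      ultimately show ?thesis by (simp add: simps)
    qed
    have sum1: "letter_sum ?F letter Xs (\<lambda>x. f [x]) g [] = \<zero>"
      by (rule letter_sum_free_algebra(1)[OF assms]) (simp_all add: \<alpha> g)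
    have sum2: "letter_sum ?F letter Xs (\<lambda>x. f [x]) g (y # u) =
        (if y \<in> Xs then if u = [] then f [y] else g y u else \<zero>)" for y u
      by (rule letter_sum_free_algebra(2)[OF assms]) (simp_all add: \<alpha> g)
    have "f w = letter_sum ?F letter Xs (\<lambda>x. f [x]) g w" for w
    proof (cases w)
      case Nil
      have "f [] = \<zero>" using f by (auto simp: simps)
      then show ?thesis using Nil sum1 by simp
    next
      case (Cons y u)
      have "f (y # u) = \<zero>" if "y \<notin> Xs" using f that by (auto simp: simps)
      then show ?thesis unfolding Cons sum2 by (auto simp: g_def)
    qed
    then have "f = letter_sum ?F letter Xs (\<lambda>x. f [x]) g" by (rule ext)
    then show "\<exists>\<alpha> g. (\<forall>x\<in>Xs. \<alpha> x \<in> carrier R \<and> g x \<in> carrier ?F) \<and>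
        f = letter_sum ?F letter Xs \<alpha> g"
      using \<alpha> g by (intro exI[of _ "\<lambda>x. f [x]"] exI[of _ g] conjI) (simp_all add: \<alpha> g)
  next
    fix \<alpha> g x
    assume \<alpha>: "\<And>x. x \<in> Xs \<Longrightarrow> \<alpha> x \<in> carrier R" and g: "\<And>x. x \<in> Xs \<Longrightarrow> g x \<in> carrier ?F"
      and 0: "letter_sum ?F letter Xs \<alpha> g = \<zero>\<^bsub>?F\<^esub>" and x: "x \<in> Xs"
    have *: "(if w = [] then \<alpha> x else g x w) = \<zero>" for w
    proof -
      have "letter_sum ?F letter Xs \<alpha> g (x # w) =
          (if x \<in> Xs then if w = [] then \<alpha> x else g x w else \<zero>)"
        by (rule letter_sum_free_algebra(2)[OF assms]) (simp_all add: \<alpha> g)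
      then show ?thesis using 0 x by (simp add: simps)
    qed
    have "g x w = \<zero>" for w using *[of w] g[OF x] by (cases "w = []") (auto simp: simps)
    then have "g x = (\<lambda>w. \<zero>)" by auto
    then show "\<alpha> x = \<zero> \<and> g x = \<zero>\<^bsub>?F\<^esub>" using *[of "[]"] by (simp add: simps)
  qed
qed

end

section \<open>Coordinates and quotients by powers\<close>

lemma with_smult_simps [simp]:
  "carrier (with_smult R s) = carrier R" "mult (with_smult R s) = mult R"
  "one (with_smult R s) = one R" "zero (with_smult R s) = zero R"
  "add (with_smult R s) = add R" "smult (with_smult R s) = s"
  by (simp_all add: with_smult_def ring.defs)

context assoc_algebra
begin

lemma mult_zero [simp]:
  assumes "f \<in> carrier A"
  shows "\<zero>\<^bsub>A\<^esub> \<otimes>\<^bsub>A\<^esub> f = \<zero>\<^bsub>A\<^esub>" "f \<otimes>\<^bsub>A\<^esub> \<zero>\<^bsub>A\<^esub> = \<zero>\<^bsub>A\<^esub>"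
proof -
  have "(\<zero> \<odot>\<^bsub>A\<^esub> \<zero>\<^bsub>A\<^esub>) \<otimes>\<^bsub>A\<^esub> f = \<zero>\<^bsub>A\<^esub>"
    by (subst smult_mult_left) (use assms mult_closed in auto)
  then show "\<zero>\<^bsub>A\<^esub> \<otimes>\<^bsub>A\<^esub> f = \<zero>\<^bsub>A\<^esub>" by simp
  have "f \<otimes>\<^bsub>A\<^esub> (\<zero> \<odot>\<^bsub>A\<^esub> \<zero>\<^bsub>A\<^esub>) = \<zero>\<^bsub>A\<^esub>"
    by (subst smult_mult_right) (use assms mult_closed in auto)
  then show "f \<otimes>\<^bsub>A\<^esub> \<zero>\<^bsub>A\<^esub> = \<zero>\<^bsub>A\<^esub>" by simp
qed

lemma finsum_mult_right:
  assumes "finite I" "f \<in> carrier A" "t \<in> I \<rightarrow> carrier A"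
  shows "(\<Oplus>\<^bsub>A\<^esub>i\<in>I. t i) \<otimes>\<^bsub>A\<^esub> f = (\<Oplus>\<^bsub>A\<^esub>i\<in>I. t i \<otimes>\<^bsub>A\<^esub> f)"
  using assms by (induction I) (auto simp: Pi_def mult_closed distrib_right)

end

section \<open>Coordinates of an element along words\<close>

context letter_algebra
begin

definition admissible :: "('x \<Rightarrow> 'a) \<Rightarrow> ('x \<Rightarrow> 'c) \<Rightarrow> bool" where
  "admissible \<alpha> g \<longleftrightarrow> (\<forall>x\<in>Xs. \<alpha> x \<in> carrier K \<and> g x \<in> carrier A)"

lemma admissibleD:
  assumes "admissible \<alpha> g" "x \<in> Xs"
  shows "\<alpha> x \<in> carrier K" "g x \<in> carrier A"
    "\<alpha> x \<odot>\<^bsub>A\<^esub> e x \<oplus>\<^bsub>A\<^esub> e x \<otimes>\<^bsub>A\<^esub> g x \<in> carrier A"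
  using assms letter_closed by (auto simp: admissible_def mult_closed)

lemma letter_sum_closed: "admissible \<alpha> g \<Longrightarrow> letter_sum A e Xs \<alpha> g \<in> carrier A"
  unfolding letter_sum_def by (intro M.finsum_closed Pi_I admissibleD(3))

lemma letter_sum_add:
  assumes "admissible \<alpha> g" "admissible \<beta> h"
  shows "letter_sum A e Xs \<alpha> g \<oplus>\<^bsub>A\<^esub> letter_sum A e Xs \<beta> h =
    letter_sum A e Xs (\<lambda>x. \<alpha> x \<oplus> \<beta> x) (\<lambda>x. g x \<oplus>\<^bsub>A\<^esub> h x)"
proof -
  have "letter_sum A e Xs \<alpha> g \<oplus>\<^bsub>A\<^esub> letter_sum A e Xs \<beta> h =
      (\<Oplus>\<^bsub>A\<^esub>x\<in>Xs. (\<alpha> x \<odot>\<^bsub>A\<^esub> e x \<oplus>\<^bsub>A\<^esub> e x \<otimes>\<^bsub>A\<^esub> g x) \<oplus>\<^bsub>A\<^esub> (\<beta> x \<odot>\<^bsub>A\<^esub> e x \<oplus>\<^bsub>A\<^esub> e x \<otimes>\<^bsub>A\<^esub> h x))"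
    unfolding letter_sum_def
    by (rule M.finsum_addf[symmetric]) (use assms admissibleD in blast)+
  also have "\<dots> = letter_sum A e Xs (\<lambda>x. \<alpha> x \<oplus> \<beta> x) (\<lambda>x. g x \<oplus>\<^bsub>A\<^esub> h x)"
    unfolding letter_sum_def
  proof (rule M.finsum_cong')
    fix x assume x: "x \<in> Xs"
    note c = admissibleD(1,2)[OF assms(1) x] admissibleD(1,2)[OF assms(2) x] letter_closed[OF x]
    show "(\<alpha> x \<odot>\<^bsub>A\<^esub> e x \<oplus>\<^bsub>A\<^esub> e x \<otimes>\<^bsub>A\<^esub> g x) \<oplus>\<^bsub>A\<^esub> (\<beta> x \<odot>\<^bsub>A\<^esub> e x \<oplus>\<^bsub>A\<^esub> e x \<otimes>\<^bsub>A\<^esub> h x) =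
        (\<alpha> x \<oplus> \<beta> x) \<odot>\<^bsub>A\<^esub> e x \<oplus>\<^bsub>A\<^esub> e x \<otimes>\<^bsub>A\<^esub> (g x \<oplus>\<^bsub>A\<^esub> h x)"
      using c by (simp add: smult_l_distr distrib_left mult_closed M.a_ac)
  next
    show "(\<lambda>x. (\<alpha> x \<oplus> \<beta> x) \<odot>\<^bsub>A\<^esub> e x \<oplus>\<^bsub>A\<^esub> e x \<otimes>\<^bsub>A\<^esub> (g x \<oplus>\<^bsub>A\<^esub> h x)) \<in> Xs \<rightarrow> carrier A"
      using assms admissibleD(1,2) letter_closed by (auto simp: mult_closed)
  qed simp
  finally show ?thesis .
qed

lemma letter_sum_smult:
  assumes "admissible \<alpha> g" "a \<in> carrier K"
  shows "a \<odot>\<^bsub>A\<^esub> letter_sum A e Xs \<alpha> g = letter_sum A e Xs (\<lambda>x. a \<otimes> \<alpha> x) (\<lambda>x. a \<odot>\<^bsub>A\<^esub> g x)"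
proof -
  have "a \<odot>\<^bsub>A\<^esub> letter_sum A e Xs \<alpha> g =
      (\<Oplus>\<^bsub>A\<^esub>x\<in>Xs. a \<odot>\<^bsub>A\<^esub> (\<alpha> x \<odot>\<^bsub>A\<^esub> e x \<oplus>\<^bsub>A\<^esub> e x \<otimes>\<^bsub>A\<^esub> g x))"
    unfolding letter_sum_def
    by (rule finsum_smult_ldistr) (use assms admissibleD finite_letters in blast)+
  also have "\<dots> = letter_sum A e Xs (\<lambda>x. a \<otimes> \<alpha> x) (\<lambda>x. a \<odot>\<^bsub>A\<^esub> g x)"
    unfolding letter_sum_def
  proof (rule M.finsum_cong')
    fix x assume x: "x \<in> Xs"
    note c = admissibleD(1,2)[OF assms(1) x] letter_closed[OF x]
    show "a \<odot>\<^bsub>A\<^esub> (\<alpha> x \<odot>\<^bsub>A\<^esub> e x \<oplus>\<^bsub>A\<^esub> e x \<otimes>\<^bsub>A\<^esub> g x) =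
        (a \<otimes> \<alpha> x) \<odot>\<^bsub>A\<^esub> e x \<oplus>\<^bsub>A\<^esub> e x \<otimes>\<^bsub>A\<^esub> (a \<odot>\<^bsub>A\<^esub> g x)"
      using c assms(2) by (simp add: smult_r_distr mult_closed smult_assoc1 smult_mult_right)
  next
    show "(\<lambda>x. (a \<otimes> \<alpha> x) \<odot>\<^bsub>A\<^esub> e x \<oplus>\<^bsub>A\<^esub> e x \<otimes>\<^bsub>A\<^esub> (a \<odot>\<^bsub>A\<^esub> g x)) \<in> Xs \<rightarrow> carrier A"
      using assms admissibleD(1,2) letter_closed by (auto simp: mult_closed)
  qed simp
  finally show ?thesis .
qed

text \<open>Each summand is (\<alpha> e + e g) f = e (\<alpha> f + g f). Multiplication on the right
  thus moves the scalar part behind the letter; this is the source of the recursion for coordinates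
  of products.\<close>

lemma letter_sum_mult:
  assumes "admissible \<alpha> g" "f \<in> carrier A"
  shows "letter_sum A e Xs \<alpha> g \<otimes>\<^bsub>A\<^esub> f =
    letter_sum A e Xs (\<lambda>x. \<zero>) (\<lambda>x. \<alpha> x \<odot>\<^bsub>A\<^esub> f \<oplus>\<^bsub>A\<^esub> g x \<otimes>\<^bsub>A\<^esub> f)"
proof -
  have "letter_sum A e Xs \<alpha> g \<otimes>\<^bsub>A\<^esub> f =
      (\<Oplus>\<^bsub>A\<^esub>x\<in>Xs. (\<alpha> x \<odot>\<^bsub>A\<^esub> e x \<oplus>\<^bsub>A\<^esub> e x \<otimes>\<^bsub>A\<^esub> g x) \<otimes>\<^bsub>A\<^esub> f)"
    unfolding letter_sum_def
    by (rule finsum_mult_right) (use assms admissibleD finite_letters in blast)+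
  also have "\<dots> = letter_sum A e Xs (\<lambda>x. \<zero>) (\<lambda>x. \<alpha> x \<odot>\<^bsub>A\<^esub> f \<oplus>\<^bsub>A\<^esub> g x \<otimes>\<^bsub>A\<^esub> f)"
    unfolding letter_sum_def
  proof (rule M.finsum_cong')
    fix x assume x: "x \<in> Xs"
    note c = admissibleD(1,2)[OF assms(1) x] letter_closed[OF x]
    show "(\<alpha> x \<odot>\<^bsub>A\<^esub> e x \<oplus>\<^bsub>A\<^esub> e x \<otimes>\<^bsub>A\<^esub> g x) \<otimes>\<^bsub>A\<^esub> f =
        \<zero> \<odot>\<^bsub>A\<^esub> e x \<oplus>\<^bsub>A\<^esub> e x \<otimes>\<^bsub>A\<^esub> (\<alpha> x \<odot>\<^bsub>A\<^esub> f \<oplus>\<^bsub>A\<^esub> g x \<otimes>\<^bsub>A\<^esub> f)"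
      using c assms(2)
      by (simp add: distrib_left distrib_right mult_closed mult_assoc smult_mult_left smult_mult_right)
  next
    show "(\<lambda>x. \<zero> \<odot>\<^bsub>A\<^esub> e x \<oplus>\<^bsub>A\<^esub> e x \<otimes>\<^bsub>A\<^esub> (\<alpha> x \<odot>\<^bsub>A\<^esub> f \<oplus>\<^bsub>A\<^esub> g x \<otimes>\<^bsub>A\<^esub> f)) \<in> Xs \<rightarrow> carrier A"
      using assms admissibleD(1,2) letter_closed by (auto simp: mult_closed)
  qed simp
  finally show ?thesis .
qed

lemma letter_sum_inj:
  assumes "admissible \<alpha> g" "admissible \<beta> h" "letter_sum A e Xs \<alpha> g = letter_sum A e Xs \<beta> h" "x \<in> Xs"
  shows "\<alpha> x = \<beta> x" "g x = h x"
proof -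
  have m1: "\<ominus> \<one> \<in> carrier K" by simp
  have neg: "admissible (\<lambda>x. \<ominus> \<one> \<otimes> \<beta> x) (\<lambda>x. \<ominus> \<one> \<odot>\<^bsub>A\<^esub> h x)"
    using assms(2) m1 by (auto simp: admissible_def)
  have "letter_sum A e Xs (\<lambda>x. \<alpha> x \<oplus> \<ominus> \<one> \<otimes> \<beta> x) (\<lambda>x. g x \<oplus>\<^bsub>A\<^esub> \<ominus> \<one> \<odot>\<^bsub>A\<^esub> h x) =
      letter_sum A e Xs \<beta> h \<oplus>\<^bsub>A\<^esub> \<ominus> \<one> \<odot>\<^bsub>A\<^esub> letter_sum A e Xs \<beta> h"
    using letter_sum_add[OF assms(1) neg] letter_sum_smult[OF assms(2) m1] assms(3) by simp
  also have "\<dots> = \<zero>\<^bsub>A\<^esub>"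
    using letter_sum_closed[OF assms(2)] by (simp add: smult_l_minus M.r_neg)
  finally have "\<alpha> x \<oplus> \<ominus> \<one> \<otimes> \<beta> x = \<zero> \<and> g x \<oplus>\<^bsub>A\<^esub> \<ominus> \<one> \<odot>\<^bsub>A\<^esub> h x = \<zero>\<^bsub>A\<^esub>"
    using assms m1 by (intro letter_sum_zero) (auto simp: admissible_def)
  then have "\<alpha> x \<ominus> \<beta> x = \<zero>" "g x \<ominus>\<^bsub>A\<^esub> h x = \<zero>\<^bsub>A\<^esub>"
    using admissibleD(1,2)[OF assms(2,4)] by (simp_all add: a_minus_def l_minus smult_l_minus)
  then show "\<alpha> x = \<beta> x" "g x = h x"
    using admissibleD(1,2)[OF assms(2,4)] admissibleD(1,2)[OF assms(1,4)]
      M.minus_equality[of "g x" "\<ominus>\<^bsub>A\<^esub> h x"] by (simp_all add: a_minus_def[of A])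
qed

text \<open>The scalar part is chosen first, and \<open>rest\<close> is then chosen to fit it. The
  values are determined only at letters; elsewhere the choice is arbitrary.\<close>

definition lead :: "'c \<Rightarrow> 'x \<Rightarrow> 'a" where
  "lead f = (SOME \<alpha>. \<exists>g. admissible \<alpha> g \<and> f = letter_sum A e Xs \<alpha> g)"

definition rest :: "'c \<Rightarrow> 'x \<Rightarrow> 'c" where
  "rest f = (SOME g. admissible (lead f) g \<and> f = letter_sum A e Xs (lead f) g)"

lemma
  assumes "f \<in> carrier A"
  shows admissible_lead_rest: "admissible (lead f) (rest f)"
    and letter_sum_lead_rest: "letter_sum A e Xs (lead f) (rest f) = f"
proof -
  have "\<exists>\<alpha> g. admissible \<alpha> g \<and> f = letter_sum A e Xs \<alpha> g"
    using letter_sum_exists[OF assms] by (simp add: admissible_def)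
  then have "\<exists>g. admissible (lead f) g \<and> f = letter_sum A e Xs (lead f) g"
    unfolding lead_def by (rule someI_ex)
  then have "admissible (lead f) (rest f) \<and> f = letter_sum A e Xs (lead f) (rest f)"
    unfolding rest_def by (rule someI_ex)
  then show "admissible (lead f) (rest f)" "letter_sum A e Xs (lead f) (rest f) = f" by auto
qed

lemma lead_rest_unique:
  assumes "admissible \<alpha> g" "f = letter_sum A e Xs \<alpha> g" "x \<in> Xs"
  shows "lead f x = \<alpha> x" "rest f x = g x"
proof -
  have f: "f \<in> carrier A" using assms letter_sum_closed by simp
  note * = letter_sum_inj[OF admissible_lead_rest[OF f] assms(1) _ assms(3)]
  show "lead f x = \<alpha> x" "rest f x = g x"
    using * letter_sum_lead_rest[OF f] assms(2) by simp_all
qed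

lemma lead_rest_closed:
  "\<lbrakk>f \<in> carrier A; x \<in> Xs\<rbrakk> \<Longrightarrow> lead f x \<in> carrier K"
  "\<lbrakk>f \<in> carrier A; x \<in> Xs\<rbrakk> \<Longrightarrow> rest f x \<in> carrier A"
  using admissible_lead_rest admissibleD(1,2) by blast+

text \<open>In the free algebra with its own letters these are the coefficients. The test for
  membership in \<open>Xs\<close> discards the arbitrary values of \<open>lead\<close> and
  \<open>rest\<close>; the empty word gets zero because there is no constant term.\<close>

primrec coord :: "'c \<Rightarrow> 'x list \<Rightarrow> 'a" where
  "coord f [] = \<zero>"
| "coord f (x # w) = (if x \<in> Xs then if w = [] then lead f x else coord (rest f x) w else \<zero>)"

lemma coord_closed: "f \<in> carrier A \<Longrightarrow> coord f w \<in> carrier K"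
  by (induction w arbitrary: f) (auto simp: lead_rest_closed)

lemma coord_nonletter: "w \<notin> lists Xs \<Longrightarrow> coord f w = \<zero>"
  by (induction w arbitrary: f) auto

lemma lead_rest_add:
  assumes "f \<in> carrier A" "g \<in> carrier A" "x \<in> Xs"
  shows "lead (f \<oplus>\<^bsub>A\<^esub> g) x = lead f x \<oplus> lead g x"
    "rest (f \<oplus>\<^bsub>A\<^esub> g) x = rest f x \<oplus>\<^bsub>A\<^esub> rest g x"
proof -
  have "admissible (\<lambda>x. lead f x \<oplus> lead g x) (\<lambda>x. rest f x \<oplus>\<^bsub>A\<^esub> rest g x)"
    using assms lead_rest_closed by (simp add: admissible_def)
  note * = lead_rest_unique[OF this _ assms(3)]
  show "lead (f \<oplus>\<^bsub>A\<^esub> g) x = lead f x \<oplus> lead g x"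
    "rest (f \<oplus>\<^bsub>A\<^esub> g) x = rest f x \<oplus>\<^bsub>A\<^esub> rest g x"
    by (rule *; use assms in \<open>simp add: letter_sum_add[symmetric] admissible_lead_rest
        letter_sum_lead_rest\<close>)+
qed

lemma lead_rest_smult:
  assumes "f \<in> carrier A" "a \<in> carrier K" "x \<in> Xs"
  shows "lead (a \<odot>\<^bsub>A\<^esub> f) x = a \<otimes> lead f x" "rest (a \<odot>\<^bsub>A\<^esub> f) x = a \<odot>\<^bsub>A\<^esub> rest f x"
proof -
  have "admissible (\<lambda>x. a \<otimes> lead f x) (\<lambda>x. a \<odot>\<^bsub>A\<^esub> rest f x)"
    using assms lead_rest_closed by (simp add: admissible_def)
  note * = lead_rest_unique[OF this _ assms(3)]
  show "lead (a \<odot>\<^bsub>A\<^esub> f) x = a \<otimes> lead f x" "rest (a \<odot>\<^bsub>A\<^esub> f) x = a \<odot>\<^bsub>A\<^esub> rest f x"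
    by (rule *; use assms in \<open>simp add: letter_sum_smult[symmetric] admissible_lead_rest
        letter_sum_lead_rest\<close>)+
qed

lemma lead_rest_mult:
  assumes "f \<in> carrier A" "g \<in> carrier A" "x \<in> Xs"
  shows "lead (f \<otimes>\<^bsub>A\<^esub> g) x = \<zero>"
    "rest (f \<otimes>\<^bsub>A\<^esub> g) x = lead f x \<odot>\<^bsub>A\<^esub> g \<oplus>\<^bsub>A\<^esub> rest f x \<otimes>\<^bsub>A\<^esub> g"
proof -
  have "admissible (\<lambda>x. \<zero>) (\<lambda>x. lead f x \<odot>\<^bsub>A\<^esub> g \<oplus>\<^bsub>A\<^esub> rest f x \<otimes>\<^bsub>A\<^esub> g)"
    using assms lead_rest_closed by (simp add: admissible_def mult_closed)
  note * = lead_rest_unique[OF this _ assms(3)]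
  show "lead (f \<otimes>\<^bsub>A\<^esub> g) x = \<zero>"
    "rest (f \<otimes>\<^bsub>A\<^esub> g) x = lead f x \<odot>\<^bsub>A\<^esub> g \<oplus>\<^bsub>A\<^esub> rest f x \<otimes>\<^bsub>A\<^esub> g"
    by (rule *; use assms in \<open>simp add: letter_sum_mult[symmetric] admissible_lead_rest
        letter_sum_lead_rest\<close>)+
qed

lemma coord_add:
  "\<lbrakk>f \<in> carrier A; g \<in> carrier A\<rbrakk> \<Longrightarrow> coord (f \<oplus>\<^bsub>A\<^esub> g) w = coord f w \<oplus> coord g w"
  by (induction w arbitrary: f g) (auto simp: lead_rest_add lead_rest_closed)

lemma coord_smult:
  "\<lbrakk>f \<in> carrier A; a \<in> carrier K\<rbrakk> \<Longrightarrow> coord (a \<odot>\<^bsub>A\<^esub> f) w = a \<otimes> coord f w"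
  by (induction w arbitrary: f) (auto simp: lead_rest_smult lead_rest_closed)

text \<open>The rest of a product, given by \<open>lead_rest_mult\<close>, and the first-letter
  recursion of the convolution have the same shape. Together with additivity this maps A into formal
  power series; the map need be neither injective nor surjective.\<close>

lemma coord_mult:
  "\<lbrakk>f \<in> carrier A; g \<in> carrier A\<rbrakk> \<Longrightarrow> coord (f \<otimes>\<^bsub>A\<^esub> g) w = conv K (coord f) (coord g) w"
proof (induction w arbitrary: f)
  case Nil
  then show ?case by (subst conv_Nil) (auto simp: coord_closed)
next
  case (Cons x w)
  have r: "range (coord f) \<subseteq> carrier K" "range (coord g) \<subseteq> carrier K"
    using Cons.prems coord_closed by auto
  have gc: "coord g w \<in> carrier K" "coord g (x # w) \<in> carrier K" for w x
    by (rule coord_closed[OF Cons.prems(2)])+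
  show ?case
  proof (cases "x \<in> Xs")
    case False
    then have "(\<lambda>u. coord f (x # u)) = (\<lambda>u. \<zero>)" by auto
    then have "conv K (\<lambda>u. coord f (x # u)) (coord g) w = \<zero>"
      by (simp only: conv_zero_left[OF r(2)])
    then show ?thesis using False gc(1)[of w] gc(2)
      by (simp only: conv_Cons[OF r]) simp
  next
    case True
    \<comment> \<open>The function obtained from \<open>coord f\<close> by stripping x splits into
      the constant \<open>lead f x\<close> at the empty word and the coordinates of
      \<open>rest f x\<close>, which themselves vanish there.\<close>
    define d where "d u = (if u = [] then lead f x else \<zero>)" for u :: "'x list"
    have lr: "lead f x \<in> carrier K" "rest f x \<in> carrier A"
      using True Cons.prems lead_rest_closed by auto
    have d: "range d \<subseteq> carrier K" "range (coord (rest f x)) \<subseteq> carrier K"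
      using lr coord_closed by (auto simp: d_def)
    have "(\<lambda>u. coord f (x # u)) = (\<lambda>u. d u \<oplus> coord (rest f x) u)"
      using True lr by (auto simp: d_def coord_closed fun_eq_iff)
    then have "conv K (coord f) (coord g) (x # w) =
        coord f [] \<otimes> coord g (x # w) \<oplus> (conv K d (coord g) w \<oplus> conv K (coord (rest f x)) (coord g) w)"
      by (simp only: conv_Cons[OF r] conv_add_left[OF d r(2)])
    also have "conv K d (coord g) w = lead f x \<otimes> coord g w"
      using conv_unit_left[OF r(2) d(1)] by (simp add: d_def)
    also have "conv K (coord (rest f x)) (coord g) w = coord (rest f x \<otimes>\<^bsub>A\<^esub> g) w"
      using Cons lr by simp
    finally have "conv K (coord f) (coord g) (x # w) =
        coord (lead f x \<odot>\<^bsub>A\<^esub> g \<oplus>\<^bsub>A\<^esub> rest f x \<otimes>\<^bsub>A\<^esub> g) w"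
      using lr Cons.prems gc by (simp add: coord_add coord_smult mult_closed coord_closed del: coord.simps(2))
    then show ?thesis using True Cons.prems by (cases w) (simp_all add: lead_rest_mult)
  qed
qed

text \<open>Only the coordinates on words shorter than n can be prescribed: n steps of the
  decomposition build an element, whereas infinitely many prescribed values may belong to no element
  of A.\<close>

lemma coord_surj:
  assumes "range t \<subseteq> carrier K" "t [] = \<zero>" "\<And>w. w \<notin> lists Xs \<Longrightarrow> t w = \<zero>"
  shows "\<exists>f\<in>carrier A. \<forall>w. length w < n \<longrightarrow> coord f w = t w"
  using assms
proof (induction n arbitrary: t)
  case 0
  then show ?case by (auto intro!: bexI[of _ "\<zero>\<^bsub>A\<^esub>"])
next
  case (Suc n)
  have tc: "t w \<in> carrier K" for w using Suc.prems by auto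
  \<comment> \<open>The shifted function is reset to zero at the empty word, since
    \<open>t [x]\<close> is realized by the scalar coefficient of the letter x.\<close>
  have "\<exists>f\<in>carrier A. \<forall>w. length w < n \<longrightarrow> coord f w = (if w = [] then \<zero> else t (x # w))" if "x \<in> Xs" for x
    by (rule Suc.IH) (use that tc Suc.prems in auto)
  then obtain g where g: "\<And>x. x \<in> Xs \<Longrightarrow> g x \<in> carrier A"
      "\<And>x w. x \<in> Xs \<Longrightarrow> length w < n \<Longrightarrow> coord (g x) w = (if w = [] then \<zero> else t (x # w))"
    by metis
  have adm: "admissible (\<lambda>x. t [x]) g" using tc g by (simp add: admissible_def)
  let ?f = "letter_sum A e Xs (\<lambda>x. t [x]) g"
  have "coord ?f w = t w" if "length w < Suc n" for w
  proof (cases w)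
    case Nil
    then show ?thesis using Suc.prems by simp
  next
    case (Cons x u)
    have "t (x # u) = \<zero>" if "x \<notin> Xs" using Suc.prems(3)[of "x # u"] that by auto
    then show ?thesis using Cons that lead_rest_unique[OF adm refl, of x] g(2)[of x u] by auto
  qed
  then show ?case using letter_sum_closed[OF adm] by blast
qed

section \<open>Powers of the algebra in terms of coordinates\<close>

lemma ring_power_subgroup: "n \<ge> 1 \<Longrightarrow> subgroup (ring_power A n) (add_monoid A)"
proof -
  assume n: "n \<ge> 1"
  have closed: "nonempty_prod A as \<in> carrier A" if "as \<noteq> []" "set as \<subseteq> carrier A" for as
    using that by (induction as rule: induct_list012) (auto simp: mult_closed)
  have "{nonempty_prod A as | as. length as = n \<and> set as \<subseteq> carrier A} \<subseteq> carrier A"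
  proof clarify
    fix as :: "'c list" assume *: "set as \<subseteq> carrier A" "n = length as"
    from * n have "as \<noteq> []" by auto
    from this *(1) show "nonempty_prod A as \<in> carrier A" by (rule closed)
  qed
  then show ?thesis unfolding ring_power_def by (intro M.add.generate_is_subgroup) simp
qed

lemma mult_ring_power:
  assumes "f \<in> carrier A" "p \<in> ring_power A n" "n \<ge> 1"
  shows "f \<otimes>\<^bsub>A\<^esub> p \<in> ring_power A (Suc n)"
proof -
  interpret S: subgroup "ring_power A (Suc n)" "add_monoid A" by (rule ring_power_subgroup) simp
  interpret S': subgroup "ring_power A n" "add_monoid A" using assms(3) by (rule ring_power_subgroup)
  let ?S = "{nonempty_prod A as | as. length as = n \<and> set as \<subseteq> carrier A}"
  have base: "f \<otimes>\<^bsub>A\<^esub> s \<in> ring_power A (Suc n)" if s: "s \<in> ?S" for s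
  proof -
    obtain as where as: "s = nonempty_prod A as" "length as = n" "set as \<subseteq> carrier A" using s by auto
    have "f \<otimes>\<^bsub>A\<^esub> s = nonempty_prod A (f # as)" using as assms(3) by (cases as) auto
    then show ?thesis unfolding ring_power_def using as assms(1)
      by (intro generate.incl) (auto intro!: exI[of _ "f # as"])
  qed
  have S: "s \<in> carrier A" if "s \<in> ?S" for s
    using generate.incl[OF that] S'.subset unfolding ring_power_def by auto
  from assms(2) have "p \<in> generate (add_monoid A) ?S" unfolding ring_power_def .
  then have "p \<in> carrier A \<and> f \<otimes>\<^bsub>A\<^esub> p \<in> ring_power A (Suc n)"
  proof (induction rule: generate.induct)
    case one
    then show ?case using assms(1) S.one_closed by simp
  next
    case (incl h)
    then show ?case using base S by blast
  next
    case (inv h)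
    have h: "h \<in> carrier A" using S inv by blast
    have "f \<otimes>\<^bsub>A\<^esub> (\<ominus> \<one> \<odot>\<^bsub>A\<^esub> h) = \<ominus> \<one> \<odot>\<^bsub>A\<^esub> (f \<otimes>\<^bsub>A\<^esub> h)"
      using h assms(1) by (intro smult_mult_right) auto
    then have "f \<otimes>\<^bsub>A\<^esub> (\<ominus>\<^bsub>A\<^esub> h) = \<ominus>\<^bsub>A\<^esub> (f \<otimes>\<^bsub>A\<^esub> h)"
      using h assms(1) by (simp add: smult_l_minus mult_closed)
    then show ?case using S.m_inv_closed[OF base[OF inv]] h by (simp add: a_inv_def[symmetric])
  next
    case (eng h k)
    then show ?case using S.m_closed assms(1) by (simp add: distrib_left)
  qed
  then show ?thesis by simp
qed

text \<open>A product of n factors has no coordinate on a shorter word, because every factor uses up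
  at least one letter. Conversely, if the coordinates on words shorter than n + 1 vanish, the scalar
  parts are zero and every rest lies in the n-th power by induction; multiplying it by a letter from
  the left gains one degree.\<close>

lemma ring_power_eq:
  assumes "n \<ge> 1"
  shows "ring_power A n = {f \<in> carrier A. \<forall>w. length w < n \<longrightarrow> coord f w = \<zero>}" (is "_ = ?J n")
proof
  have prod: "nonempty_prod A as \<in> ?J (length as)" if "as \<noteq> []" "set as \<subseteq> carrier A" for as
    using that
  proof (induction as rule: induct_list012)
    case (2 a)
    then show ?case by auto
  next
    case (3 a b bs)
    let ?p = "nonempty_prod A (b # bs)"
    have p: "?p \<in> carrier A" "\<And>w. length w < length (b # bs) \<Longrightarrow> coord ?p w = \<zero>" using 3 by auto
    have a: "a \<in> carrier A" using 3 by simp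
    have r: "range (coord a) \<subseteq> carrier K" "range (coord ?p) \<subseteq> carrier K"
      using a p(1) coord_closed by auto
    have "coord (a \<otimes>\<^bsub>A\<^esub> ?p) w = \<zero>" if w: "length w < length (a # b # bs)" for w
    proof (rule ccontr)
      assume "coord (a \<otimes>\<^bsub>A\<^esub> ?p) w \<noteq> \<zero>"
      then obtain u v where uv: "w = u @ v" "coord a u \<noteq> \<zero>" "coord ?p v \<noteq> \<zero>"
        using conv_nonzero_split[OF r, of w] unfolding coord_mult[OF a p(1)] by blast
      have "u \<noteq> []" using uv(2) by auto
      then have "length v < length (b # bs)" using w uv(1) by (cases u) auto
      then show False using p(2) uv(3) by blast
    qed
    then show ?case using a p(1) by (simp add: mult_closed)
  qed simp
  show "ring_power A n \<subseteq> ?J n"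
  proof -
    have "coord (\<ominus>\<^bsub>A\<^esub> f) w = \<ominus> \<one> \<otimes> coord f w" if "f \<in> carrier A" for f w
      using that coord_smult[of f "\<ominus> \<one>" w] by (simp add: smult_l_minus)
    moreover have "coord \<zero>\<^bsub>A\<^esub> w = \<zero>" for w
      using coord_smult[of "\<zero>\<^bsub>A\<^esub>" \<zero> w] by (simp add: coord_closed)
    ultimately have "subgroup (?J n) (add_monoid A)"
      by (intro M.add.subgroupI) (auto simp: coord_add a_inv_def[symmetric])
    moreover have "{nonempty_prod A as | as. length as = n \<and> set as \<subseteq> carrier A} \<subseteq> ?J n"
    proof (intro subsetI)
      fix f assume "f \<in> {nonempty_prod A as | as. length as = n \<and> set as \<subseteq> carrier A}"
      then obtain as where as: "f = nonempty_prod A as" "length as = n" "set as \<subseteq> carrier A" by blast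
      from as(2) assms have "as \<noteq> []" by auto
      from prod[OF this as(3)] show "f \<in> ?J n" by (simp only: as(1,2))
    qed
    ultimately show ?thesis unfolding ring_power_def
      by (intro M.add.generate_subgroup_incl)
  qed
  show "?J n \<subseteq> ring_power A n"
    using assms
  proof (induction n rule: nat_induct_at_least)
    case base
    have "f \<in> ring_power A 1" if "f \<in> carrier A" for f
      unfolding ring_power_def using that by (intro generate.incl) (auto intro!: exI[of _ "[f]"])
    then show ?case by auto
  next
    case (Suc n)
    interpret S: subgroup "ring_power A (Suc n)" "add_monoid A" by (rule ring_power_subgroup) simp
    show ?case
    proof
      fix f assume f: "f \<in> ?J (Suc n)"
      \<comment> \<open>The coordinate at the one-letter word \<open>[x]\<close> is the scalar part,
        so it vanishes. Coordinates of \<open>rest f x\<close> on words shorter than n are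
        coordinates of f on words one letter longer.\<close>
      have summand: "lead f x \<odot>\<^bsub>A\<^esub> e x \<oplus>\<^bsub>A\<^esub> e x \<otimes>\<^bsub>A\<^esub> rest f x \<in> ring_power A (Suc n)" if x: "x \<in> Xs" for x
      proof -
        have lr: "lead f x = \<zero>" "rest f x \<in> carrier A"
          using f x lead_rest_closed Suc(1) by (auto dest!: spec[of _ "[x]"])
        have "coord (rest f x) w = \<zero>" if "length w < n" for w
          using f x that by (cases w) (auto dest!: spec[of _ "x # w"])
        then have "rest f x \<in> ring_power A n" using Suc lr by auto
        then have "e x \<otimes>\<^bsub>A\<^esub> rest f x \<in> ring_power A (Suc n)"
          using mult_ring_power letter_closed x Suc(1) by auto
        then show ?thesis using lr letter_closed x by (simp add: mult_closed)
      qed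
      have "(\<Oplus>\<^bsub>A\<^esub>x\<in>I. lead f x \<odot>\<^bsub>A\<^esub> e x \<oplus>\<^bsub>A\<^esub> e x \<otimes>\<^bsub>A\<^esub> rest f x) \<in> ring_power A (Suc n)"
        if "I \<subseteq> Xs" for I
        using finite_subset[OF that finite_letters] that
      proof (induction I)
        case empty
        then show ?case using S.one_closed by simp
      next
        case (insert x I)
        have "(\<lambda>x. lead f x \<odot>\<^bsub>A\<^esub> e x \<oplus>\<^bsub>A\<^esub> e x \<otimes>\<^bsub>A\<^esub> rest f x) \<in> insert x I \<rightarrow> carrier A"
          using insert.prems f admissibleD(3)[OF admissible_lead_rest] by auto
        then show ?case using insert S.m_closed[OF summand] by (simp add: Pi_def)
      qed
      from this[of Xs] show "f \<in> ring_power A (Suc n)"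
        using f letter_sum_lead_rest[of f] by (simp add: letter_sum_def)
    qed
  qed
qed

end

section \<open>Isomorphisms of algebras and quotients by a kernel\<close>

lemma algebra_isomorphic_sym:
  assumes iso: "algebra_isomorphic K A B"
    and closed: "\<And>x y. x \<in> carrier A \<Longrightarrow> y \<in> carrier A \<Longrightarrow> x \<oplus>\<^bsub>A\<^esub> y \<in> carrier A \<and> x \<otimes>\<^bsub>A\<^esub> y \<in> carrier A"
    "\<And>a x. a \<in> carrier K \<Longrightarrow> x \<in> carrier A \<Longrightarrow> a \<odot>\<^bsub>A\<^esub> x \<in> carrier A"
  shows "algebra_isomorphic K B A"
proof -
  obtain h where h: "bij_betw h (carrier A) (carrier B)"
    "\<And>x y. x \<in> carrier A \<Longrightarrow> y \<in> carrier A \<Longrightarrow> h (x \<oplus>\<^bsub>A\<^esub> y) = h x \<oplus>\<^bsub>B\<^esub> h y"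
    "\<And>x y. x \<in> carrier A \<Longrightarrow> y \<in> carrier A \<Longrightarrow> h (x \<otimes>\<^bsub>A\<^esub> y) = h x \<otimes>\<^bsub>B\<^esub> h y"
    "\<And>a x. a \<in> carrier K \<Longrightarrow> x \<in> carrier A \<Longrightarrow> h (a \<odot>\<^bsub>A\<^esub> x) = a \<odot>\<^bsub>B\<^esub> h x"
    using iso unfolding algebra_isomorphic_def by blast
  define k where "k = inv_into (carrier A) h"
  have k: "bij_betw k (carrier B) (carrier A)" unfolding k_def by (rule bij_betw_inv_into[OF h(1)])
  have kc: "k y \<in> carrier A" if "y \<in> carrier B" for y using bij_betwE[OF k] that by blast
  have hk: "h (k y) = y" if "y \<in> carrier B" for y
    unfolding k_def by (rule bij_betw_inv_into_right[OF h(1) that])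
  have kh: "k (h x) = x" if "x \<in> carrier A" for x
    unfolding k_def by (rule bij_betw_inv_into_left[OF h(1) that])
  have "k (x \<oplus>\<^bsub>B\<^esub> y) = k x \<oplus>\<^bsub>A\<^esub> k y" "k (x \<otimes>\<^bsub>B\<^esub> y) = k x \<otimes>\<^bsub>A\<^esub> k y"
    if xy: "x \<in> carrier B" "y \<in> carrier B" for x y
  proof -
    note c = kc[OF xy(1)] kc[OF xy(2)]
    have "k (h (k x \<oplus>\<^bsub>A\<^esub> k y)) = k x \<oplus>\<^bsub>A\<^esub> k y" "k (h (k x \<otimes>\<^bsub>A\<^esub> k y)) = k x \<otimes>\<^bsub>A\<^esub> k y"
      using closed(1)[OF c] kh by auto
    then show "k (x \<oplus>\<^bsub>B\<^esub> y) = k x \<oplus>\<^bsub>A\<^esub> k y" "k (x \<otimes>\<^bsub>B\<^esub> y) = k x \<otimes>\<^bsub>A\<^esub> k y"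
      by (simp_all only: h(2,3)[OF c] hk xy)
  qed
  moreover have "k (a \<odot>\<^bsub>B\<^esub> x) = a \<odot>\<^bsub>A\<^esub> k x" if ax: "a \<in> carrier K" "x \<in> carrier B" for a x
  proof -
    have "k (h (a \<odot>\<^bsub>A\<^esub> k x)) = a \<odot>\<^bsub>A\<^esub> k x" using closed(2)[OF ax(1) kc[OF ax(2)]] kh by auto
    then show ?thesis by (simp only: h(4)[OF ax(1) kc[OF ax(2)]] hk ax)
  qed
  ultimately show ?thesis unfolding algebra_isomorphic_def using k by blast
qed

lemma algebra_isomorphic_trans:
  assumes "algebra_isomorphic K A B" "algebra_isomorphic K B C"
  shows "algebra_isomorphic K A C"
proof -
  obtain h where h: "bij_betw h (carrier A) (carrier B)"
    "\<And>x y. x \<in> carrier A \<Longrightarrow> y \<in> carrier A \<Longrightarrow> h (x \<oplus>\<^bsub>A\<^esub> y) = h x \<oplus>\<^bsub>B\<^esub> h y"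
    "\<And>x y. x \<in> carrier A \<Longrightarrow> y \<in> carrier A \<Longrightarrow> h (x \<otimes>\<^bsub>A\<^esub> y) = h x \<otimes>\<^bsub>B\<^esub> h y"
    "\<And>a x. a \<in> carrier K \<Longrightarrow> x \<in> carrier A \<Longrightarrow> h (a \<odot>\<^bsub>A\<^esub> x) = a \<odot>\<^bsub>B\<^esub> h x"
    using assms(1) unfolding algebra_isomorphic_def by blast
  obtain k where k: "bij_betw k (carrier B) (carrier C)"
    "\<And>x y. x \<in> carrier B \<Longrightarrow> y \<in> carrier B \<Longrightarrow> k (x \<oplus>\<^bsub>B\<^esub> y) = k x \<oplus>\<^bsub>C\<^esub> k y"
    "\<And>x y. x \<in> carrier B \<Longrightarrow> y \<in> carrier B \<Longrightarrow> k (x \<otimes>\<^bsub>B\<^esub> y) = k x \<otimes>\<^bsub>C\<^esub> k y"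
    "\<And>a x. a \<in> carrier K \<Longrightarrow> x \<in> carrier B \<Longrightarrow> k (a \<odot>\<^bsub>B\<^esub> x) = a \<odot>\<^bsub>C\<^esub> k x"
    using assms(2) unfolding algebra_isomorphic_def by blast
  have "bij_betw (k \<circ> h) (carrier A) (carrier C)" by (rule bij_betw_trans[OF h(1) k(1)])
  moreover have "h x \<in> carrier B" if "x \<in> carrier A" for x using bij_betwE[OF h(1)] that by blast
  ultimately show ?thesis
    unfolding algebra_isomorphic_def by (intro exI[of _ "k \<circ> h"]) (simp add: h k)
qed

text \<open>The cosets of the kernel are exactly the fibres of \<open>h\<close>, so sending t to its
  fibre is the isomorphism from T to the quotient. Ring equivalence is obtained together with both
  algebra isomorphisms, as all three rest on the same fibre computations.\<close>

lemma (in assoc_algebra) quotient_algebra_isomorphic: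
  fixes T :: "('a, 't, 'l) module_scheme" and h :: "'c \<Rightarrow> 't"
  assumes surj: "h ` carrier A = carrier T"
    and add: "\<And>x y. x \<in> carrier A \<Longrightarrow> y \<in> carrier A \<Longrightarrow> h (x \<oplus>\<^bsub>A\<^esub> y) = h x \<oplus>\<^bsub>T\<^esub> h y"
    and mult: "\<And>x y. x \<in> carrier A \<Longrightarrow> y \<in> carrier A \<Longrightarrow> h (x \<otimes>\<^bsub>A\<^esub> y) = h x \<otimes>\<^bsub>T\<^esub> h y"
    and smult: "\<And>a x. a \<in> carrier K \<Longrightarrow> x \<in> carrier A \<Longrightarrow> h (a \<odot>\<^bsub>A\<^esub> x) = a \<odot>\<^bsub>T\<^esub> h x"
    and zero: "h \<zero>\<^bsub>A\<^esub> = \<zero>\<^bsub>T\<^esub>"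
    and ker: "I = {x \<in> carrier A. h x = \<zero>\<^bsub>T\<^esub>}"
  shows "algebra_isomorphic K (quotient_algebra A I) T"
    and "algebra_isomorphic K T (quotient_algebra A I)"
    and "A Quot I \<equiv>\<^sub>e T"
proof -
  have pre: "\<exists>x\<in>carrier A. h x = t" if "t \<in> carrier T" for t
    using that unfolding surj[symmetric] by auto
  have h_closed: "h x \<in> carrier T" if "x \<in> carrier A" for x
    using that unfolding surj[symmetric] by (rule imageI)
  define fib where "fib t = {y \<in> carrier A. h y = t}" for t
  have coset: "I +>\<^bsub>A\<^esub> x = fib (h x)" if x: "x \<in> carrier A" for x
  proof
    have "h (i \<oplus>\<^bsub>A\<^esub> x) = h x" if "i \<in> I" for i
    proof -
      have "i \<in> carrier A" "h i = h \<zero>\<^bsub>A\<^esub>" using that by (auto simp: ker zero)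
      then have "h (i \<oplus>\<^bsub>A\<^esub> x) = h (\<zero>\<^bsub>A\<^esub> \<oplus>\<^bsub>A\<^esub> x)" using x by (simp only: add M.zero_closed)
      then show ?thesis using x by simp
    qed
    then show "I +>\<^bsub>A\<^esub> x \<subseteq> fib (h x)"
      using x by (auto simp: a_r_coset_def r_coset_def fib_def ker)
    show "fib (h x) \<subseteq> I +>\<^bsub>A\<^esub> x"
    proof
      fix y assume "y \<in> fib (h x)"
      then have y: "y \<in> carrier A" "h y = h x" by (auto simp: fib_def)
      have "h (y \<oplus>\<^bsub>A\<^esub> \<ominus>\<^bsub>A\<^esub> x) = h (x \<oplus>\<^bsub>A\<^esub> \<ominus>\<^bsub>A\<^esub> x)" using x y by (simp only: add M.a_inv_closed)
      then have "y \<oplus>\<^bsub>A\<^esub> \<ominus>\<^bsub>A\<^esub> x \<in> I" using x y by (simp add: ker zero M.r_neg)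
      moreover have "y = (y \<oplus>\<^bsub>A\<^esub> \<ominus>\<^bsub>A\<^esub> x) \<oplus>\<^bsub>A\<^esub> x" using x y by (simp add: M.a_assoc M.l_neg)
      ultimately show "y \<in> I +>\<^bsub>A\<^esub> x" by (auto simp: a_r_coset_def r_coset_def)
    qed
  qed
  have fib_ne: "\<exists>x\<in>carrier A. x \<in> fib t \<and> h x = t" if "t \<in> carrier T" for t
    using pre[OF that] by (auto simp: fib_def)
  have carrier_quot: "carrier (A Quot I) = fib ` carrier T"
  proof -
    have "carrier (A Quot I) = (\<lambda>x. I +>\<^bsub>A\<^esub> x) ` carrier A"
      by (auto simp: FactRing_def A_RCOSETS_def')
    also have "\<dots> = (\<lambda>x. fib (h x)) ` carrier A" by (rule image_cong) (simp_all add: coset)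
    also have "\<dots> = fib ` carrier T" by (simp add: surj[symmetric] image_image)
    finally show ?thesis .
  qed
  have zero_quot: "\<zero>\<^bsub>A Quot I\<^esub> = fib \<zero>\<^bsub>T\<^esub>" by (simp add: FactRing_def ker fib_def)
  have add_quot: "fib s \<oplus>\<^bsub>A Quot I\<^esub> fib t = fib (s \<oplus>\<^bsub>T\<^esub> t)"
    if s: "s \<in> carrier T" and t: "t \<in> carrier T" for s t
  proof
    show "fib s \<oplus>\<^bsub>A Quot I\<^esub> fib t \<subseteq> fib (s \<oplus>\<^bsub>T\<^esub> t)"
      by (auto simp: FactRing_def set_add_def set_mult_def fib_def add)
    show "fib (s \<oplus>\<^bsub>T\<^esub> t) \<subseteq> fib s \<oplus>\<^bsub>A Quot I\<^esub> fib t"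
    proof
      fix y assume "y \<in> fib (s \<oplus>\<^bsub>T\<^esub> t)"
      then have y: "y \<in> carrier A" "h y = s \<oplus>\<^bsub>T\<^esub> t" by (auto simp: fib_def)
      obtain a where a: "a \<in> carrier A" "h a = s" using pre[OF s] by blast
      obtain b where b: "b \<in> carrier A" "h b = t" using pre[OF t] by blast
      have "y \<in> fib (h (a \<oplus>\<^bsub>A\<^esub> b))" using y a b by (simp add: fib_def add)
      then have "y \<in> I +>\<^bsub>A\<^esub> (a \<oplus>\<^bsub>A\<^esub> b)" using coset a b by simp
      \<comment> \<open>The kernel element i is absorbed into the first summand: i + a still lies in
        the fibre of s, which exhibits y as a sum of elements of the two fibres.\<close>
      then obtain i where i: "i \<in> I" "y = i \<oplus>\<^bsub>A\<^esub> (a \<oplus>\<^bsub>A\<^esub> b)"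
        by (auto simp: a_r_coset_def r_coset_def)
      have "i \<in> carrier A" using i by (simp add: ker)
      have "i \<oplus>\<^bsub>A\<^esub> a \<in> I +>\<^bsub>A\<^esub> a" using i by (auto simp: a_r_coset_def r_coset_def)
      then have "i \<oplus>\<^bsub>A\<^esub> a \<in> fib s" using coset[OF a(1)] a by simp
      moreover have "b \<in> fib t" using b by (simp add: fib_def)
      moreover have "y = (i \<oplus>\<^bsub>A\<^esub> a) \<oplus>\<^bsub>A\<^esub> b" using i(2) \<open>i \<in> carrier A\<close> a b by (simp add: M.a_assoc)
      ultimately show "y \<in> fib s \<oplus>\<^bsub>A Quot I\<^esub> fib t"
        by (auto simp: FactRing_def set_add_def set_mult_def)
    qed
  qed
  have mult_quot: "fib s \<otimes>\<^bsub>A Quot I\<^esub> fib t = fib (s \<otimes>\<^bsub>T\<^esub> t)"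
    if s: "s \<in> carrier T" and t: "t \<in> carrier T" for s t
  proof -
    have "fib s \<otimes>\<^bsub>A Quot I\<^esub> fib t = (\<Union>a\<in>fib s. \<Union>b\<in>fib t. I +>\<^bsub>A\<^esub> (a \<otimes>\<^bsub>A\<^esub> b))"
      by (simp add: FactRing_def rcoset_mult_def)
    also have "\<dots> = (\<Union>a\<in>fib s. \<Union>b\<in>fib t. fib (s \<otimes>\<^bsub>T\<^esub> t))"
      by (intro SUP_cong refl) (auto simp: fib_def coset mult mult_closed)
    \<comment> \<open>The union is over a constant family, so it equals its member because
      surjectivity makes both fibres nonempty.\<close>
    also have "\<dots> = fib (s \<otimes>\<^bsub>T\<^esub> t)" using fib_ne[OF s] fib_ne[OF t] by blast
    finally show ?thesis .
  qed
  have smult_quot: "a \<odot>\<^bsub>quotient_algebra A I\<^esub> fib t = fib (a \<odot>\<^bsub>T\<^esub> t)"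
    if a: "a \<in> carrier K" and t: "t \<in> carrier T" for a t
  proof -
    have "a \<odot>\<^bsub>quotient_algebra A I\<^esub> fib t = (\<Union>x\<in>fib t. I +>\<^bsub>A\<^esub> (a \<odot>\<^bsub>A\<^esub> x))"
      by (simp add: quotient_algebra_def)
    also have "\<dots> = (\<Union>x\<in>fib t. fib (a \<odot>\<^bsub>T\<^esub> t))"
      by (intro SUP_cong refl) (use a in \<open>auto simp: fib_def coset smult\<close>)
    also have "\<dots> = fib (a \<odot>\<^bsub>T\<^esub> t)" using fib_ne[OF t] by blast
    finally show ?thesis .
  qed
  have closed: "x \<oplus>\<^bsub>T\<^esub> y \<in> carrier T \<and> x \<otimes>\<^bsub>T\<^esub> y \<in> carrier T" if x: "x \<in> carrier T" and y: "y \<in> carrier T" for x y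
  proof -
    obtain a b where ab: "a \<in> carrier A" "h a = x" "b \<in> carrier A" "h b = y"
      using pre[OF x] pre[OF y] by blast
    have "h (a \<oplus>\<^bsub>A\<^esub> b) \<in> carrier T" "h (a \<otimes>\<^bsub>A\<^esub> b) \<in> carrier T"
      using ab by (simp_all add: h_closed mult_closed)
    then show ?thesis using ab by (simp add: add mult)
  qed
  have closed_smult: "a \<odot>\<^bsub>T\<^esub> x \<in> carrier T" if "a \<in> carrier K" and x: "x \<in> carrier T" for a x
  proof -
    obtain y where y: "y \<in> carrier A" "h y = x" using pre[OF x] by blast
    have "h (a \<odot>\<^bsub>A\<^esub> y) \<in> carrier T" using y that by (simp add: h_closed)
    then show ?thesis using y that by (simp add: smult)
  qed
  have zero_T: "\<zero>\<^bsub>T\<^esub> \<in> carrier T" unfolding zero[symmetric] by (simp add: h_closed)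
  have bij: "bij_betw fib (carrier T) (carrier (A Quot I))"
    unfolding bij_betw_def carrier_quot
  proof (intro conjI inj_onI refl)
    fix s t assume "s \<in> carrier T" "t \<in> carrier T" "fib s = fib t"
    then show "s = t" using fib_ne[of s] unfolding fib_def by blast
  qed
  have simps: "carrier (quotient_algebra A I) = carrier (A Quot I)"
    "s \<oplus>\<^bsub>quotient_algebra A I\<^esub> t = s \<oplus>\<^bsub>A Quot I\<^esub> t"
    "s \<otimes>\<^bsub>quotient_algebra A I\<^esub> t = s \<otimes>\<^bsub>A Quot I\<^esub> t" for s t
    by (simp_all add: quotient_algebra_def)
  show iso: "algebra_isomorphic K T (quotient_algebra A I)"
    unfolding algebra_isomorphic_def
    by (intro exI[of _ fib]) (simp add: simps bij add_quot mult_quot smult_quot)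
  show "algebra_isomorphic K (quotient_algebra A I) T"
    by (rule algebra_isomorphic_sym[OF iso closed closed_smult])
  have "T \<equiv>\<^sub>e A Quot I"
    by (rule isomorphic_imp_elementarily_equivalent[OF bij])
      (simp_all add: add_quot mult_quot zero_quot closed zero_T)
  then show "A Quot I \<equiv>\<^sub>e T" by (simp add: elementarily_equivalent_def)
qed

text \<open>The common model of the quotients. It depends on the field, the letters and n alone, so
  two algebras with letters over the same field are compared through it without any map between
  them.\<close>

definition truncated_algebra :: "('k, 'm) ring_scheme \<Rightarrow> 'x set \<Rightarrow> nat \<Rightarrow> ('k, 'x list \<Rightarrow> 'k) module" where
  "truncated_algebra K Xs n =
     \<lparr>carrier = {f. range f \<subseteq> carrier K \<and>
        (\<forall>w. f w \<noteq> \<zero>\<^bsub>K\<^esub> \<longrightarrow> w \<in> lists Xs \<and> w \<noteq> [] \<and> length w < n)},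
      mult = (\<lambda>f g w. if length w < n then conv K f g w else \<zero>\<^bsub>K\<^esub>),
      one = undefined,
      zero = (\<lambda>w. \<zero>\<^bsub>K\<^esub>),
      add = (\<lambda>f g w. f w \<oplus>\<^bsub>K\<^esub> g w),
      smult = (\<lambda>a f w. a \<otimes>\<^bsub>K\<^esub> f w)\<rparr>"

lemma (in ring) conv_cong:
  assumes "\<And>u. length u \<le> length w \<Longrightarrow> f u = f' u" "\<And>u. length u \<le> length w \<Longrightarrow> g u = g' u"
    and "range f' \<subseteq> carrier R" "range g' \<subseteq> carrier R"
  shows "conv R f g w = conv R f' g' w"
  unfolding conv_def using assms by (intro finsum_cong') (auto simp: image_subset_iff)

lemma (in letter_algebra) quotient_isomorphic_truncated:
  assumes n: "n \<ge> 1"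
  shows "algebra_isomorphic K (quotient_algebra A (ring_power A n)) (truncated_algebra K Xs n)"
    and "algebra_isomorphic K (truncated_algebra K Xs n) (quotient_algebra A (ring_power A n))"
    and "A Quot ring_power A n \<equiv>\<^sub>e truncated_algebra K Xs n"
proof -
  let ?T = "truncated_algebra K Xs n"
  define h where "h f w = (if length w < n then coord f w else \<zero>)" for f w
  have cc: "coord f w \<in> carrier K" if "f \<in> carrier A" for f w using coord_closed[OF that] .
  have hT: "h f \<in> carrier ?T" if f: "f \<in> carrier A" for f
  proof -
    have "w \<in> lists Xs \<and> w \<noteq> [] \<and> length w < n" if "h f w \<noteq> \<zero>" for w
    proof -
      have "length w < n" "coord f w \<noteq> \<zero>" using that by (auto simp: h_def split: if_splits)
      then show ?thesis using coord_nonletter[of w f] by (cases w) auto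
    qed
    then show ?thesis using cc[OF f] by (auto simp: truncated_algebra_def h_def)
  qed
  have surj: "h ` carrier A = carrier ?T"
  proof
    show "h ` carrier A \<subseteq> carrier ?T" using hT by auto
    show "carrier ?T \<subseteq> h ` carrier A"
    proof
      fix t assume "t \<in> carrier ?T"
      then have t: "range t \<subseteq> carrier K" "\<And>w. t w \<noteq> \<zero> \<Longrightarrow> w \<in> lists Xs \<and> w \<noteq> [] \<and> length w < n"
        by (auto simp: truncated_algebra_def)
      have "t [] = \<zero>" "\<And>w. w \<notin> lists Xs \<Longrightarrow> t w = \<zero>" using t(2) by blast+
      then obtain f where f: "f \<in> carrier A" "\<forall>w. length w < n \<longrightarrow> coord f w = t w"
        using coord_surj[OF t(1), of n] by blast
      have "h f w = t w" for w using f(2) t(2)[of w] by (cases "t w = \<zero>") (auto simp: h_def)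
      then have "t = h f" by (intro ext) simp
      then show "t \<in> h ` carrier A" using f(1) by blast
    qed
  qed
  \<comment> \<open>Both pieces of a word of length below n are again of length below n, so
    truncating the factors does not change this coefficient of the product.\<close>
  have conv_h: "conv K (h f) (h g) w = conv K (coord f) (coord g) w"
    if "length w < n" "f \<in> carrier A" "g \<in> carrier A" for f g w
    by (rule conv_cong) (use that cc in \<open>auto simp: h_def\<close>)
  have zero: "coord \<zero>\<^bsub>A\<^esub> w = \<zero>" for w
    using coord_smult[of "\<zero>\<^bsub>A\<^esub>" \<zero> w] cc by simp
  have add: "h (x \<oplus>\<^bsub>A\<^esub> y) = h x \<oplus>\<^bsub>?T\<^esub> h y" if "x \<in> carrier A" "y \<in> carrier A" for x y
    using that by (simp add: truncated_algebra_def h_def coord_add fun_eq_iff)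
  have mult: "h (x \<otimes>\<^bsub>A\<^esub> y) = h x \<otimes>\<^bsub>?T\<^esub> h y" if "x \<in> carrier A" "y \<in> carrier A" for x y
  proof
    fix w show "h (x \<otimes>\<^bsub>A\<^esub> y) w = (h x \<otimes>\<^bsub>?T\<^esub> h y) w"
      using that conv_h[of w x y] coord_mult[OF that, of w]
      by (simp add: truncated_algebra_def) (simp add: h_def)
  qed
  have smult: "h (a \<odot>\<^bsub>A\<^esub> x) = a \<odot>\<^bsub>?T\<^esub> h x" if "a \<in> carrier K" "x \<in> carrier A" for a x
    using that by (simp add: truncated_algebra_def h_def coord_smult fun_eq_iff)
  have z: "h \<zero>\<^bsub>A\<^esub> = \<zero>\<^bsub>?T\<^esub>" by (simp add: truncated_algebra_def h_def zero fun_eq_iff)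
  have ker: "ring_power A n = {x \<in> carrier A. h x = \<zero>\<^bsub>?T\<^esub>}"
    unfolding ring_power_eq[OF n] by (auto simp: truncated_algebra_def h_def fun_eq_iff)
  show "algebra_isomorphic K (quotient_algebra A (ring_power A n)) ?T"
    "algebra_isomorphic K ?T (quotient_algebra A (ring_power A n))" "A Quot ring_power A n \<equiv>\<^sub>e ?T"
    by (rule quotient_algebra_isomorphic[where h = h, OF surj add mult smult z ker]; assumption)+
qed

section \<open>Independence of ring notions from the scalar multiplication\<close>

lemma satisfies_with_smult [simp]:
  "satisfies (with_smult R s) v p = satisfies R v p"
proof -
  have "term_val (with_smult R s) v t = term_val R v t" for v t by (induction t) auto
  then show ?thesis by (induction p arbitrary: v) auto
qed

lemma elementarily_equivalent_with_smult [simp]: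
  "with_smult R s \<equiv>\<^sub>e S \<longleftrightarrow> R \<equiv>\<^sub>e S" "S \<equiv>\<^sub>e with_smult R s \<longleftrightarrow> S \<equiv>\<^sub>e R"
  by (simp_all add: elementarily_equivalent_def holds_in_def)

text \<open>The additive monoids of a ring and of its extension by a scalar multiplication are
  records of different extension types and cannot be equated. Agreement of the relevant fields is
  enough, and using it in both directions gives equality of the generated sets.\<close>

lemma generate_mono_monoid:
  assumes "carrier G = carrier H" "mult G = mult H" "one G = one H"
  shows "generate G S \<subseteq> generate H S"
proof
  fix x assume "x \<in> generate G S"
  then show "x \<in> generate H S"
  proof induction
    case one
    then show ?case using generate.one[of H S] assms(3) by simp
  next
    case (incl h)
    then show ?case by (rule generate.incl)
  next
    case (inv h)
    have "m_inv G h = m_inv H h" by (simp only: m_inv_def assms)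
    then show ?case using generate.inv[OF inv, of H] by simp
  next
    case (eng h k)
    then show ?case using generate.eng[of h H S k] assms(2) by simp
  qed
qed

lemma ring_power_with_smult [simp]: "ring_power (with_smult R s) n = ring_power R n"
proof -
  have "nonempty_prod (with_smult R s) as = nonempty_prod R as" for as
    by (induction as rule: induct_list012) auto
  then show ?thesis
    unfolding ring_power_def with_smult_simps by (simp only: )
      (intro equalityI generate_mono_monoid; simp)
qed

lemma Quot_with_smult [simp]: "with_smult R s Quot I = R Quot I"
  by (simp add: FactRing_def A_RCOSETS_def RCOSETS_def a_r_coset_def r_coset_def rcoset_mult_def
      set_add_def set_mult_def fun_eq_iff)

lemma residually_nilpotent_with_smult [simp]:
  "residually_nilpotent (with_smult R s) \<longleftrightarrow> residually_nilpotent R"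
  by (simp add: residually_nilpotent_def)

section \<open>Reconstructing the scalars\<close>

text \<open>With f = \<phi> b and g = \<gamma> b: the equation b b = g f says that \<gamma> is
  inverse to \<phi>; g b = x f says that g is \<phi> x; x b = f g says that x represents the product
  of \<phi> and \<gamma>. The last clause states (\<phi> x) y = x (\<phi> y). These are the field
  axioms and the axioms of a bilinear action, stated without mentioning a field.\<close>

definition scalar_axioms :: "('a, 'm) ring_scheme \<Rightarrow> 'a \<Rightarrow> bool" where
  "scalar_axioms R b \<longleftrightarrow>
    (\<forall>x\<in>carrier R. \<forall>y\<in>carrier R. \<forall>z\<in>carrier R. (x \<otimes>\<^bsub>R\<^esub> y) \<otimes>\<^bsub>R\<^esub> z = x \<otimes>\<^bsub>R\<^esub> (y \<otimes>\<^bsub>R\<^esub> z)) \<and>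
    (\<forall>x\<in>carrier R. \<forall>y\<in>carrier R. x \<otimes>\<^bsub>R\<^esub> y = \<zero>\<^bsub>R\<^esub> \<longrightarrow> x = \<zero>\<^bsub>R\<^esub> \<or> y = \<zero>\<^bsub>R\<^esub>) \<and>
    (\<forall>f\<in>carrier R. proportional R b f \<longrightarrow>
      (\<exists>g\<in>carrier R. proportional R b g \<and> f \<oplus>\<^bsub>R\<^esub> g = \<zero>\<^bsub>R\<^esub>) \<and>
      (f = \<zero>\<^bsub>R\<^esub> \<or> (\<exists>g\<in>carrier R. proportional R b g \<and> b \<otimes>\<^bsub>R\<^esub> b = g \<otimes>\<^bsub>R\<^esub> f)) \<and>
      (\<forall>x\<in>carrier R. \<exists>g\<in>carrier R. g \<otimes>\<^bsub>R\<^esub> b = x \<otimes>\<^bsub>R\<^esub> f) \<and>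
      (\<forall>g\<in>carrier R. proportional R b g \<longrightarrow> proportional R b (f \<oplus>\<^bsub>R\<^esub> g) \<and>
        f \<otimes>\<^bsub>R\<^esub> g = g \<otimes>\<^bsub>R\<^esub> f \<and>
        (\<forall>x\<in>carrier R. x \<otimes>\<^bsub>R\<^esub> b = f \<otimes>\<^bsub>R\<^esub> g \<longrightarrow> proportional R b x)) \<and>
      (\<forall>x\<in>carrier R. \<forall>y\<in>carrier R. \<forall>g\<in>carrier R. \<forall>h\<in>carrier R.
        g \<otimes>\<^bsub>R\<^esub> b = x \<otimes>\<^bsub>R\<^esub> f \<longrightarrow> h \<otimes>\<^bsub>R\<^esub> b = y \<otimes>\<^bsub>R\<^esub> f \<longrightarrow> g \<otimes>\<^bsub>R\<^esub> y = x \<otimes>\<^bsub>R\<^esub> h))"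

text \<open>Variable 0 is b and variable 1 is f. As \<open>Proportional\<close> accepts only
  variables, the sum f + g enters through an auxiliary variable equated with it; closure under
  addition removes that variable again when the formula is evaluated.\<close>

definition Scalar_axioms :: ring_formula where
  "Scalar_axioms =
    Conj (All 1 (All 2 (All 3 (Eq (Times (Times (Var 1) (Var 2)) (Var 3))
                                  (Times (Var 1) (Times (Var 2) (Var 3)))))))
   (Conj (All 1 (All 2 (Imp (Eq (Times (Var 1) (Var 2)) Zero) (Disj (Eq (Var 1) Zero) (Eq (Var 2) Zero)))))
   (All 1 (Imp (Proportional 0 1)
     (Conj (Ex 2 (Conj (Proportional 0 2) (Eq (Plus (Var 1) (Var 2)) Zero)))
     (Conj (Disj (Eq (Var 1) Zero)
        (Ex 2 (Conj (Proportional 0 2) (Eq (Times (Var 0) (Var 0)) (Times (Var 2) (Var 1))))))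
     (Conj (All 3 (Ex 2 (Eq (Times (Var 2) (Var 0)) (Times (Var 3) (Var 1)))))
     (Conj (All 2 (Imp (Proportional 0 2)
        (Conj (All 3 (Imp (Eq (Var 3) (Plus (Var 1) (Var 2))) (Proportional 0 3)))
        (Conj (Eq (Times (Var 1) (Var 2)) (Times (Var 2) (Var 1)))
        (All 3 (Imp (Eq (Times (Var 3) (Var 0)) (Times (Var 1) (Var 2))) (Proportional 0 3)))))))
     (All 2 (All 3 (All 4 (All 5 (Imp (Eq (Times (Var 4) (Var 0)) (Times (Var 2) (Var 1)))
        (Imp (Eq (Times (Var 5) (Var 0)) (Times (Var 3) (Var 1)))
        (Eq (Times (Var 4) (Var 3)) (Times (Var 2) (Var 5))))))))))))))))"

lemma (in nonunital_ring) satisfies_Scalar_axioms: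
  "satisfies R v Scalar_axioms \<longleftrightarrow> scalar_axioms R (v 0)"
  by (simp add: Scalar_axioms_def scalar_axioms_def cong: conj_cong)

lemma free_vars_Scalar_axioms: "free_vars Scalar_axioms \<subseteq> {0}"
  by (auto simp: Scalar_axioms_def)

context scalar_domain
begin

lemma cancel_right:
  assumes "x \<in> carrier A" "y \<in> carrier A" "x \<otimes>\<^bsub>A\<^esub> b = y \<otimes>\<^bsub>A\<^esub> b"
  shows "x = y"
proof -
  have m1: "\<ominus> \<one> \<in> carrier K" by simp
  have m: "\<ominus> \<one> \<odot>\<^bsub>A\<^esub> y \<in> carrier A" using assms by simp
  have "(x \<oplus>\<^bsub>A\<^esub> \<ominus> \<one> \<odot>\<^bsub>A\<^esub> y) \<otimes>\<^bsub>A\<^esub> b = x \<otimes>\<^bsub>A\<^esub> b \<oplus>\<^bsub>A\<^esub> \<ominus> \<one> \<odot>\<^bsub>A\<^esub> (y \<otimes>\<^bsub>A\<^esub> b)"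
    by (simp only: distrib_right[OF assms(1) m b_closed] smult_mult_left[OF m1 assms(2) b_closed])
  also have "\<dots> = \<zero>\<^bsub>A\<^esub>"
    using assms b_closed by (simp add: smult_l_minus mult_closed M.r_neg)
  finally have "x \<oplus>\<^bsub>A\<^esub> \<ominus> \<one> \<odot>\<^bsub>A\<^esub> y = \<zero>\<^bsub>A\<^esub>"
    using integral[of "x \<oplus>\<^bsub>A\<^esub> \<ominus> \<one> \<odot>\<^bsub>A\<^esub> y" b] b_closed b_nonzero assms m by auto
  then show ?thesis
    using M.minus_equality[of x "\<ominus>\<^bsub>A\<^esub> y"] assms by (simp add: smult_l_minus)
qed

lemma scalar_axioms: "scalar_axioms A b"
proof -
  have pI: "proportional A b (a \<odot>\<^bsub>A\<^esub> b)" if "a \<in> carrier K" for a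
    using proportional_iff[OF smult_closed[OF that b_closed]] that by blast
  \<comment> \<open>Cancelling b turns the indirect description of a scalar multiple into the
    multiple itself.\<close>
  have div: "g = a \<odot>\<^bsub>A\<^esub> x"
    if "g \<otimes>\<^bsub>A\<^esub> b = x \<otimes>\<^bsub>A\<^esub> (a \<odot>\<^bsub>A\<^esub> b)" "a \<in> carrier K" "x \<in> carrier A" "g \<in> carrier A" for a x g
    by (rule cancel_right) (use that b_closed in \<open>simp_all add: smult_mult_left smult_mult_right\<close>)
  have 3: "(\<exists>g\<in>carrier A. proportional A b g \<and> a \<odot>\<^bsub>A\<^esub> b \<oplus>\<^bsub>A\<^esub> g = \<zero>\<^bsub>A\<^esub>) \<and>
      (a \<odot>\<^bsub>A\<^esub> b = \<zero>\<^bsub>A\<^esub> \<or>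
        (\<exists>g\<in>carrier A. proportional A b g \<and> b \<otimes>\<^bsub>A\<^esub> b = g \<otimes>\<^bsub>A\<^esub> (a \<odot>\<^bsub>A\<^esub> b))) \<and>
      (\<forall>x\<in>carrier A. \<exists>g\<in>carrier A. g \<otimes>\<^bsub>A\<^esub> b = x \<otimes>\<^bsub>A\<^esub> (a \<odot>\<^bsub>A\<^esub> b)) \<and>
      (\<forall>c\<in>carrier K. proportional A b (a \<odot>\<^bsub>A\<^esub> b \<oplus>\<^bsub>A\<^esub> c \<odot>\<^bsub>A\<^esub> b) \<and>
        (a \<odot>\<^bsub>A\<^esub> b) \<otimes>\<^bsub>A\<^esub> (c \<odot>\<^bsub>A\<^esub> b) = (c \<odot>\<^bsub>A\<^esub> b) \<otimes>\<^bsub>A\<^esub> (a \<odot>\<^bsub>A\<^esub> b) \<and>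
        (\<forall>x\<in>carrier A. x \<otimes>\<^bsub>A\<^esub> b = (a \<odot>\<^bsub>A\<^esub> b) \<otimes>\<^bsub>A\<^esub> (c \<odot>\<^bsub>A\<^esub> b) \<longrightarrow> proportional A b x)) \<and>
      (\<forall>x\<in>carrier A. \<forall>y\<in>carrier A. \<forall>g\<in>carrier A. \<forall>h\<in>carrier A.
        g \<otimes>\<^bsub>A\<^esub> b = x \<otimes>\<^bsub>A\<^esub> (a \<odot>\<^bsub>A\<^esub> b) \<longrightarrow> h \<otimes>\<^bsub>A\<^esub> b = y \<otimes>\<^bsub>A\<^esub> (a \<odot>\<^bsub>A\<^esub> b) \<longrightarrow>
          g \<otimes>\<^bsub>A\<^esub> y = x \<otimes>\<^bsub>A\<^esub> h)" if a: "a \<in> carrier K" for a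
  proof (intro conjI ballI impI)
    have "a \<odot>\<^bsub>A\<^esub> b \<oplus>\<^bsub>A\<^esub> (\<ominus> a) \<odot>\<^bsub>A\<^esub> b = \<zero>\<^bsub>A\<^esub>"
      using a b_closed by (simp add: smult_l_minus M.r_neg)
    then show "\<exists>g\<in>carrier A. proportional A b g \<and> a \<odot>\<^bsub>A\<^esub> b \<oplus>\<^bsub>A\<^esub> g = \<zero>\<^bsub>A\<^esub>"
      using a b_closed pI[of "\<ominus> a"] by (intro bexI[of _ "(\<ominus> a) \<odot>\<^bsub>A\<^esub> b"]) auto
    show "a \<odot>\<^bsub>A\<^esub> b = \<zero>\<^bsub>A\<^esub> \<or>
        (\<exists>g\<in>carrier A. proportional A b g \<and> b \<otimes>\<^bsub>A\<^esub> b = g \<otimes>\<^bsub>A\<^esub> (a \<odot>\<^bsub>A\<^esub> b))"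
    proof (cases "a = \<zero>")
      case False
      have i: "inv a \<in> carrier K" "a \<otimes> inv a = \<one>" using a False by (auto simp: field_Units)
      have "(inv a \<odot>\<^bsub>A\<^esub> b) \<otimes>\<^bsub>A\<^esub> (a \<odot>\<^bsub>A\<^esub> b) = a \<odot>\<^bsub>A\<^esub> (inv a \<odot>\<^bsub>A\<^esub> (b \<otimes>\<^bsub>A\<^esub> b))"
        using a i b_closed by (simp add: smult_mult_left smult_mult_right mult_closed)
      also have "\<dots> = (a \<otimes> inv a) \<odot>\<^bsub>A\<^esub> (b \<otimes>\<^bsub>A\<^esub> b)"
        using a i b_closed by (intro smult_assoc1[symmetric] mult_closed) auto
      also have "\<dots> = b \<otimes>\<^bsub>A\<^esub> b" using i b_closed by (simp add: mult_closed)
      finally show ?thesis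
        using i b_closed pI[of "inv a"] by (intro disjI2 bexI[of _ "inv a \<odot>\<^bsub>A\<^esub> b"]) auto
    qed (use b_closed in simp)
    show "\<exists>g\<in>carrier A. g \<otimes>\<^bsub>A\<^esub> b = x \<otimes>\<^bsub>A\<^esub> (a \<odot>\<^bsub>A\<^esub> b)" if "x \<in> carrier A" for x
      using that a b_closed
      by (intro bexI[of _ "a \<odot>\<^bsub>A\<^esub> x"]) (simp_all add: smult_mult_left smult_mult_right)
    fix c assume c: "c \<in> carrier K"
    show "proportional A b (a \<odot>\<^bsub>A\<^esub> b \<oplus>\<^bsub>A\<^esub> c \<odot>\<^bsub>A\<^esub> b)"
      using pI[of "a \<oplus> c"] a c b_closed by (simp add: smult_l_distr)
    show "(a \<odot>\<^bsub>A\<^esub> b) \<otimes>\<^bsub>A\<^esub> (c \<odot>\<^bsub>A\<^esub> b) = (c \<odot>\<^bsub>A\<^esub> b) \<otimes>\<^bsub>A\<^esub> (a \<odot>\<^bsub>A\<^esub> b)"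
      using smult_bpow_mult[OF a c, of 0 0] smult_bpow_mult[OF c a, of 0 0] a c
      by (simp add: m_comm)
    fix x assume x: "x \<in> carrier A" "x \<otimes>\<^bsub>A\<^esub> b = (a \<odot>\<^bsub>A\<^esub> b) \<otimes>\<^bsub>A\<^esub> (c \<odot>\<^bsub>A\<^esub> b)"
    have "x = c \<odot>\<^bsub>A\<^esub> (a \<odot>\<^bsub>A\<^esub> b)" using div[OF x(2) c] x(1) a b_closed by simp
    then have "x = (c \<otimes> a) \<odot>\<^bsub>A\<^esub> b" using a c b_closed by (simp only: smult_assoc1)
    then show "proportional A b x" using pI a c by simp
  next
    fix x y g h
    assume "x \<in> carrier A" "y \<in> carrier A" "g \<in> carrier A" "h \<in> carrier A"
      "g \<otimes>\<^bsub>A\<^esub> b = x \<otimes>\<^bsub>A\<^esub> (a \<odot>\<^bsub>A\<^esub> b)" "h \<otimes>\<^bsub>A\<^esub> b = y \<otimes>\<^bsub>A\<^esub> (a \<odot>\<^bsub>A\<^esub> b)"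
    then show "g \<otimes>\<^bsub>A\<^esub> y = x \<otimes>\<^bsub>A\<^esub> h"
      using div[of g x a] div[of h y a] a by (simp add: smult_mult_left smult_mult_right)
  qed
  \<comment> \<open>Quantification over elements proportional to b becomes quantification over
    scalars. Rewriting with this equivalence for arbitrary P handles the nested quantifiers over f
    and g alike.\<close>
  have S: "(\<forall>f\<in>carrier A. proportional A b f \<longrightarrow> P f) \<longleftrightarrow> (\<forall>a\<in>carrier K. P (a \<odot>\<^bsub>A\<^esub> b))" for P
  proof safe
    fix a assume P: "\<forall>f\<in>carrier A. proportional A b f \<longrightarrow> P f" and "a \<in> carrier K"
    then show "P (a \<odot>\<^bsub>A\<^esub> b)" using pI smult_closed[OF _ b_closed] by simp
  next
    fix f assume "\<forall>a\<in>carrier K. P (a \<odot>\<^bsub>A\<^esub> b)" "f \<in> carrier A" "proportional A b f"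
    then show "P f" using proportional_iff by auto
  qed
  show ?thesis
    unfolding scalar_axioms_def S
  proof (intro conjI)
    show "\<forall>x\<in>carrier A. \<forall>y\<in>carrier A. \<forall>z\<in>carrier A. (x \<otimes>\<^bsub>A\<^esub> y) \<otimes>\<^bsub>A\<^esub> z = x \<otimes>\<^bsub>A\<^esub> (y \<otimes>\<^bsub>A\<^esub> z)"
      by (simp add: mult_assoc)
    show "\<forall>x\<in>carrier A. \<forall>y\<in>carrier A. x \<otimes>\<^bsub>A\<^esub> y = \<zero>\<^bsub>A\<^esub> \<longrightarrow> x = \<zero>\<^bsub>A\<^esub> \<or> y = \<zero>\<^bsub>A\<^esub>"
      using integral by simp
  qed (rule ballI, rule 3)
qed

end

text \<open>No field is given here; it is to be built from the ring and b. This is the state of B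
  immediately after the transfer.\<close>

locale scalar_ring = nonunital_ring +
  fixes b
  assumes b_closed: "b \<in> carrier R" and b_nonzero: "b \<noteq> \<zero>" and scalar_axioms: "scalar_axioms R b"
begin

lemma scalar_ringD:
  "\<lbrakk>x \<in> carrier R; y \<in> carrier R; z \<in> carrier R\<rbrakk> \<Longrightarrow> (x \<otimes> y) \<otimes> z = x \<otimes> (y \<otimes> z)"
  "\<lbrakk>x \<in> carrier R; y \<in> carrier R; x \<otimes> y = \<zero>\<rbrakk> \<Longrightarrow> x = \<zero> \<or> y = \<zero>"
  using conjunct1[OF scalar_axioms[unfolded scalar_axioms_def]]
    conjunct1[OF conjunct2[OF scalar_axioms[unfolded scalar_axioms_def]]] by simp_all

lemma proportionalD:
  assumes "f \<in> carrier R" "proportional R b f"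
  shows "\<exists>g\<in>carrier R. proportional R b g \<and> f \<oplus> g = \<zero>"
    "f \<noteq> \<zero> \<Longrightarrow> \<exists>g\<in>carrier R. proportional R b g \<and> b \<otimes> b = g \<otimes> f"
    "x \<in> carrier R \<Longrightarrow> \<exists>g\<in>carrier R. g \<otimes> b = x \<otimes> f"
    "\<lbrakk>g \<in> carrier R; proportional R b g\<rbrakk> \<Longrightarrow> proportional R b (f \<oplus> g)"
    "\<lbrakk>g \<in> carrier R; proportional R b g\<rbrakk> \<Longrightarrow> f \<otimes> g = g \<otimes> f"
    "\<lbrakk>g \<in> carrier R; proportional R b g; x \<in> carrier R; x \<otimes> b = f \<otimes> g\<rbrakk> \<Longrightarrow> proportional R b x"
    "\<lbrakk>x \<in> carrier R; y \<in> carrier R; g \<in> carrier R; h \<in> carrier R; g \<otimes> b = x \<otimes> f; h \<otimes> b = y \<otimes> f\<rbrakk>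
      \<Longrightarrow> g \<otimes> y = x \<otimes> h"
proof -
  note * = mp[OF bspec[OF conjunct2[OF conjunct2[OF scalar_axioms[unfolded scalar_axioms_def]]]
        assms(1)] assms(2)]
  note c1 = conjunct1[OF *] and * = conjunct2[OF *]
  note c2 = conjunct1[OF *] and * = conjunct2[OF *]
  note c3 = conjunct1[OF *] and * = conjunct2[OF *]
  note c4 = mp[OF bspec[OF conjunct1[OF *]]] and c5 = conjunct2[OF *]
  show "\<exists>g\<in>carrier R. proportional R b g \<and> f \<oplus> g = \<zero>" by (rule c1)
  show "\<exists>g\<in>carrier R. proportional R b g \<and> b \<otimes> b = g \<otimes> f" if "f \<noteq> \<zero>"
    using c2 that by simp
  show "\<exists>g\<in>carrier R. g \<otimes> b = x \<otimes> f" if "x \<in> carrier R" using c3 that by simp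
  show "proportional R b (f \<oplus> g)" if "g \<in> carrier R" "proportional R b g"
    by (rule conjunct1[OF c4[OF that]])
  show "f \<otimes> g = g \<otimes> f" if "g \<in> carrier R" "proportional R b g"
    by (rule conjunct1[OF conjunct2[OF c4[OF that]]])
  show "proportional R b x"
    if "g \<in> carrier R" "proportional R b g" "x \<in> carrier R" "x \<otimes> b = f \<otimes> g"
    by (rule mp[OF bspec[OF conjunct2[OF conjunct2[OF c4[OF that(1,2)]]] that(3)] that(4)])
  show "g \<otimes> y = x \<otimes> h" if "x \<in> carrier R" "y \<in> carrier R" "g \<in> carrier R" "h \<in> carrier R"
    "g \<otimes> b = x \<otimes> f" "h \<otimes> b = y \<otimes> f"
    using c5 that by simp
qed

lemma cancel:
  assumes "x \<in> carrier R" "y \<in> carrier R" "x \<otimes> b = y \<otimes> b"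
  shows "x = y"
proof -
  have "(x \<ominus> y) \<otimes> b \<oplus> y \<otimes> b = ((x \<ominus> y) \<oplus> y) \<otimes> b"
    using assms b_closed by (simp add: distrib_right)
  also have "\<dots> = y \<otimes> b" using assms by (simp add: a_minus_def a_assoc l_neg)
  finally have "(x \<ominus> y) \<otimes> b = \<zero>"
    using assms b_closed by (simp add: mult_closed)
  then have "x \<ominus> y = \<zero>" using scalar_ringD(2)[of "x \<ominus> y" b] assms b_closed b_nonzero by auto
  then show ?thesis using minus_equality[of x "\<ominus> y"] assms by (simp add: a_minus_def)
qed

text \<open>If \<open>f = \<phi>b\<close> with a scalar \<open>\<phi>\<close>, then \<open>(\<phi>x)b = xf\<close> determines \<open>\<phi>x\<close>.\<close>

definition act :: "'a \<Rightarrow> 'a \<Rightarrow> 'a" where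
  "act f x = (THE g. g \<in> carrier R \<and> g \<otimes> b = x \<otimes> f)"

text \<open>The scalar \<phi> is represented by \<phi> b, so the unity is b and the sum is that of
  the ring. The product of \<phi> b and \<gamma> b has to be \<phi> \<gamma> b, which is the action
  of \<phi> on \<gamma> b and not their product in the ring.\<close>

definition scalars :: "'a ring" where
  "scalars = \<lparr>carrier = {f \<in> carrier R. proportional R b f}, mult = act, one = b, zero = \<zero>, add = add R\<rparr>"

lemma scalars_simps [simp]:
  "f \<in> carrier scalars \<longleftrightarrow> f \<in> carrier R \<and> proportional R b f"
  "mult scalars = act" "one scalars = b" "zero scalars = \<zero>" "add scalars = add R"
  by (simp_all add: scalars_def)

lemma act:
  assumes "f \<in> carrier scalars" "x \<in> carrier R"
  shows act_closed: "act f x \<in> carrier R" and act_b: "act f x \<otimes> b = x \<otimes> f"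
proof -
  have "\<exists>!g. g \<in> carrier R \<and> g \<otimes> b = x \<otimes> f"
  proof (rule ex_ex1I)
    show "\<exists>g. g \<in> carrier R \<and> g \<otimes> b = x \<otimes> f"
      using proportionalD(3)[of f x] assms by auto
    show "g = h" if "g \<in> carrier R \<and> g \<otimes> b = x \<otimes> f" "h \<in> carrier R \<and> h \<otimes> b = x \<otimes> f" for g h
      using that by (intro cancel[of g h]) simp_all
  qed
  from theI'[OF this] show "act f x \<in> carrier R" "act f x \<otimes> b = x \<otimes> f"
    by (simp_all add: act_def)
qed

lemma act_eqI:
  "\<lbrakk>f \<in> carrier scalars; x \<in> carrier R; g \<in> carrier R; g \<otimes> b = x \<otimes> f\<rbrakk> \<Longrightarrow> act f x = g"
  using act[of f x] by (intro cancel[of "act f x" g]) simp_all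

lemma proportional_b: "proportional R b b"
  by (auto simp: proportional_def)

lemma b_scalar: "b \<in> carrier scalars"
  by (simp add: b_closed proportional_b)

lemma act_scalars:
  assumes "f \<in> carrier scalars" "g \<in> carrier scalars"
  shows "act f g \<in> carrier scalars"
  using assms act[of f g] proportionalD(6)[of g f "act f g"] by simp

lemma act_comm:
  assumes "f \<in> carrier scalars" "g \<in> carrier scalars"
  shows "act f g = act g f"
  using assms act[of g f] proportionalD(5)[of f g] by (intro act_eqI) auto

lemma act_shift:
  assumes "f \<in> carrier scalars" "x \<in> carrier R" "y \<in> carrier R"
  shows "act f x \<otimes> y = x \<otimes> act f y"
  using assms act[of f x] act[of f y] proportionalD(7)[of f x y "act f x" "act f y"] by simp

text \<open>After multiplication by b the outer scalar appears as the right factor f, and the inner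
  one slides across the product onto it by \<open>act_shift\<close>. Commutativity then puts the two
  scalars in the desired order.\<close>

lemma act_act:
  assumes "f \<in> carrier scalars" "g \<in> carrier scalars" "x \<in> carrier R"
  shows "act (act f g) x = act f (act g x)"
proof (rule act_eqI)
  show "act f g \<in> carrier scalars" using assms by (intro act_scalars)
  show "act f (act g x) \<in> carrier R" using assms by (intro act_closed)
  have "act f (act g x) \<otimes> b = act g x \<otimes> f" using assms by (intro act_b act_closed)
  also have "\<dots> = x \<otimes> act g f" using assms by (intro act_shift) auto
  finally show "act f (act g x) \<otimes> b = x \<otimes> act f g" using act_comm[OF assms(1,2)] by simp
qed (use assms in simp)

lemma act_one: "x \<in> carrier R \<Longrightarrow> act b x = x"
  by (rule act_eqI[OF b_scalar]) auto

lemma act_b_scalar: "f \<in> carrier scalars \<Longrightarrow> act f b = f"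
  using act_comm[OF _ b_scalar] act_one by simp

lemma act_add_left:
  assumes "f \<in> carrier scalars" "g \<in> carrier scalars" "x \<in> carrier R"
  shows "act (f \<oplus> g) x = act f x \<oplus> act g x"
  using assms act[of f x] act[of g x] proportionalD(4)[of f g] b_closed
  by (intro act_eqI) (auto simp: distrib_left distrib_right)

lemma act_add_right:
  assumes "f \<in> carrier scalars" "x \<in> carrier R" "y \<in> carrier R"
  shows "act f (x \<oplus> y) = act f x \<oplus> act f y"
  using assms act[of f x] act[of f y] b_closed
  by (intro act_eqI) (auto simp: distrib_right)

lemma act_mult_right:
  assumes "f \<in> carrier scalars" "x \<in> carrier R" "y \<in> carrier R"
  shows "act f (x \<otimes> y) = x \<otimes> act f y"
  using assms act[of f y] b_closed
  by (intro act_eqI) (auto simp: scalar_ringD(1) mult_closed)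

lemma field_scalars: "field scalars"
proof -
  have "abelian_group scalars"
  proof (rule abelian_groupI)
    show "\<zero>\<^bsub>scalars\<^esub> \<in> carrier scalars" by (simp add: proportional_def)
    show "\<exists>g\<in>carrier scalars. g \<oplus>\<^bsub>scalars\<^esub> f = \<zero>\<^bsub>scalars\<^esub>" if "f \<in> carrier scalars" for f
      using that proportionalD(1)[of f] a_comm by auto
  qed (auto simp: proportionalD(4) a_ac)
  moreover have "comm_monoid scalars"
  proof (rule comm_monoidI)
    show "\<one>\<^bsub>scalars\<^esub> \<in> carrier scalars" using b_scalar by simp
  next
    fix f g h assume fgh: "f \<in> carrier scalars" "g \<in> carrier scalars" "h \<in> carrier scalars"
    show "f \<otimes>\<^bsub>scalars\<^esub> g \<in> carrier scalars" using act_scalars[OF fgh(1,2)] by simp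
    show "f \<otimes>\<^bsub>scalars\<^esub> g \<otimes>\<^bsub>scalars\<^esub> h = f \<otimes>\<^bsub>scalars\<^esub> (g \<otimes>\<^bsub>scalars\<^esub> h)"
      using act_act[of f g h] fgh by simp
    show "f \<otimes>\<^bsub>scalars\<^esub> g = g \<otimes>\<^bsub>scalars\<^esub> f" using act_comm[OF fgh(1,2)] by simp
    show "\<one>\<^bsub>scalars\<^esub> \<otimes>\<^bsub>scalars\<^esub> f = f" using act_one[of f] fgh by simp
  qed
  ultimately have "cring scalars"
    by (rule cringI) (simp add: act_add_left)
  then show ?thesis
  proof (rule cring.cring_fieldI2)
    show "\<zero>\<^bsub>scalars\<^esub> \<noteq> \<one>\<^bsub>scalars\<^esub>" using b_nonzero by simp
    fix f assume f: "f \<in> carrier scalars" "f \<noteq> \<zero>\<^bsub>scalars\<^esub>"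
    then obtain g where g: "g \<in> carrier scalars" "b \<otimes> b = g \<otimes> f"
      using proportionalD(2)[of f] by auto
    \<comment> \<open>The equation b b = g f is the defining equation of \<open>act f g\<close> with
      value b, and b is the unity of the field.\<close>
    then have "act f g = b" using f b_closed by (intro act_eqI) auto
    then show "\<exists>g\<in>carrier scalars. f \<otimes>\<^bsub>scalars\<^esub> g = \<one>\<^bsub>scalars\<^esub>" using g by auto
  qed
qed

end

text \<open>Definability of the scalars is automatic for the reconstructed field: an element f
  proportional to b is itself a scalar, and it acts on b with result f.\<close>

lemma scalar_domain_scalars:
  fixes B :: "'b ring"
  assumes "scalar_ring B b"
  shows "scalar_domain (scalar_ring.scalars B b) (with_smult B (scalar_ring.act B b)) b"
proof -
  interpret scalar_ring B b by fact
  have "abelian_group (with_smult B act)"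
    by (rule abelian_groupI) (use l_neg a_inv_closed in \<open>auto simp: a_ac\<close>)
  moreover have "cring scalars" using field_scalars by (simp add: field_def domain_def)
  ultimately have "Module.module scalars (with_smult B act)"
    by (intro moduleI)
      (simp_all add: act_closed act_add_left act_add_right act_act act_one)
  moreover have "assoc_nonunital_ring (with_smult B act)"
    using \<open>abelian_group (with_smult B act)\<close>
    by (intro assoc_nonunital_ring.intro nonunital_ring.intro nonunital_ring_axioms.intro
        assoc_nonunital_ring_axioms.intro)
      (simp_all add: mult_closed distrib_left distrib_right scalar_ringD(1))
  moreover have "act f x \<otimes>\<^bsub>B\<^esub> y = act f (x \<otimes>\<^bsub>B\<^esub> y)"
    if "f \<in> carrier scalars" "x \<in> carrier B" "y \<in> carrier B" for f x y
    using act_shift[OF that] act_mult_right[OF that] by simp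
  ultimately have "assoc_algebra scalars (with_smult B act)"
    by (intro assoc_algebra.intro field_scalars assoc_algebra_axioms.intro)
      (simp_all add: act_mult_right)
  moreover have "proportional (with_smult B act) b f \<longleftrightarrow> proportional B b f" for f
    by (simp add: proportional_def)
  ultimately show ?thesis
    by (intro scalar_domain.intro scalar_domain_axioms.intro)
      (use b_closed b_nonzero scalar_ringD(2) act_b_scalar in \<open>auto simp: proportional_b\<close>)
qed

section \<open>Reconstructing the letters\<close>

text \<open>The recursion copies that of \<open>Plus_block\<close>, so evaluating the term requires
  no laws of addition; in an abelian monoid it is the usual finite sum.\<close>

primrec iterated_sum :: "('a, 'm) ring_scheme \<Rightarrow> nat \<Rightarrow> (nat \<Rightarrow> 'a) \<Rightarrow> 'a" where
  "iterated_sum R 0 t = \<zero>\<^bsub>R\<^esub>"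
| "iterated_sum R (Suc n) t = t n \<oplus>\<^bsub>R\<^esub> iterated_sum R n t"

lemma iterated_sum_cong:
  "n = m \<Longrightarrow> (\<And>i. i < m \<Longrightarrow> t i = u i) \<Longrightarrow> iterated_sum R n t = iterated_sum R m u"
  by (induction n arbitrary: m) auto

lemma term_val_Plus_block [simp]:
  "term_val R v (Plus_block n t) = iterated_sum R n (\<lambda>i. term_val R v (t i))"
  by (induction n) auto

lemma (in abelian_monoid) iterated_sum_eq_finsum:
  "(\<And>i. i < n \<Longrightarrow> t i \<in> carrier G) \<Longrightarrow> iterated_sum G n t = (\<Oplus>i\<in>{..<n}. t i)"
  by (induction n) (auto simp: lessThan_Suc Pi_def)

text \<open>
  Scalars \<open>\<alpha>\<^sub>i\<close> are accessible only through \<open>a\<^sub>i = \<alpha>\<^sub>i b\<close>, so the decomposition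
  \<open>f = \<Sum> \<alpha>\<^sub>i e\<^sub>i + e\<^sub>i g\<^sub>i\<close> is stated after multiplication by \<open>b\<close> on the right.
\<close>

definition letter_system :: "('a, 'm) ring_scheme \<Rightarrow> 'a \<Rightarrow> nat \<Rightarrow> (nat \<Rightarrow> 'a) \<Rightarrow> bool" where
  "letter_system R b r e \<longleftrightarrow> (\<forall>i<r. e i \<in> carrier R) \<and>
    (\<forall>f\<in>carrier R. \<exists>a. (\<forall>i<r. a i \<in> carrier R) \<and> (\<exists>g. (\<forall>i<r. g i \<in> carrier R) \<and>
      (\<forall>i<r. proportional R b (a i)) \<and>
      f \<otimes>\<^bsub>R\<^esub> b = iterated_sum R r (\<lambda>i. e i \<otimes>\<^bsub>R\<^esub> (a i \<oplus>\<^bsub>R\<^esub> g i \<otimes>\<^bsub>R\<^esub> b)))) \<and>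
    (\<forall>a. (\<forall>i<r. a i \<in> carrier R) \<longrightarrow> (\<forall>g. (\<forall>i<r. g i \<in> carrier R) \<longrightarrow>
      (\<forall>i<r. proportional R b (a i)) \<longrightarrow>
      iterated_sum R r (\<lambda>i. e i \<otimes>\<^bsub>R\<^esub> (a i \<oplus>\<^bsub>R\<^esub> g i \<otimes>\<^bsub>R\<^esub> b)) = \<zero>\<^bsub>R\<^esub> \<longrightarrow>
      (\<forall>i<r. a i = \<zero>\<^bsub>R\<^esub> \<and> g i = \<zero>\<^bsub>R\<^esub>)))"

definition letters_at :: "('a, 'm) ring_scheme \<Rightarrow> 'a \<Rightarrow> nat \<Rightarrow> bool" where
  "letters_at R b r \<longleftrightarrow> (\<exists>e. letter_system R b r e)"

text \<open>
  Variable \<open>0\<close> is \<open>b\<close>, variable \<open>1\<close> is \<open>f\<close>, and the three blocks of \<open>r\<close> variables starting at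
  \<open>2\<close>, \<open>2 + r\<close> and \<open>2 + r + r\<close> are \<open>e\<close>, \<open>a\<close> and \<open>g\<close>.
\<close>

definition Letter_sum :: "nat \<Rightarrow> ring_term" where
  "Letter_sum r = Plus_block r (\<lambda>i. Times (Var (2 + i))
     (Plus (Var (2 + r + i)) (Times (Var (2 + r + r + i)) (Var 0))))"

definition Letters_at :: "nat \<Rightarrow> ring_formula" where
  "Letters_at r = Ex_block 2 r (Conj
     (All 1 (Ex_block (2 + r) r (Ex_block (2 + r + r) r (Conj
        (Conj_block r (\<lambda>i. Proportional 0 (2 + r + i)))
        (Eq (Times (Var 1) (Var 0)) (Letter_sum r))))))
     (All_block (2 + r) r (All_block (2 + r + r) r (Imp
        (Conj_block r (\<lambda>i. Proportional 0 (2 + r + i)))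
        (Imp (Eq (Letter_sum r) Zero)
        (Conj_block r (\<lambda>i. Conj (Eq (Var (2 + r + i)) Zero) (Eq (Var (2 + r + r + i)) Zero))))))))"

lemma satisfies_Letters_at: "satisfies R v (Letters_at r) \<longleftrightarrow> letters_at R (v 0) r"
proof -
  \<comment> \<open>These are the assignments reached under the quantifiers of the existence and of
    the uniqueness clause; only the former binds variable 1. The three blocks are disjoint and avoid
    variables 0 and 1, so later updates leave earlier values intact.\<close>
  let ?u = "\<lambda>e f a g. upd_block (upd_block ((upd_block v 2 r e)(1 := f)) (2 + r) r a) (2 + r + r) r g"
  let ?w = "\<lambda>e a g. upd_block (upd_block (upd_block v 2 r e) (2 + r) r a) (2 + r + r) r g"
  have u: "?u e f a g 0 = v 0" "?u e f a g 1 = f"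
    "i < r \<Longrightarrow> ?u e f a g (2 + i) = e i"
    "i < r \<Longrightarrow> ?u e f a g (2 + r + i) = a i"
    "i < r \<Longrightarrow> ?u e f a g (2 + r + r + i) = g i" for e f a g i
    by (simp_all add: upd_block_def)
  have w: "?w e a g 0 = v 0"
    "i < r \<Longrightarrow> ?w e a g (2 + i) = e i"
    "i < r \<Longrightarrow> ?w e a g (2 + r + i) = a i"
    "i < r \<Longrightarrow> ?w e a g (2 + r + r + i) = g i" for e a g i
    by (simp_all add: upd_block_def)
  show ?thesis
    unfolding Letters_at_def letters_at_def letter_system_def Letter_sum_def
    by (simp only: satisfies_Ex_block satisfies_All_block satisfies_Conj_block satisfies.simps
        satisfies_connectives satisfies_Proportional term_val.simps term_val_Plus_block u w
        cong: iterated_sum_cong conj_cong imp_cong)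
qed

lemma free_vars_Letters_at: "free_vars (Letters_at r) \<subseteq> {0}"
  by (auto simp: Letters_at_def Letter_sum_def)

text \<open>The formula can only speak of letters numbered below r, whereas the free algebra has
  letters indexed by \<open>Xs\<close>. The passage is made once for the free algebra and once,
  backwards, for B.\<close>

lemma letter_algebra_reindex:
  fixes K (structure) and A (structure)
  assumes "letter_algebra K A I e" and h: "bij_betw h J I"
  shows "letter_algebra K A J (e \<circ> h)"
proof -
  interpret letter_algebra K A I e by fact
  have I: "h ` J = I" "inj_on h J" using h by (auto simp: bij_betw_def)
  have hI: "h j \<in> I" if "j \<in> J" for j using I that by auto
  have sum: "letter_sum A (e \<circ> h) J (\<alpha> \<circ> h) (g \<circ> h) = letter_sum A e I \<alpha> g"
    if "admissible \<alpha> g" for \<alpha> g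
  proof -
    have "(\<Oplus>\<^bsub>A\<^esub>x\<in>h ` J. \<alpha> x \<odot>\<^bsub>A\<^esub> e x \<oplus>\<^bsub>A\<^esub> e x \<otimes>\<^bsub>A\<^esub> g x) =
        (\<Oplus>\<^bsub>A\<^esub>j\<in>J. \<alpha> (h j) \<odot>\<^bsub>A\<^esub> e (h j) \<oplus>\<^bsub>A\<^esub> e (h j) \<otimes>\<^bsub>A\<^esub> g (h j))"
      using admissibleD(3)[OF that] I by (intro M.finsum_reindex) auto
    then show ?thesis by (simp add: letter_sum_def I(1))
  qed
  show ?thesis
  proof (intro letter_algebra.intro letter_algebra_axioms.intro assoc_algebra_axioms)
    show "finite J" using bij_betw_finite[OF h] finite_letters by simp
    show "(e \<circ> h) j \<in> carrier A" if "j \<in> J" for j using hI[OF that] letter_closed by simp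
  next
    fix f assume "f \<in> carrier A"
    then obtain \<alpha> g where ag: "admissible \<alpha> g" "f = letter_sum A e I \<alpha> g"
      using letter_sum_exists[of f] unfolding admissible_def by blast
    show "\<exists>\<alpha> g. (\<forall>j\<in>J. \<alpha> j \<in> carrier K \<and> g j \<in> carrier A) \<and> f = letter_sum A (e \<circ> h) J \<alpha> g"
      using ag sum[OF ag(1)] hI
      by (intro exI[of _ "\<alpha> \<circ> h"] exI[of _ "g \<circ> h"]) (simp add: admissible_def)
  next
    fix \<alpha> g j
    assume \<alpha>: "\<And>j. j \<in> J \<Longrightarrow> \<alpha> j \<in> carrier K" and g: "\<And>j. j \<in> J \<Longrightarrow> g j \<in> carrier A"
      and 0: "letter_sum A (e \<circ> h) J \<alpha> g = \<zero>\<^bsub>A\<^esub>" and j: "j \<in> J"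
    define k where "k = inv_into J h"
    have kh: "k (h j) = j" if "j \<in> J" for j using I(2) that by (simp add: k_def)
    have kI: "k x \<in> J" if "x \<in> I" for x using I(1) that inv_into_into[of x h J] by (simp add: k_def)
    have adm: "admissible (\<alpha> \<circ> k) (g \<circ> k)" using \<alpha> g kI by (simp add: admissible_def)
    \<comment> \<open>The inverse \<open>k\<close> undoes \<open>h\<close> only on J, so the
      coefficient families agree there and not as functions; the sum sees only J.\<close>
    have "letter_sum A (e \<circ> h) J (\<alpha> \<circ> k \<circ> h) (g \<circ> k \<circ> h) = letter_sum A (e \<circ> h) J \<alpha> g"
      unfolding letter_sum_def
      by (rule M.finsum_cong') (use \<alpha> g hI letter_closed kh in \<open>auto simp: mult_closed\<close>)
    then have "letter_sum A e I (\<alpha> \<circ> k) (g \<circ> k) = \<zero>\<^bsub>A\<^esub>" using sum[OF adm] 0 by simp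
    from letter_sum_zero[OF _ _ this hI[OF j]]
    have "(\<alpha> \<circ> k) (h j) = \<zero> \<and> (g \<circ> k) (h j) = \<zero>\<^bsub>A\<^esub>"
      using adm by (simp add: admissible_def)
    then show "\<alpha> j = \<zero> \<and> g j = \<zero>\<^bsub>A\<^esub>" using kh[OF j] by simp
  qed
qed

text \<open>Writing a_i = \<alpha>_i b, bilinearity gives e_i (a_i + g_i b) = (\<alpha>_i e_i + e_i
  g_i) b. Hence the formula is the letter decomposition multiplied by b, and integrality allows b to
  be cancelled.\<close>

lemma (in scalar_domain) letters_at_iff:
  "letters_at A b r \<longleftrightarrow> (\<exists>e. letter_algebra K A {..<r} e)"
proof -
  have pI: "proportional A b (a \<odot>\<^bsub>A\<^esub> b)" if "a \<in> carrier K" for a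
    using proportional_iff[OF smult_closed[OF that b_closed]] that by blast
  have sum: "iterated_sum A r (\<lambda>i. e i \<otimes>\<^bsub>A\<^esub> (a i \<oplus>\<^bsub>A\<^esub> g i \<otimes>\<^bsub>A\<^esub> b)) = letter_sum A e {..<r} \<alpha> g \<otimes>\<^bsub>A\<^esub> b"
    if "\<And>i. i < r \<Longrightarrow> e i \<in> carrier A" "\<And>i. i < r \<Longrightarrow> \<alpha> i \<in> carrier K" "\<And>i. i < r \<Longrightarrow> g i \<in> carrier A"
      "\<And>i. i < r \<Longrightarrow> a i = \<alpha> i \<odot>\<^bsub>A\<^esub> b" for e \<alpha> g a
  proof -
    have c: "e i \<otimes>\<^bsub>A\<^esub> (a i \<oplus>\<^bsub>A\<^esub> g i \<otimes>\<^bsub>A\<^esub> b) \<in> carrier A" if "i < r" for i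
      using that \<open>\<And>i. i < r \<Longrightarrow> e i \<in> carrier A\<close> \<open>\<And>i. i < r \<Longrightarrow> \<alpha> i \<in> carrier K\<close>
        \<open>\<And>i. i < r \<Longrightarrow> g i \<in> carrier A\<close> \<open>\<And>i. i < r \<Longrightarrow> a i = \<alpha> i \<odot>\<^bsub>A\<^esub> b\<close> b_closed
      by (simp add: mult_closed)
    have "iterated_sum A r (\<lambda>i. e i \<otimes>\<^bsub>A\<^esub> (a i \<oplus>\<^bsub>A\<^esub> g i \<otimes>\<^bsub>A\<^esub> b)) =
        (\<Oplus>\<^bsub>A\<^esub>i\<in>{..<r}. e i \<otimes>\<^bsub>A\<^esub> (a i \<oplus>\<^bsub>A\<^esub> g i \<otimes>\<^bsub>A\<^esub> b))"
      by (rule M.iterated_sum_eq_finsum) (rule c)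
    also have "\<dots> = (\<Oplus>\<^bsub>A\<^esub>i\<in>{..<r}. (\<alpha> i \<odot>\<^bsub>A\<^esub> e i \<oplus>\<^bsub>A\<^esub> e i \<otimes>\<^bsub>A\<^esub> g i) \<otimes>\<^bsub>A\<^esub> b)"
      by (rule M.finsum_cong')
        (use that b_closed in \<open>auto simp: mult_closed distrib_left distrib_right smult_mult_left
          smult_mult_right mult_assoc\<close>)
    also have "\<dots> = letter_sum A e {..<r} \<alpha> g \<otimes>\<^bsub>A\<^esub> b"
      unfolding letter_sum_def
      by (rule finsum_mult_right[symmetric]) (use that b_closed in \<open>auto simp: mult_closed\<close>)
    finally show ?thesis .
  qed
  have sum_closed: "letter_sum A e {..<r} \<alpha> g \<in> carrier A"
    if "\<And>i. i < r \<Longrightarrow> e i \<in> carrier A" "\<And>i. i < r \<Longrightarrow> \<alpha> i \<in> carrier K" "\<And>i. i < r \<Longrightarrow> g i \<in> carrier A"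
    for e \<alpha> g
    unfolding letter_sum_def by (rule M.finsum_closed) (use that in \<open>auto simp: mult_closed\<close>)
  have scal: "\<exists>\<alpha>. \<forall>i<r. \<alpha> i \<in> carrier K \<and> a i = \<alpha> i \<odot>\<^bsub>A\<^esub> b"
    if "\<forall>i<r. a i \<in> carrier A" "\<forall>i<r. proportional A b (a i)" for a :: "nat \<Rightarrow> 'c"
  proof -
    have "\<forall>i\<in>{..<r}. \<exists>x. x \<in> carrier K \<and> a i = x \<odot>\<^bsub>A\<^esub> b"
    proof
      fix i assume "i \<in> {..<r}"
      then have "a i \<in> carrier A" "proportional A b (a i)" using that by simp_all
      then show "\<exists>x. x \<in> carrier K \<and> a i = x \<odot>\<^bsub>A\<^esub> b" using proportional_iff[of "a i"] by blast
    qed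
    from bchoice[OF this] show ?thesis by (simp add: Ball_def)
  qed
  show ?thesis
  proof
    assume "letters_at A b r"
    then obtain e where sys: "letter_system A b r e" unfolding letters_at_def by (rule exE)
    note sys = sys[unfolded letter_system_def]
    note e = conjunct1[OF sys] and ex = bspec[OF conjunct1[OF conjunct2[OF sys]]]
      and uniq = conjunct2[OF conjunct2[OF sys], rule_format]
    have "letter_algebra K A {..<r} e"
    proof (intro letter_algebra.intro letter_algebra_axioms.intro assoc_algebra_axioms)
      show "e i \<in> carrier A" if "i \<in> {..<r}" for i using e that by simp
      fix f assume f: "f \<in> carrier A"
      obtain a g where a: "\<forall>i<r. a i \<in> carrier A" "\<forall>i<r. proportional A b (a i)"
        and g: "\<forall>i<r. g i \<in> carrier A"
        and eq: "f \<otimes>\<^bsub>A\<^esub> b = iterated_sum A r (\<lambda>i. e i \<otimes>\<^bsub>A\<^esub> (a i \<oplus>\<^bsub>A\<^esub> g i \<otimes>\<^bsub>A\<^esub> b))"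
        using ex[OF f] by blast
      obtain \<alpha> where \<alpha>: "\<forall>i<r. \<alpha> i \<in> carrier K \<and> a i = \<alpha> i \<odot>\<^bsub>A\<^esub> b" using scal[OF a] by blast
      have "f \<otimes>\<^bsub>A\<^esub> b = letter_sum A e {..<r} \<alpha> g \<otimes>\<^bsub>A\<^esub> b"
        unfolding eq by (rule sum) (use e g \<alpha> in auto)
      then have "f = letter_sum A e {..<r} \<alpha> g"
        by (intro cancel_right[of f "letter_sum A e {..<r} \<alpha> g"] f sum_closed) (use e g \<alpha> in auto)
      then show "\<exists>\<alpha> g. (\<forall>i\<in>{..<r}. \<alpha> i \<in> carrier K \<and> g i \<in> carrier A) \<and> f = letter_sum A e {..<r} \<alpha> g"
        using \<alpha> g by (intro exI[of _ \<alpha>] exI[of _ g]) simp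
    next
      fix \<alpha> g i
      assume "\<And>i. i \<in> {..<r} \<Longrightarrow> \<alpha> i \<in> carrier K" "\<And>i. i \<in> {..<r} \<Longrightarrow> g i \<in> carrier A"
        and 0: "letter_sum A e {..<r} \<alpha> g = \<zero>\<^bsub>A\<^esub>" and "i \<in> {..<r}"
      then have \<alpha>: "\<forall>i<r. \<alpha> i \<in> carrier K" and g: "\<forall>i<r. g i \<in> carrier A" and i: "i < r" by auto
      have "iterated_sum A r (\<lambda>i. e i \<otimes>\<^bsub>A\<^esub> (\<alpha> i \<odot>\<^bsub>A\<^esub> b \<oplus>\<^bsub>A\<^esub> g i \<otimes>\<^bsub>A\<^esub> b)) =
          letter_sum A e {..<r} \<alpha> g \<otimes>\<^bsub>A\<^esub> b"
        by (rule sum) (use e \<alpha> g in auto)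
      also have "\<dots> = \<zero>\<^bsub>A\<^esub>" unfolding 0 using b_closed by simp
      finally have "\<alpha> i \<odot>\<^bsub>A\<^esub> b = \<zero>\<^bsub>A\<^esub> \<and> g i = \<zero>\<^bsub>A\<^esub>"
        by (intro uniq[where a = "\<lambda>i. \<alpha> i \<odot>\<^bsub>A\<^esub> b"]) (use \<alpha> g pI b_closed i in simp_all)
      then show "\<alpha> i = \<zero> \<and> g i = \<zero>\<^bsub>A\<^esub>"
        using smult_inj[of "\<alpha> i" \<zero> b] \<alpha> i b_closed b_nonzero by simp
    qed simp
    then show "\<exists>e. letter_algebra K A {..<r} e" by blast
  next
    assume "\<exists>e. letter_algebra K A {..<r} e"
    then obtain e where "letter_algebra K A {..<r} e" by (rule exE)
    then interpret L: letter_algebra K A "{..<r}" e .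
    have e: "\<forall>i<r. e i \<in> carrier A" using L.letter_closed by simp
    show "letters_at A b r"
      unfolding letters_at_def letter_system_def
    proof (rule exI[of _ e], intro conjI ballI allI impI)
      fix f assume "f \<in> carrier A"
      then obtain \<alpha> g where ag: "\<forall>i\<in>{..<r}. \<alpha> i \<in> carrier K \<and> g i \<in> carrier A" "f = letter_sum A e {..<r} \<alpha> g"
        using L.letter_sum_exists by blast
      have "f \<otimes>\<^bsub>A\<^esub> b = iterated_sum A r (\<lambda>i. e i \<otimes>\<^bsub>A\<^esub> (\<alpha> i \<odot>\<^bsub>A\<^esub> b \<oplus>\<^bsub>A\<^esub> g i \<otimes>\<^bsub>A\<^esub> b))"
        unfolding ag(2) by (rule sum[symmetric]) (use e ag(1) in auto)
      then show "\<exists>a. (\<forall>i<r. a i \<in> carrier A) \<and> (\<exists>g. (\<forall>i<r. g i \<in> carrier A) \<and>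
          (\<forall>i<r. proportional A b (a i)) \<and>
          f \<otimes>\<^bsub>A\<^esub> b = iterated_sum A r (\<lambda>i. e i \<otimes>\<^bsub>A\<^esub> (a i \<oplus>\<^bsub>A\<^esub> g i \<otimes>\<^bsub>A\<^esub> b)))"
        using ag(1) b_closed pI
        by (intro exI[of _ "\<lambda>i. \<alpha> i \<odot>\<^bsub>A\<^esub> b"] conjI exI[of _ g]) simp_all
    next
      fix a g i
      assume a: "\<forall>i<r. a i \<in> carrier A" "\<forall>i<r. proportional A b (a i)" and g: "\<forall>i<r. g i \<in> carrier A"
        and 0: "iterated_sum A r (\<lambda>i. e i \<otimes>\<^bsub>A\<^esub> (a i \<oplus>\<^bsub>A\<^esub> g i \<otimes>\<^bsub>A\<^esub> b)) = \<zero>\<^bsub>A\<^esub>" and i: "i < r"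
      obtain \<alpha> where \<alpha>: "\<forall>i<r. \<alpha> i \<in> carrier K \<and> a i = \<alpha> i \<odot>\<^bsub>A\<^esub> b" using scal[OF a] by blast
      have "letter_sum A e {..<r} \<alpha> g \<otimes>\<^bsub>A\<^esub> b = \<zero>\<^bsub>A\<^esub>"
        unfolding 0[symmetric] by (rule sum[symmetric]) (use e g \<alpha> in auto)
      moreover have "letter_sum A e {..<r} \<alpha> g \<in> carrier A"
        by (rule sum_closed) (use e g \<alpha> in auto)
      ultimately have "letter_sum A e {..<r} \<alpha> g = \<zero>\<^bsub>A\<^esub>"
        using integral b_closed b_nonzero by blast
      then have *: "\<alpha> i = \<zero> \<and> g i = \<zero>\<^bsub>A\<^esub>"
        by (intro L.letter_sum_zero) (use g \<alpha> i in auto)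
      then show "a i = \<zero>\<^bsub>A\<^esub>" "g i = \<zero>\<^bsub>A\<^esub>" using \<alpha> i b_closed by auto
    qed (use e in simp)
  qed
qed

lemma letters_at_with_smult [simp]: "letters_at (with_smult R s) b r \<longleftrightarrow> letters_at R b r"
proof -
  have "iterated_sum (with_smult R s) n t = iterated_sum R n t" for n t
    by (induction n) auto
  then show ?thesis by (simp add: letters_at_def letter_system_def proportional_def)
qed

section \<open>Rings elementarily equivalent to a free algebra\<close>

theorem theorem9p8:
  fixes K :: "('k, 'm) ring_scheme" and Xs :: "'x set" and r :: nat and B :: "'b ring"
  assumes "field K"
    and "finite Xs" and "card Xs = r" and "r \<ge> 1"
    and "nonunital_ring B"
    and "B \<equiv>\<^sub>e free_algebra K Xs"
  shows "\<exists>(K1 :: 'b ring) (s :: 'b \<Rightarrow> 'b \<Rightarrow> 'b).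
           field K1 \<and> assoc_algebra K1 (with_smult B s) \<and>
           K1 \<equiv>\<^sub>e K \<and>
           (\<forall>n\<ge>1. B Quot (ring_power B n) \<equiv>\<^sub>e free_nilpotent_algebra K1 Xs n) \<and>
           (residually_nilpotent B \<longrightarrow> para_free K1 Xs (with_smult B s))"
proof -
  let ?F = "free_algebra K Xs"
  interpret K: field K by fact
  interpret B: nonunital_ring B by fact
  have "Xs \<noteq> {}" using assms(3,4) by auto
  obtain h where h: "bij_betw h {..<r} Xs"
    using ex_bij_betw_nat_finite[OF assms(2)] unfolding assms(3) atLeast0LessThan by blast
  have F: "scalar_domain K ?F x" if "x \<in> carrier ?F" "x \<noteq> \<zero>\<^bsub>?F\<^esub>" for x
    using K.free_algebra_scalar_domain[OF \<open>Xs \<noteq> {}\<close> that] .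
  \<comment> \<open>B must contain a nonzero element to play the role of b. Its existence is a
    first-order sentence, witnessed in the free algebra by any letter.\<close>
  have "\<exists>x\<in>carrier ?F. x \<noteq> \<zero>\<^bsub>?F\<^esub>"
  proof -
    obtain y where y: "y \<in> Xs" using \<open>Xs \<noteq> {}\<close> by auto
    have "K.letter y [y] \<noteq> \<zero>\<^bsub>?F\<^esub> [y]" by (simp add: K.letter_def free_algebra_simps)
    then show ?thesis using K.letter_in_free_algebra[OF y] by metis
  qed
  then have "holds_in ?F (Ex 0 (Neg (Eq (Var 0) Zero)))" by (simp add: holds_in_def)
  moreover have "free_vars (Ex 0 (Neg (Eq (Var 0) Zero))) = {}" by simp
  ultimately have "holds_in B (Ex 0 (Neg (Eq (Var 0) Zero)))"
    using assms(6) unfolding elementarily_equivalent_def by blast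
  then have "satisfies B (\<lambda>_. \<zero>\<^bsub>B\<^esub>) (Ex 0 (Neg (Eq (Var 0) Zero)))"
    unfolding holds_in_def by (auto simp del: satisfies.simps satisfies_connectives)
  then obtain b where b: "b \<in> carrier B" "b \<noteq> \<zero>\<^bsub>B\<^esub>" by auto
  have "satisfies B (\<lambda>_. b) Scalar_axioms"
  proof (rule elementarily_equivalent_transfer[OF assms(6) free_vars_Scalar_axioms])
    fix x assume x: "x \<in> carrier ?F" "x \<noteq> \<zero>\<^bsub>?F\<^esub>"
    interpret scalar_domain K ?F x using F[OF x] .
    show "\<exists>v. v 0 = x \<and> satisfies ?F v Scalar_axioms"
      using scalar_axioms by (intro exI[of _ "\<lambda>_. x"]) (simp add: satisfies_Scalar_axioms)
  qed (use b in simp_all)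
  then have "scalar_ring B b"
    by (intro scalar_ring.intro scalar_ring_axioms.intro assms(5) b)
      (simp add: B.satisfies_Scalar_axioms)
  then interpret B: scalar_ring B b .
  let ?K1 = B.scalars and ?A = "with_smult B B.act"
  interpret A: scalar_domain ?K1 ?A b by (rule scalar_domain_scalars) fact
  have "satisfies B (\<lambda>_. b) (Letters_at r)"
  proof (rule elementarily_equivalent_transfer[OF assms(6) free_vars_Letters_at])
    fix x assume x: "x \<in> carrier ?F" "x \<noteq> \<zero>\<^bsub>?F\<^esub>"
    interpret scalar_domain K ?F x using F[OF x] .
    have "letter_algebra K ?F {..<r} (K.letter \<circ> h)"
      by (rule letter_algebra_reindex[OF K.free_algebra_letter_algebra[OF assms(2)] h])
    then have "letters_at ?F x r" using letters_at_iff by blast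
    then show "\<exists>v. v 0 = x \<and> satisfies ?F v (Letters_at r)"
      by (intro exI[of _ "\<lambda>_. x"]) (simp add: satisfies_Letters_at)
  qed (use b in simp_all)
  then have "letters_at ?A b r" by (simp add: satisfies_Letters_at)
  then obtain e where e: "letter_algebra ?K1 ?A {..<r} e" using A.letters_at_iff by blast
  \<comment> \<open>The transferred letters are numbered; reindexing along the inverse of
    \<open>h\<close> attaches them to \<open>Xs\<close>, so that words over \<open>Xs\<close> serve
    as coordinates on both sides.\<close>
  interpret A: letter_algebra ?K1 ?A Xs "e \<circ> inv_into {..<r} h"
    by (rule letter_algebra_reindex[OF e bij_betw_inv_into[OF h]])
  let ?F1 = "free_algebra ?K1 Xs"
  interpret F1: letter_algebra ?K1 ?F1 Xs "field.letter ?K1"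
    by (rule field.free_algebra_letter_algebra[OF B.field_scalars assms(2)])
  have "?K1 \<equiv>\<^sub>e K"
    by (rule scalar_fields_elementarily_equivalent[OF A.scalar_domain_axioms F])
      (use assms in simp_all)
  \<comment> \<open>Both quotients are elementarily equivalent to the same truncated algebra over
    the reconstructed field, hence to each other.\<close>
  moreover have "B Quot ring_power B n \<equiv>\<^sub>e free_nilpotent_algebra ?K1 Xs n" if "n \<ge> 1" for n
    using A.quotient_isomorphic_truncated(3)[OF that] F1.quotient_isomorphic_truncated(3)[OF that]
    by (simp add: free_nilpotent_algebra_def quotient_algebra_def)
      (simp add: elementarily_equivalent_def)
  moreover have "algebra_isomorphic ?K1 (quotient_algebra ?A (ring_power ?A n))
      (free_nilpotent_algebra ?K1 Xs n)" if "n \<ge> 1" for n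
    unfolding free_nilpotent_algebra_def
    by (rule algebra_isomorphic_trans[OF A.quotient_isomorphic_truncated(1)[OF that]
          F1.quotient_isomorphic_truncated(2)[OF that]])
  ultimately show ?thesis
    using B.field_scalars A.assoc_algebra_axioms
    by (intro exI[of _ ?K1] exI[of _ B.act]) (simp add: para_free_def)
qed


end
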